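(* Let $n\ge 1$ be an integer, $0<\alpha<1$, and $\kappa_{n,\alpha}=\omega_n^{\frac{n-\alpha}{n}}\big(2P_\alpha(\mathbb B^n)\big)^{-1}$. Then: (i) The analytic inequality $$\|f\|_{L^{\frac{n}{n-\alpha}}}\le \kappa_{n,\alpha}\left(\int_0^\infty \big(\mathrm{cap}(\{x\in\mathbb R^n: |f(x)|\ge t\};\dot{\Lambda}_\alpha^{1,1})\big)^{\frac{n}{n-\alpha}}\,dt^{\frac{n}{n-\alpha}}\right)^{\frac{n-\alpha}{n}}\quad\text{for all } f\in C_0^\infty \tag{A}$$ is equivalent to the geometric inequality $$\big(V(O)\big)^{\frac{n-\alpha}{n}}\le \kappa_{n,\alpha}\,\mathrm{cap}(\overline{O};\dot{\Lambda}_\alpha^{1,1})\quad\text{for all bounded domains } O\subset\mathbb R^n \text{ with } C^\infty \text{ boundary } \partial O. \tag{B}$$ Moreover, both (A) and (B) are true and sharp. (ii) The analytic inequality $$\left(\int_0^\infty \big(\mathrm{cap}(\{x\in\mathbb R^n: |f(x)|\ge t\};\dot{\Lambda}_\alpha^{1,1})\big)^{\frac{n}{n-\alpha}}\,dt^{\frac{n}{n-\alpha}}\right)^{\frac{n-\alpha}{n}}\le \|f\|_{\dot{\Lambda}_\alpha^{1,1}}\quad\text{for all } f\in C_0^\infty \tag{C}$$ is equivalent to the geometric inequality $$\mathrm{cap}(\overline{O};\dot{\Lambda}_\alpha^{1,1})\le 2P_\alpha(O)\quad\text{for all bounded domains } O\subset\mathbb R^n \text{ with } C^\infty \text{ boundary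 } \partial O. \tag{D}$$ Moreover, both (C) and (D) are true and sharp. Here "sharp" means that the multiplicative constant on the right-hand side ($\kappa_{n,\alpha}$ in (A) and (B), $1$ in (C), $2$ in (D)) cannot be replaced by any smaller constant.
   Context: $C_0^\infty$ is the class of all smooth (real-valued) functions with compact support in $\mathbb R^n$, and $1_E$ is the indicator function of a set $E\subset\mathbb R^n$. $V$ denotes Lebesgue measure (volume) on $\mathbb R^n$, $\mathbb B^n$ is the unit ball of $\mathbb R^n$, and $\omega_n=V(\mathbb B^n)$. For $f\in C_0^\infty$, $$\|f\|_{\dot{\Lambda}_\alpha^{1,1}}=\int_{\mathbb R^n}\left(\int_{\mathbb R^n}|f(x+h)-f(x)|\,dx\right)\frac{dh}{|h|^{n+\alpha}}.$$ The fractional Sobolev capacity of a compact set $K\subset\mathbb R^n$ is $$\mathrm{cap}(K;\dot{\Lambda}_\alpha^{1,1})=\inf\big\{\|f\|_{\dot{\Lambda}_\alpha^{1,1}}:\ f\in C_0^\infty,\ f\ge 1_K\big\}.$$ The fractional $\alpha$-perimeter of a (measurable) set $E\subset\mathbb R^n$, with $E^c=\mathbb R^n\setminus E$, is $$P_\alpha(E)=\int_E\int_{E^c}\frac{dx\,dy}{|x-y|^{n+\alpha}}.$$ The notation $dt^{\frac{n}{n-\alpha}}$ means $\frac{n}{n-\alpha}\,t^{\frac{\alpha}{n-\alpha}}\,dt$. A domain is a connected open set, and $\overline O$ is the closure of $O$. *)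

theory Defs
  imports "HOL-Analysis.Analysis"
begin

(* Meant for open U: all iterated directional derivatives of order at most k exist
   and are continuous on U. *)
primrec Ck_on :: "nat \<Rightarrow> 'a::euclidean_space set \<Rightarrow> ('a \<Rightarrow> real) \<Rightarrow> bool" where
  "Ck_on 0 U f \<longleftrightarrow> continuous_on U f"
| "Ck_on (Suc k) U f \<longleftrightarrow>
     (\<forall>x\<in>U. f differentiable (at x)) \<and>
     (\<forall>v. Ck_on k U (\<lambda>x. frechet_derivative f (at x) v))"

definition smooth_on :: "'a::euclidean_space set \<Rightarrow> ('a \<Rightarrow> real) \<Rightarrow> bool" where
  "smooth_on U f \<longleftrightarrow> (\<forall>k. Ck_on k U f)"

definition test_functions :: "('a::euclidean_space \<Rightarrow> real) set" where
  "test_functions = {f. smooth_on UNIV f \<and> compact (closure {x. f x \<noteq> 0})}"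

(* Near each boundary point, S is the sublevel set of a smooth function without critical
   points; by the implicit function theorem this says that S lies locally on one side of
   the graph of a smooth function, the graph being the boundary of S. *)
definition smooth_boundary :: "'a::euclidean_space set \<Rightarrow> bool" where
  "smooth_boundary S \<longleftrightarrow>
     (\<forall>p\<in>frontier S. \<exists>U \<phi>. open U \<and> p \<in> U \<and> smooth_on U \<phi> \<and>
        (\<forall>x\<in>U. frechet_derivative \<phi> (at x) \<noteq> (\<lambda>v. 0)) \<and>
        S \<inter> U = {x\<in>U. \<phi> x < 0} \<and> frontier S \<inter> U = {x\<in>U. \<phi> x = 0})"

definition smooth_domains :: "'a::euclidean_space set set" where
  "smooth_domains = {S. open S \<and> connected S \<and> bounded S \<and> smooth_boundary S}"

(* Power of an extended nonnegative number; only meant for exponents p > 0. *)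
definition ennpowr :: "ennreal \<Rightarrow> real \<Rightarrow> ennreal" where
  "ennpowr x p = (if x = \<infinity> then \<infinity> else ennreal (enn2real x powr p))"

definition Lp_norm :: "real \<Rightarrow> ('a::euclidean_space \<Rightarrow> real) \<Rightarrow> ennreal" where
  "Lp_norm p f = ennpowr (\<integral>\<^sup>+x. ennreal (\<bar>f x\<bar> powr p) \<partial>lborel) (1 / p)"

definition sobolev_norm :: "real \<Rightarrow> (real ^ 'n \<Rightarrow> real) \<Rightarrow> ennreal" where
  "sobolev_norm \<alpha> f =
     (\<integral>\<^sup>+h. (\<integral>\<^sup>+x. ennreal \<bar>f (x + h) - f x\<bar> \<partial>lborel)
        * ennreal (1 / norm h powr (real CARD('n) + \<alpha>)) \<partial>lborel)"

definition sobolev_cap :: "real \<Rightarrow> (real ^ 'n) set \<Rightarrow> ennreal" where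
  "sobolev_cap \<alpha> K =
     (INF f\<in>{f\<in>test_functions. \<forall>x. indicator K x \<le> f x}. sobolev_norm \<alpha> f)"

definition perimeter :: "real \<Rightarrow> (real ^ 'n) set \<Rightarrow> ennreal" where
  "perimeter \<alpha> E =
     (\<integral>\<^sup>+x\<in>E. (\<integral>\<^sup>+y\<in>-E. ennreal (1 / norm (x - y) powr (real CARD('n) + \<alpha>)) \<partial>lborel) \<partial>lborel)"

(* With p = n / (n - \<alpha>), the weight p t^(p - 1) is that of the measure dt^p, and
   1 / p = (n - \<alpha>) / n. *)
definition cap_integral :: "real \<Rightarrow> (real ^ 'n \<Rightarrow> real) \<Rightarrow> ennreal" where
  "cap_integral \<alpha> f =
     (let n = real CARD('n); p = n / (n - \<alpha>) in
      ennpowr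
        (\<integral>\<^sup>+t\<in>{0<..}. ennpowr (sobolev_cap \<alpha> {x. t \<le> \<bar>f x\<bar>}) p
           * ennreal (p * t powr (\<alpha> / (n - \<alpha>))) \<partial>lborel)
        ((n - \<alpha>) / n))"

definition kappa :: "'n::finite itself \<Rightarrow> real \<Rightarrow> ennreal" where
  "kappa _ \<alpha> =
     (let n = real CARD('n); B = ball (0 :: real ^ 'n) 1 in
      ennpowr (emeasure lborel B) ((n - \<alpha>) / n) / (2 * perimeter \<alpha> B))"

end

theory Submission
  imports Defs "HOL-Complex_Analysis.Great_Picard"
begin

text \<open>All four inequalities are proved outright, so the equivalences are immediate. Write
  \<open>gagliardo \<alpha> f\<close> for the double integral of \<open>|f x - f y| / |x - y|^(n + \<alpha>)\<close>; it equals the Sobolev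
  norm, and twice the \<open>\<alpha>\<close>-perimeter when \<open>f\<close> is an indicator function.

  (B) and (A): polarization with respect to a hyperplane does not increase \<open>gagliardo\<close>. Among all
  functions with values in \<open>[0, 1]\<close>, a given modulus of continuity, a given support radius, at
  least a given volume on which they equal 1, and at most a given \<open>gagliardo\<close> value, there is one with
  least moment of inertia (Arzela-Ascoli and Fatou). It is its own polarization for
  every half-space containing 0 in its interior, hence radially decreasing, so its level sets are
  balls, and the coarea formula bounds \<open>gagliardo\<close> from below. This is (B) for arbitrary bounded Borel
  sets; applied to level sets it gives (A) by the layer cake formula.

  (D): near the closure of \<open>S\<close> there is a Lipschitz field \<open>X\<close> pointing outward on the boundary. For
  small \<open>e > 0\<close> the preimage of \<open>S\<close> under \<open>x - e X x\<close> is an open neighbourhood of the closure of \<open>S\<close>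
  whose perimeter exceeds that of \<open>S\<close> at most by a factor tending to 1, and mollified indicators of
  this preimage are admissible for the capacity.

  (C): cut \<open>|f|\<close> into slabs. Each slab, divided by its height and mollified, is admissible for the
  capacity of the level set at its upper end, and the slabs add up to at most \<open>gagliardo\<close> of \<open>|f|\<close>;
  hence no regularity of the level sets is needed.

  Balls, and mollified indicators of balls, show that the constants are sharp.\<close>

section \<open>Lipschitz images and the Gagliardo seminorm\<close>

text \<open>The constraints of the minimisation survive both polarization and pointwise limits:
  bounds, modulus and support give compactness, volume and seminorm pass to limits by
  semicontinuity. This replaces the symmetric decreasing rearrangement, usually reached as a limit
  of infinitely many polarizations: here a single polarization is applied to a function that is
  already optimal. Continuity of the competitors turns equality of integrals into equality at every
  point. The value of \<open>kappa\<close> is the one for which balls give equality: a ball of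
  radius \<open>r\<close> has volume \<open>\<omega> r^n\<close> and indicator seminorm
  \<open>2 P r^(n - \<alpha>)\<close>, so the radius cancels. In (D) an admissible function must be
  at least 1 on the closure of \<open>S\<close>, so \<open>S\<close> has to be enlarged at almost no
  cost in perimeter; dilations do this only for star-shaped domains, hence the map
  \<open>x - e X x\<close>. In (C) the powers enter through convexity of \<open>t powr p\<close>:
  capacities of level sets decrease in the level, and for decreasing \<open>c\<close> the integral
  of \<open>c^p\<close> against \<open>dt^p\<close> is at most the \<open>p\<close>-th power of the
  integral of \<open>c\<close>.\<close>

abbreviation (input) nn_integral_lborel :: "('a::euclidean_space \<Rightarrow> ennreal) \<Rightarrow> ennreal"
    (binder \<open>\<integral>\<^sup>+\<close> 10) where
  "nn_integral_lborel f \<equiv> integral\<^sup>N lborel f"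

text \<open>The change of variables theorems of the library require the index type of the coordinates to be
  well-ordered. Covering by small balls (Vitali) gives the sharp constant without derivatives.\<close>
lemma emeasure_Lipschitz_image_open_le:
  fixes f :: "'a::euclidean_space \<Rightarrow> 'a"
  assumes lip: "\<And>x y. dist (f x) (f y) \<le> L * dist x y" and L: "0 < L"
    and U: "open U" and B: "B \<in> sets borel" "B \<subseteq> f ` U"
  shows "emeasure lborel B \<le> ennreal (L ^ DIM('a)) * emeasure lborel U"
proof -
  define K where "K = {(x, r). 0 < r \<and> ball x r \<subseteq> U}"
  have S: "\<exists>i. i \<in> K \<and> x \<in> ball (fst i) (snd i) \<and> snd i < d" if "x \<in> U" "0 < d" for x d
  proof -
    obtain e where "0 < e" "ball x e \<subseteq> U" using U \<open>x \<in> U\<close> openE by blast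
    then have "(x, min e (d/2)) \<in> K" using \<open>0 < d\<close> by (auto simp: K_def)
    then show ?thesis using \<open>0 < e\<close> \<open>0 < d\<close> by (intro exI[of _ "(x, min e (d/2))"]) auto
  qed
  obtain C where C: "countable C" "C \<subseteq> K"
     "pairwise (\<lambda>i j. disjnt (ball (fst i) (snd i)) (ball (fst j) (snd j))) C"
     and neg: "negligible (U - (\<Union>i \<in> C. ball (fst i) (snd i)))"
    by (rule Vitali_covering_theorem_balls[OF S]) blast
  \<comment> \<open>\<open>D\<close> enumerates the disjoint Vitali balls and \<open>D'\<close> the
    balls of \<open>L\<close> times the radius around the images of their centres. Each
    \<open>D' n\<close> contains the image of \<open>D n\<close> and has exactly
    \<open>L ^ DIM('a)\<close> times its volume, which is where the sharp constant comes
    from.\<close>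
  define D where "D n = (if n \<in> to_nat_on C ` C then ball (fst (from_nat_into C n)) (snd (from_nat_into C n)) else {})" for n
  define D' where "D' n = (if n \<in> to_nat_on C ` C then ball (f (fst (from_nat_into C n))) (L * snd (from_nat_into C n)) else {})" for n
  have inj: "from_nat_into C n \<in> C" if "n \<in> to_nat_on C ` C" for n
    using that C(1) by auto
  have Ksnd: "0 < snd i" if "i \<in> C" for i using that C(2) by (auto simp: K_def)
  have disj: "disjoint_family D"
    unfolding disjoint_family_on_def
  proof (intro ballI impI)
    fix m n :: nat assume "m \<noteq> n"
    show "D m \<inter> D n = {}"
    proof (cases "m \<in> to_nat_on C ` C \<and> n \<in> to_nat_on C ` C")
      case True
      then have "from_nat_into C m \<noteq> from_nat_into C n"
        using \<open>m \<noteq> n\<close> C(1) by auto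
      then show ?thesis
        using C(3) True inj unfolding pairwise_def disjnt_def D_def by auto
    qed (auto simp: D_def)
  qed
  have UD: "(\<Union>n. D n) = (\<Union>i \<in> C. ball (fst i) (snd i))"
    unfolding D_def using C(1) by (force split: if_splits)
  have UDU: "(\<Union>n. D n) \<subseteq> U"
    unfolding UD using C(2) by (fastforce simp: K_def)
  have eq: "emeasure lborel (D' n) = ennreal (L ^ DIM('a)) * emeasure lborel (D n)" for n
    using inj[of n] Ksnd[of "from_nat_into C n"] L
    by (auto simp: D'_def D_def emeasure_ball ennreal_mult[symmetric] power_mult_distrib mult_ac)
  let ?N = "f ` (U - (\<Union>n. D n))"
  have negN: "negligible ?N"
  proof (rule negligible_locally_Lipschitz_image)
    show "negligible (U - (\<Union>n. D n))" using neg UD by simp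
    fix x
    have "\<forall>y\<in>(U - (\<Union>n. D n)) \<inter> UNIV. norm (f y - f x) \<le> L * norm (y - x)"
      using lip by (auto simp: dist_norm)
    then show "\<exists>T B. open T \<and> x \<in> T \<and> (\<forall>y\<in>(U - (\<Union>n. D n)) \<inter> T. norm (f y - f x) \<le> B * norm (y - x))"
      by (intro exI[of _ UNIV] exI[of _ L]) auto
  qed simp
  have sub: "B \<subseteq> ?N \<union> (\<Union>n. D' n)"
  proof
    fix y assume "y \<in> B"
    then obtain x where x: "x \<in> U" "y = f x" using B by auto
    show "y \<in> ?N \<union> (\<Union>n. D' n)"
    proof (cases "x \<in> (\<Union>n. D n)")
      case True
      then obtain n where n: "x \<in> D n" by auto
      then have "dist (f (fst (from_nat_into C n))) (f x) < L * snd (from_nat_into C n)"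
        using lip[of "fst (from_nat_into C n)" x] L
        by (auto simp: D_def dist_commute split: if_splits intro: le_less_trans)
      then have "y \<in> D' n" using n x by (auto simp: D'_def D_def split: if_splits)
      then show ?thesis by auto
    qed (use x in auto)
  qed
  have D'm: "D' n \<in> sets lborel" for n by (auto simp: D'_def)
  have D'l: "(\<Union>n. D' n) \<in> sets lebesgue" using D'm by (intro sets_completionI_sets sets.countable_UN) auto
  have N0: "?N \<in> null_sets lebesgue" using negN by (simp add: negligible_iff_null_sets)
  have "emeasure lborel B = emeasure lebesgue B" using B by simp
  also have "\<dots> \<le> emeasure lebesgue (?N \<union> (\<Union>n. D' n))"
    using N0 D'l by (intro emeasure_mono sub sets.Un) (auto simp: null_sets_def)
  also have "\<dots> = emeasure lebesgue (\<Union>n. D' n)"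
    using N0 D'l by (subst Un_commute, intro emeasure_Un_null_set) auto
  also have "\<dots> = emeasure lborel (\<Union>n. D' n)"
  proof -
    have "(\<Union>n. D' n) \<in> sets lborel" using D'm by (intro sets.countable_UN) auto
    then show ?thesis by simp
  qed
  also have "\<dots> \<le> (\<Sum>n. emeasure lborel (D' n))"
    using D'm by (intro emeasure_subadditive_countably) auto
  also have "\<dots> = ennreal (L ^ DIM('a)) * (\<Sum>n. emeasure lborel (D n))"
    by (simp add: eq ennreal_suminf_cmult)
  also have "(\<Sum>n. emeasure lborel (D n)) = emeasure lborel (\<Union>n. D n)"
    by (rule suminf_emeasure[OF _ disj]) (auto simp: D_def)
  also have "\<dots> \<le> emeasure lborel U"
    using U UDU by (intro emeasure_mono) auto
  finally show ?thesis by (simp add: mult_left_mono)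
qed

text \<open>Outer regularity replaces \<open>A\<close> by an open superset of almost the same
  measure. The bound is stated for Borel subsets \<open>B\<close> of the image because the image
  itself may fail to be Borel.\<close>

lemma emeasure_Lipschitz_image_le:
  fixes f :: "'a::euclidean_space \<Rightarrow> 'a"
  assumes lip: "\<And>x y. dist (f x) (f y) \<le> L * dist x y" and L: "0 < L"
    and A: "A \<in> sets borel" and B: "B \<in> sets borel" "B \<subseteq> f ` A"
  shows "emeasure lborel B \<le> ennreal (L ^ DIM('a)) * emeasure lborel A"
proof (rule ennreal_le_epsilon)
  fix e :: real assume e: "0 < e"
  define d where "d = e / L ^ DIM('a)"
  have d: "0 < d" using e L by (simp add: d_def)
  obtain U where U: "open U" "A \<subseteq> U" "emeasure lborel (U - A) < ennreal d"
    using outer_regular_lborel[OF A d] by metis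
  have "emeasure lborel U = emeasure lborel (A \<union> (U - A))" using U by (simp add: Un_absorb1)
  also have "\<dots> = emeasure lborel A + emeasure lborel (U - A)"
    using U A by (intro plus_emeasure[symmetric]) auto
  also have "\<dots> \<le> emeasure lborel A + ennreal d"
    using U by (intro add_left_mono) auto
  finally have "emeasure lborel U \<le> emeasure lborel A + ennreal d" .
  moreover have "emeasure lborel B \<le> ennreal (L ^ DIM('a)) * emeasure lborel U"
    using emeasure_Lipschitz_image_open_le[OF lip L U(1) B(1)] B(2) U(2) by blast
  ultimately have "emeasure lborel B \<le> ennreal (L ^ DIM('a)) * (emeasure lborel A + ennreal d)"
    by (meson mult_left_mono order_trans zero_le)
  also have "\<dots> = ennreal (L ^ DIM('a)) * emeasure lborel A + ennreal e"
    using L e by (simp add: distrib_left ennreal_mult[symmetric] d_def)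
  finally show "emeasure lborel B \<le> ennreal (L ^ DIM('a)) * emeasure lborel A + ennreal e" .
qed

text \<open>A substitution inequality without Jacobian: \<open>S\<close> undoes \<open>T\<close>, so
  \<open>T -\<close> A\<open>lies in\<close>S \<open>A\<close>, and the image of Lebesgue measure
  under \<open>T\<close> is at most \<open>L ^ DIM('a)\<close> times Lebesgue measure.\<close>

lemma nn_integral_comp_le:
  fixes T S :: "'a::euclidean_space \<Rightarrow> 'a"
  assumes lip: "\<And>x y. dist (S x) (S y) \<le> L * dist x y" and L: "0 < L"
    and inv: "\<And>x. S (T x) = x" and [measurable]: "T \<in> borel_measurable borel" "g \<in> borel_measurable borel"
  shows "(\<integral>\<^sup>+x. g (T x)) \<le> ennreal (L ^ DIM('a)) * (\<integral>\<^sup>+x. g x)"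
proof -
  let ?M = "distr lborel borel T" and ?N = "density lborel (\<lambda>_. ennreal (L ^ DIM('a)))"
  have "?M \<le> ?N"
  proof (subst le_measure, simp, intro ballI)
    fix A assume "A \<in> sets ?M"
    then have A[measurable]: "A \<in> sets borel" by simp
    have "emeasure ?M A = emeasure lborel (T -` A)"
      by (subst emeasure_distr) auto
    also have "\<dots> \<le> ennreal (L ^ DIM('a)) * emeasure lborel A"
    proof (rule emeasure_Lipschitz_image_le[OF lip L A])
      show "T -` A \<in> sets borel" using measurable_sets[OF \<open>T \<in> borel_measurable borel\<close> A] by simp
      show "T -` A \<subseteq> S ` A"
      proof
        fix x assume "x \<in> T -` A"
        then have "S (T x) \<in> S ` A" by blast
        then show "x \<in> S ` A" by (simp only: inv)
      qed
    qed
    also have "\<dots> = emeasure ?N A" by (simp add: emeasure_density nn_integral_cmult_indicator)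
    finally show "emeasure ?M A \<le> emeasure ?N A" .
  qed
  then have "integral\<^sup>N ?M g \<le> integral\<^sup>N ?N g"
    by (intro nn_integral_mono_measure) auto
  then show ?thesis by (simp add: nn_integral_distr nn_integral_density nn_integral_cmult)
qed

text \<open>The substitution inequality with constant 1, used for \<open>g\<close> and for
  \<open>g\<close> composed with \<open>s\<close>, gives both directions.\<close>

lemma nn_integral_isometric_involution:
  fixes s :: "'a::euclidean_space \<Rightarrow> 'a"
  assumes iso: "\<And>x y. dist (s x) (s y) = dist x y" and inv: "\<And>x. s (s x) = x"
    and [measurable]: "g \<in> borel_measurable borel"
  shows "(\<integral>\<^sup>+x. g (s x)) = (\<integral>\<^sup>+x. g x)"
proof -
  have "continuous_on UNIV s"
    using iso by (intro continuous_onI) auto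
  then have [measurable]: "s \<in> borel_measurable borel" by (rule borel_measurable_continuous_onI)
  have *: "(\<integral>\<^sup>+x. h (s x)) \<le> (\<integral>\<^sup>+x. h x)" if [measurable]: "h \<in> borel_measurable borel" for h :: "'a \<Rightarrow> ennreal"
    using nn_integral_comp_le[of s 1 s h] by (simp add: iso inv)
  show ?thesis using *[of g] *[of "\<lambda>x. g (s x)"] by (simp add: inv)
qed

lemma nn_integral_lborel_translate:
  fixes a :: "'a::euclidean_space"
  assumes [measurable]: "g \<in> borel_measurable borel"
  shows "(\<integral>\<^sup>+x. g (a + x)) = (\<integral>\<^sup>+x. g x)"
proof -
  have "(\<integral>\<^sup>+x. g x) = (\<integral>\<^sup>+x. g x \<partial>distr lborel borel ((+) a))" by (simp add: lborel_distr_plus)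
  also have "\<dots> = (\<integral>\<^sup>+x. g (a + x))" by (subst nn_integral_distr) auto
  finally show ?thesis ..
qed

lemma nn_integral_lborel_scale:
  assumes [measurable]: "g \<in> borel_measurable (borel :: 'a::euclidean_space measure)" and c: "0 < c"
  shows "(\<integral>\<^sup>+x. g x) = ennreal (c ^ DIM('a)) * (\<integral>\<^sup>+x. g (c *\<^sub>R x))"
  using c by (subst lborel_affine[of c 0])
     (auto simp: nn_integral_density nn_integral_distr nn_integral_cmult)

section \<open>The Gagliardo seminorm, its coarea formula and its scaling\<close>

definition kern :: "real \<Rightarrow> real ^ 'n \<Rightarrow> real" where
  "kern \<alpha> z = 1 / norm z powr (real CARD('n) + \<alpha>)"

definition gagliardo :: "real \<Rightarrow> (real ^ 'n \<Rightarrow> real) \<Rightarrow> ennreal" where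
  "gagliardo \<alpha> f = (\<integral>\<^sup>+x. \<integral>\<^sup>+y. ennreal (\<bar>f x - f y\<bar> * kern \<alpha> (x - y)))"

lemma kern_nonneg [simp]: "0 \<le> kern \<alpha> z"
  and kern_minus: "kern \<alpha> (- z) = kern \<alpha> z"
  and kern_minus_commute: "kern \<alpha> (x - y) = kern \<alpha> (y - x)"
  by (auto simp: kern_def norm_minus_commute)

lemma borel_measurable_kern [measurable]: "kern \<alpha> \<in> borel_measurable borel"
  unfolding kern_def by measurable

lemma sobolev_norm_eq_gagliardo:
  assumes [measurable]: "f \<in> borel_measurable borel"
  shows "sobolev_norm \<alpha> f = gagliardo \<alpha> f"
proof -
  have "sobolev_norm \<alpha> f = (\<integral>\<^sup>+h. \<integral>\<^sup>+x. ennreal \<bar>f (x + h) - f x\<bar> * ennreal (kern \<alpha> h))"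
    unfolding sobolev_norm_def kern_def by (simp add: nn_integral_multc)
  also have "\<dots> = (\<integral>\<^sup>+x. \<integral>\<^sup>+h. ennreal \<bar>f (x + h) - f x\<bar> * ennreal (kern \<alpha> h))"
    by (rule lborel_pair.Fubini') measurable
  also have "\<dots> = (\<integral>\<^sup>+x. \<integral>\<^sup>+h. ennreal (\<bar>f x - f (x + h)\<bar> * kern \<alpha> (x - (x + h))))"
    by (simp add: ennreal_mult kern_minus abs_minus_commute)
  also have "\<dots> = (\<integral>\<^sup>+x. \<integral>\<^sup>+y. ennreal (\<bar>f x - f y\<bar> * kern \<alpha> (x - y)))"
    by (rule nn_integral_cong, rule nn_integral_lborel_translate) measurable
  finally show ?thesis by (simp add: gagliardo_def)
qed

lemma perimeter_eq_kern:
  assumes [measurable]: "E \<in> sets borel"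
  shows "perimeter \<alpha> E = (\<integral>\<^sup>+x. \<integral>\<^sup>+y. ennreal (indicator E x * indicator (- E) y * kern \<alpha> (x - y)))"
  unfolding perimeter_def kern_def[symmetric]
  by (subst nn_integral_multc[symmetric], measurable, intro nn_integral_cong) (auto simp: indicator_def)

lemma gagliardo_indicator:
  assumes [measurable]: "E \<in> sets borel"
  shows "gagliardo \<alpha> (indicator E) = 2 * perimeter \<alpha> E"
proof -
  let ?k = "\<lambda>x y. ennreal (indicator E x * indicator (- E) y * kern \<alpha> (x - y))"
  have "gagliardo \<alpha> (indicator E) = (\<integral>\<^sup>+x. \<integral>\<^sup>+y. ?k x y + ?k y x)"
    unfolding gagliardo_def
    by (intro nn_integral_cong) (auto simp: indicator_def kern_minus_commute)
  also have "\<dots> = (\<integral>\<^sup>+x. \<integral>\<^sup>+y. ?k x y) + (\<integral>\<^sup>+x. \<integral>\<^sup>+y. ?k y x)"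
    by (subst nn_integral_add[symmetric], measurable, intro nn_integral_cong nn_integral_add) measurable
  also have "(\<integral>\<^sup>+x. \<integral>\<^sup>+y. ?k y x) = (\<integral>\<^sup>+x. \<integral>\<^sup>+y. ?k x y)"
    by (rule lborel_pair.Fubini') measurable
  finally show ?thesis by (simp add: perimeter_eq_kern mult_2)
qed

lemma gagliardo_mono:
  assumes "\<And>x y. \<bar>g x - g y\<bar> \<le> \<bar>f x - f y\<bar>"
  shows "gagliardo \<alpha> g \<le> gagliardo \<alpha> f"
  unfolding gagliardo_def by (intro nn_integral_mono ennreal_leI mult_right_mono assms) auto

lemma gagliardo_cmult:
  assumes [measurable]: "f \<in> borel_measurable borel"
  shows "gagliardo \<alpha> (\<lambda>x. c * f x) = ennreal \<bar>c\<bar> * gagliardo \<alpha> f"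
proof -
  have "gagliardo \<alpha> (\<lambda>x. c * f x) = (\<integral>\<^sup>+x. \<integral>\<^sup>+y. ennreal \<bar>c\<bar> * ennreal (\<bar>f x - f y\<bar> * kern \<alpha> (x - y)))"
    unfolding gagliardo_def
    by (intro nn_integral_cong) (simp add: ennreal_mult[symmetric] right_diff_distrib[symmetric] abs_mult mult_ac)
  also have "\<dots> = (\<integral>\<^sup>+x. ennreal \<bar>c\<bar> * (\<integral>\<^sup>+y. ennreal (\<bar>f x - f y\<bar> * kern \<alpha> (x - y))))"
    by (intro nn_integral_cong nn_integral_cmult) measurable
  also have "\<dots> = ennreal \<bar>c\<bar> * gagliardo \<alpha> f"
    unfolding gagliardo_def by (rule nn_integral_cmult) measurable
  finally show ?thesis .
qed

text \<open>\<open>\<bar>g x - g y\<bar>\<close> is the length of the set of levels \<open>t\<close>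
  that separate \<open>g x\<close> from \<open>g y\<close>; Tonelli then moves the integral over
  \<open>t\<close> outside.\<close>

lemma gagliardo_coarea:
  assumes [measurable]: "g \<in> borel_measurable borel" and g: "\<And>x. 0 \<le> g x"
  shows "gagliardo \<alpha> g = (\<integral>\<^sup>+t\<in>{0..}. gagliardo \<alpha> (indicator {x. t < g x}) \<partial>lborel)"
proof -
  let ?I = "\<lambda>x y t. ennreal (\<bar>indicator {x. t < g x} x - indicator {x. t < g x} y\<bar> * kern \<alpha> (x - y)) * indicator {0..} t"
  have 1: "ennreal (\<bar>g x - g y\<bar> * kern \<alpha> (x - y)) = (\<integral>\<^sup>+t. ?I x y t)" for x y
  proof -
    have "(\<integral>\<^sup>+t. ?I x y t) = (\<integral>\<^sup>+t. ennreal (kern \<alpha> (x - y)) * indicator {min (g x) (g y)..<max (g x) (g y)} t)"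
      by (intro nn_integral_cong) (use g[of x] g[of y] in \<open>auto simp: indicator_def min_def max_def\<close>)
    also have "\<dots> = ennreal (kern \<alpha> (x - y)) * ennreal (max (g x) (g y) - min (g x) (g y))"
      by (subst nn_integral_cmult_indicator) auto
    also have "\<dots> = ennreal (\<bar>g x - g y\<bar> * kern \<alpha> (x - y))"
      by (subst ennreal_mult[symmetric]) (auto simp: max_def min_def mult_ac)
    finally show ?thesis ..
  qed
  have [measurable]: "Measurable.pred (borel \<Otimes>\<^sub>M borel) (\<lambda>w. fst w < g (snd w))" by measurable
  have "gagliardo \<alpha> g = (\<integral>\<^sup>+x. \<integral>\<^sup>+y. \<integral>\<^sup>+t. ?I x y t)"
    unfolding gagliardo_def by (simp add: 1)
  also have "\<dots> = (\<integral>\<^sup>+x. \<integral>\<^sup>+t. \<integral>\<^sup>+y. ?I x y t)"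
    by (intro nn_integral_cong lborel_pair.Fubini') (unfold indicator_def mem_Collect_eq, measurable)
  also have "\<dots> = (\<integral>\<^sup>+t. \<integral>\<^sup>+x. \<integral>\<^sup>+y. ?I x y t)"
    by (intro lborel_pair.Fubini') (unfold indicator_def mem_Collect_eq, measurable)
  also have "\<dots> = (\<integral>\<^sup>+t\<in>{0..}. gagliardo \<alpha> (indicator {x. t < g x}) \<partial>lborel)"
    unfolding gagliardo_def
    by (intro nn_integral_cong) (subst nn_integral_multc[symmetric], (unfold indicator_def mem_Collect_eq, measurable)[1],
       intro nn_integral_cong nn_integral_multc, (unfold indicator_def mem_Collect_eq, measurable)[1])
  finally show ?thesis .
qed

lemma kern_scaleR:
  fixes z :: "real ^ 'n"
  assumes "0 < r"
  shows "kern \<alpha> (r *\<^sub>R z) = r powr - (real CARD('n) + \<alpha>) * kern \<alpha> z"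
  using assms by (simp add: kern_def powr_mult powr_minus_divide del: minus_add_distrib)

text \<open>Each of the two integrations contributes \<open>r ^ n\<close> and the kernel
  \<open>r powr - (n + \<alpha>)\<close>.\<close>

lemma perimeter_ball_scale:
  assumes r: "0 < r"
  shows "perimeter \<alpha> (ball (0 :: real ^ 'n) r) = ennreal (r powr (real CARD('n) - \<alpha>)) * perimeter \<alpha> (ball (0 :: real ^ 'n) 1)"
proof -
  let ?B = "ball (0 :: real ^ 'n) r" and ?B1 = "ball (0 :: real ^ 'n) 1"
  let ?k = "\<lambda>B x y. ennreal (indicator B x * indicator (- B) y * kern \<alpha> (x - y))"
  let ?n = "ennreal (r ^ CARD('n))"
  have *: "?k ?B (r *\<^sub>R x) (r *\<^sub>R y) = ennreal (r powr - (real CARD('n) + \<alpha>)) * ?k ?B1 x y" for x y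
  proof -
    have "kern \<alpha> (r *\<^sub>R x - r *\<^sub>R y) = r powr - (real CARD('n) + \<alpha>) * kern \<alpha> (x - y)"
      using kern_scaleR[OF r, of \<alpha> "x - y"] by (simp add: scaleR_diff_right)
    moreover have "indicator ?B (r *\<^sub>R x) = (indicator ?B1 x :: real)" "indicator (- ?B) (r *\<^sub>R y) = (indicator (- ?B1) y :: real)"
      using r by (auto simp: indicator_def)
    ultimately show ?thesis by (simp add: ennreal_mult[symmetric] mult_ac)
  qed
  have [measurable]: "?B \<in> sets borel" "- ?B \<in> sets borel" "?B1 \<in> sets borel" "- ?B1 \<in> sets borel" by auto
  have m: "(\<lambda>x. \<integral>\<^sup>+y. ?k ?B x y) \<in> borel_measurable borel" by measurable
  have "perimeter \<alpha> ?B = ?n * (\<integral>\<^sup>+x. \<integral>\<^sup>+y. ?k ?B (r *\<^sub>R x) y)"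
    using nn_integral_lborel_scale[OF m r] by (simp add: perimeter_eq_kern)
  also have "\<dots> = ?n * (\<integral>\<^sup>+x. ?n * (\<integral>\<^sup>+y. ?k ?B (r *\<^sub>R x) (r *\<^sub>R y)))"
  proof -
    have "(\<integral>\<^sup>+y. ?k ?B (r *\<^sub>R x) y) = ?n * (\<integral>\<^sup>+y. ?k ?B (r *\<^sub>R x) (r *\<^sub>R y))" for x
      using nn_integral_lborel_scale[OF _ r, of "\<lambda>y. ?k ?B (r *\<^sub>R x) y"] by simp
    then show ?thesis by simp
  qed
  also have "\<dots> = ?n * (\<integral>\<^sup>+x. ?n * (ennreal (r powr - (real CARD('n) + \<alpha>)) * (\<integral>\<^sup>+y. ?k ?B1 x y)))"
  proof -
    have "(\<integral>\<^sup>+y. ennreal (r powr - (real CARD('n) + \<alpha>)) * ?k ?B1 x y)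
      = ennreal (r powr - (real CARD('n) + \<alpha>)) * (\<integral>\<^sup>+y. ?k ?B1 x y)" for x
      by (rule nn_integral_cmult) measurable
    then show ?thesis by (simp only: *)
  qed
  also have "\<dots> = ?n * (?n * (ennreal (r powr - (real CARD('n) + \<alpha>)) * perimeter \<alpha> ?B1))"
  proof -
    have "(\<lambda>x. \<integral>\<^sup>+y. ?k ?B1 x y) \<in> borel_measurable lborel" by measurable
    then show ?thesis by (subst perimeter_eq_kern, simp) (simp add: nn_integral_cmult)
  qed
  also have "\<dots> = ennreal (r powr (real CARD('n) - \<alpha>)) * perimeter \<alpha> ?B1"
  proof -
    have "r ^ CARD('n) * (r ^ CARD('n) * r powr - (real CARD('n) + \<alpha>)) = r powr (real CARD('n) - \<alpha>)"
      using r by (simp add: powr_realpow[symmetric] powr_add[symmetric])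
    then show ?thesis using r by (simp add: mult.assoc[symmetric] ennreal_mult[symmetric])
  qed
  finally show ?thesis .
qed

section \<open>Polarization\<close>

definition reflect :: "'a::real_inner \<Rightarrow> real \<Rightarrow> 'a \<Rightarrow> 'a" where
  "reflect u s x = x - (2 * (u \<bullet> x - s)) *\<^sub>R u"

text \<open>The two-point rearrangement: of the two values at a mirror pair, the half-space
  \<open>u \<bullet> x \<le> s\<close> receives the larger one.\<close>

definition polarize :: "'a::real_inner \<Rightarrow> real \<Rightarrow> ('a \<Rightarrow> real) \<Rightarrow> 'a \<Rightarrow> real" where
  "polarize u s g x = (if u \<bullet> x \<le> s then max (g x) (g (reflect u s x)) else min (g x) (g (reflect u s x)))"

context
  fixes u :: "'a::real_inner" and s :: real
  assumes u: "norm u = 1"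
begin

lemma inner_uu: "u \<bullet> u = 1" using u by (simp add: norm_eq_1)

lemma inner_reflect: "u \<bullet> reflect u s x = 2 * s - u \<bullet> x"
  by (simp add: reflect_def inner_diff_right inner_uu)

lemma reflect_reflect [simp]: "reflect u s (reflect u s x) = x"
  unfolding reflect_def[of u s "reflect u s x"] inner_reflect by (simp add: reflect_def algebra_simps)

text \<open>The sign of the last term decides whether \<open>y\<close> or its mirror image is nearer
  to \<open>x\<close>: points on the same side of the hyperplane are nearer to each other than to
  each other's mirror images. All properties of polarization below rest on this.\<close>

lemma norm_diff_reflect: "(norm (x - reflect u s y))\<^sup>2 = (norm (x - y))\<^sup>2 + 4 * (u \<bullet> y - s) * (u \<bullet> x - s)"
proof -
  let ?a = "2 * (u \<bullet> y - s)"
  have "(norm (w + a *\<^sub>R u))\<^sup>2 = (norm w)\<^sup>2 + 2 * a * (w \<bullet> u) + a\<^sup>2 * (u \<bullet> u)" for w a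
    unfolding power2_norm_eq_inner by (simp add: inner_simps inner_commute power2_eq_square algebra_simps)
  moreover have "x - reflect u s y = (x - y) + ?a *\<^sub>R u" by (simp add: reflect_def)
  ultimately have "(norm (x - reflect u s y))\<^sup>2 = (norm (x - y))\<^sup>2 + 2 * ?a * ((x - y) \<bullet> u) + ?a\<^sup>2 * (u \<bullet> u)"
    by (simp only:)
  then show ?thesis by (simp add: inner_uu inner_simps inner_commute power2_eq_square algebra_simps)
qed

lemma dist_reflect [simp]: "dist (reflect u s x) (reflect u s y) = dist x y"
proof -
  have "(norm (reflect u s x - reflect u s y))\<^sup>2 = (norm (x - y))\<^sup>2"
    using norm_diff_reflect[of "reflect u s x" y] norm_diff_reflect[of y x] inner_reflect[of x]
    by (simp add: norm_minus_commute algebra_simps)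
  then show ?thesis by (simp add: dist_norm)
qed

lemma norm_reflect_diff [simp]: "norm (reflect u s x - reflect u s y) = norm (x - y)"
  using dist_reflect[of x y] by (simp add: dist_norm)

lemma norm_reflect_swap: "norm (reflect u s x - y) = norm (x - reflect u s y)"
  using norm_reflect_diff[of x "reflect u s y"] by simp

lemma reflect_fixed: "u \<bullet> x = s \<Longrightarrow> reflect u s x = x"
  by (simp add: reflect_def)

lemma polarize_le:
  assumes "u \<bullet> x \<le> s"
  shows "polarize u s g x = max (g x) (g (reflect u s x))"
    "polarize u s g (reflect u s x) = min (g x) (g (reflect u s x))"
  using assms reflect_fixed[of x] by (auto simp: polarize_def inner_reflect)

lemma polarize_ge:
  assumes "s \<le> u \<bullet> x"
  shows "polarize u s g x = min (g x) (g (reflect u s x))"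
    "polarize u s g (reflect u s x) = max (g x) (g (reflect u s x))"
  using assms reflect_fixed[of x] by (auto simp: polarize_def inner_reflect)

text \<open>For points on opposite sides, reflecting one of them does not increase the distance, so
  all four pairings of the values at \<open>x\<close> and its mirror image with those at
  \<open>y\<close> and its mirror image differ by at most \<open>e\<close>, and hence so do the
  maxima and minima.\<close>

lemma polarize_modulus:
  assumes g: "\<And>x y. dist x y < d \<Longrightarrow> \<bar>g x - g y\<bar> \<le> e" and xy: "dist x y < d"
  shows "\<bar>polarize u s g x - polarize u s g y\<bar> \<le> e"
proof -
  have *: "\<bar>polarize u s g x - polarize u s g y\<bar> \<le> e" if xy: "dist x y < d" "u \<bullet> x \<le> s" "s < u \<bullet> y" for x y
  proof -
    have "4 * (u \<bullet> y - s) * (u \<bullet> x - s) \<le> 0" using xy by (simp add: mult_nonneg_nonpos)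
    then have "(norm (x - reflect u s y))\<^sup>2 \<le> (norm (x - y))\<^sup>2"
      by (simp add: norm_diff_reflect)
    then have "dist x (reflect u s y) \<le> dist x y" by (simp add: dist_norm)
    then have 1: "\<bar>g x - g (reflect u s y)\<bar> \<le> e" "\<bar>g (reflect u s x) - g y\<bar> \<le> e"
      using g[of x "reflect u s y"] g[of "reflect u s x" y] xy
      by (auto simp: dist_norm norm_reflect_swap)
    have 2: "\<bar>g x - g y\<bar> \<le> e" "\<bar>g (reflect u s x) - g (reflect u s y)\<bar> \<le> e"
      using g xy by auto
    from 1 2 show ?thesis using xy by (auto simp: polarize_def)
  qed
  have 2: "\<bar>g x - g y\<bar> \<le> e" "\<bar>g (reflect u s x) - g (reflect u s y)\<bar> \<le> e"
    using g xy by auto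
  consider "u \<bullet> x \<le> s" "u \<bullet> y \<le> s" | "u \<bullet> x > s" "u \<bullet> y > s" | "u \<bullet> x \<le> s" "u \<bullet> y > s" | "u \<bullet> y \<le> s" "u \<bullet> x > s"
    by linarith
  then show ?thesis
  proof cases
    case 3 then show ?thesis using * xy by blast
  next
    case 4 then show ?thesis using *[of y x] xy by (simp add: dist_commute abs_minus_commute)
  qed (use 2 in \<open>auto simp: polarize_def\<close>)
qed

lemma norm_reflect: "(norm (reflect u s x))\<^sup>2 = (norm x)\<^sup>2 + 4 * s * (s - u \<bullet> x)"
  using norm_diff_reflect[of 0 x] by (simp add: algebra_simps)

text \<open>\<open>0 \<le> s\<close> puts the origin into the favoured half-space, so a point of
  that half-space has a mirror image at least as far from the origin. Mass moves towards the origin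
  only.\<close>

lemma polarize_support:
  assumes "0 \<le> s" "\<And>x. R < norm x \<Longrightarrow> g x = 0" "\<And>x. 0 \<le> g x" "R < norm x"
  shows "polarize u s g x = 0"
proof (cases "u \<bullet> x \<le> s")
  case True
  then have "(norm x)\<^sup>2 \<le> (norm (reflect u s x))\<^sup>2" using \<open>0 \<le> s\<close> by (simp add: norm_reflect)
  then have "norm x \<le> norm (reflect u s x)" by simp
  then show ?thesis using assms True by (simp add: polarize_def)
next
  case False
  then show ?thesis using assms by (simp add: polarize_def)
qed

end

lemma reflect_continuous: "continuous_on A (reflect u s)"
  unfolding reflect_def by (intro continuous_intros)

lemma borel_measurable_reflect [measurable]: "reflect u s \<in> borel_measurable (borel :: 'a::euclidean_space measure)"
  by (intro borel_measurable_continuous_onI reflect_continuous)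

lemma borel_measurable_polarize [measurable]:
  fixes g :: "'a::euclidean_space \<Rightarrow> real"
  assumes [measurable]: "g \<in> borel_measurable borel"
  shows "polarize u s g \<in> borel_measurable borel"
  unfolding polarize_def by measurable

lemma nn_integral_reflect:
  fixes g :: "'a::euclidean_space \<Rightarrow> ennreal"
  assumes "norm u = 1" and "g \<in> borel_measurable borel"
  shows "(\<integral>\<^sup>+x. g (reflect u s x)) = (\<integral>\<^sup>+x. g x)"
  by (rule nn_integral_isometric_involution) (use assms in auto)

lemma kern_antimono:
  fixes z w :: "real ^ 'n"
  assumes "0 < \<alpha>" "z \<noteq> 0" "norm z \<le> norm w"
  shows "kern \<alpha> w \<le> kern \<alpha> z"
proof -
  have "norm z powr (real CARD('n) + \<alpha>) \<le> norm w powr (real CARD('n) + \<alpha>)"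
    using assms by (intro powr_mono2) auto
  then show ?thesis using assms unfolding kern_def by (intro divide_left_mono) (auto simp: zero_less_mult_iff)
qed

lemma kern_cong:
  fixes z w :: "real ^ 'n"
  shows "norm z = norm w \<Longrightarrow> kern \<alpha> z = kern \<alpha> w"
  by (simp add: kern_def)

text \<open>The sum of all four differences is the same on both sides, and on the left more of it carries
  the smaller weight \<open>k2\<close>. The alternative premise covers \<open>x = y\<close>, where \<open>kern\<close> has the junk value 0.\<close>
lemma two_point_ineq:
  fixes a b c d k1 k2 :: real
  assumes "0 \<le> k1" "0 \<le> k2" "k2 \<le> k1 \<or> (a = c \<and> b = d)"
  shows "(\<bar>max a b - max c d\<bar> + \<bar>min a b - min c d\<bar>) * k1 + (\<bar>min a b - max c d\<bar> + \<bar>max a b - min c d\<bar>) * k2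
    \<le> (\<bar>a - c\<bar> + \<bar>b - d\<bar>) * k1 + (\<bar>b - c\<bar> + \<bar>a - d\<bar>) * k2"
proof (cases "a = c \<and> b = d")
  case True
  then show ?thesis by (auto simp: max_def min_def algebra_simps abs_if)
next
  case False
  then have k: "k2 \<le> k1" using assms by auto
  define P' Q' P Q where "P' = \<bar>max a b - max c d\<bar> + \<bar>min a b - min c d\<bar>"
    and "Q' = \<bar>min a b - max c d\<bar> + \<bar>max a b - min c d\<bar>"
    and "P = \<bar>a - c\<bar> + \<bar>b - d\<bar>" and "Q = \<bar>b - c\<bar> + \<bar>a - d\<bar>"
  have "P' + Q' = P + Q" "P' \<le> P"
    unfolding P'_def Q'_def P_def Q_def by (auto simp: max_def min_def)
  then have "P' * (k1 - k2) + (P' + Q') * k2 \<le> P * (k1 - k2) + (P + Q) * k2"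
    using k by (simp add: mult_right_mono)
  then show ?thesis unfolding P'_def[symmetric] Q'_def[symmetric] P_def[symmetric] Q_def[symmetric]
    by (simp add: algebra_simps)
qed

text \<open>Averages a double integral over the four ways of reflecting \<open>x\<close> and
  \<open>y\<close>. Polarization only rearranges values within mirror pairs, so it can then be
  compared pointwise.\<close>

lemma nn_integral_reflect4:
  fixes F :: "'a::euclidean_space \<Rightarrow> 'a \<Rightarrow> ennreal"
  assumes u: "norm u = 1" and F [measurable]: "case_prod F \<in> borel_measurable (borel \<Otimes>\<^sub>M borel)"
  shows "(\<integral>\<^sup>+x. \<integral>\<^sup>+y. (F x y + F (reflect u s x) (reflect u s y)) + (F (reflect u s x) y + F x (reflect u s y)))
    = 4 * (\<integral>\<^sup>+x. \<integral>\<^sup>+y. F x y)"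
proof -
  let ?r = "reflect u s" and ?I = "\<integral>\<^sup>+x. \<integral>\<^sup>+y. F x y"
  have 1: "(\<integral>\<^sup>+y. F x (?r y)) = (\<integral>\<^sup>+y. F x y)" for x
    by (rule nn_integral_reflect[OF u]) measurable
  have 2: "(\<integral>\<^sup>+x. \<integral>\<^sup>+y. F (?r x) y) = ?I"
    by (rule nn_integral_reflect[OF u, where g = "\<lambda>x. \<integral>\<^sup>+y. F x y"]) measurable
  have "(\<integral>\<^sup>+x. \<integral>\<^sup>+y. (F x y + F (?r x) (?r y)) + (F (?r x) y + F x (?r y)))
    = (\<integral>\<^sup>+x. ((\<integral>\<^sup>+y. F x y) + (\<integral>\<^sup>+y. F (?r x) (?r y))) + ((\<integral>\<^sup>+y. F (?r x) y) + (\<integral>\<^sup>+y. F x (?r y))))"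
    by (intro nn_integral_cong) (simp add: nn_integral_add)
  also have "\<dots> = (\<integral>\<^sup>+x. ((\<integral>\<^sup>+y. F x y) + (\<integral>\<^sup>+y. F (?r x) y)) + ((\<integral>\<^sup>+y. F (?r x) y) + (\<integral>\<^sup>+y. F x y)))"
    by (simp only: 1)
  also have "\<dots> = (?I + ?I) + (?I + ?I)"
    by (subst nn_integral_add, measurable, subst nn_integral_add, measurable, subst nn_integral_add, measurable) (simp only: 2)
  also have "\<dots> = 4 * ?I"
    by (simp add: mult_2[symmetric] mult.assoc[symmetric])
  finally show ?thesis .
qed

lemma gagliardo_polarize_le:
  fixes g :: "real ^ 'n \<Rightarrow> real"
  assumes "0 < \<alpha>" and u: "norm u = 1" and [measurable]: "g \<in> borel_measurable borel"
  shows "gagliardo \<alpha> (polarize u s g) \<le> gagliardo \<alpha> g"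
proof -
  define F where "F h x y = ennreal (\<bar>h x - h y\<bar> * kern \<alpha> (x - y))" for h :: "real ^ 'n \<Rightarrow> real" and x y
  have [measurable]: "case_prod (F h) \<in> borel_measurable (borel \<Otimes>\<^sub>M borel)" if [measurable]: "h \<in> borel_measurable borel" for h
    unfolding F_def by measurable
  have gag: "gagliardo \<alpha> h = (\<integral>\<^sup>+x. \<integral>\<^sup>+y. F h x y)" for h
    unfolding gagliardo_def F_def ..
  let ?r = "reflect u s" and ?p = "polarize u s g"
  have eq: "(F h x y + F h (?r x) (?r y)) + (F h (?r x) y + F h x (?r y)) =
     ennreal ((\<bar>h x - h y\<bar> + \<bar>h (?r x) - h (?r y)\<bar>) * kern \<alpha> (x - y)
        + (\<bar>h (?r x) - h y\<bar> + \<bar>h x - h (?r y)\<bar>) * kern \<alpha> (x - ?r y))" for h x y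
  proof -
    have "kern \<alpha> (?r x - ?r y) = kern \<alpha> (x - y)" "kern \<alpha> (?r x - y) = kern \<alpha> (x - ?r y)"
      using u by (auto intro!: kern_cong norm_reflect_swap)
    then show ?thesis unfolding F_def by (simp add: ennreal_plus[symmetric] distrib_right del: ennreal_plus)
  qed
  \<comment> \<open>\<open>k1\<close> serves pairs on the same side, where the direct distance is
    the shorter one, and \<open>k2\<close> pairs on opposite sides. Both hold on the hyperplane, so
    the cases below may overlap.\<close>
  have k1: "kern \<alpha> (x - ?r y) \<le> kern \<alpha> (x - y) \<or> (g x = g y \<and> g (?r x) = g (?r y))"
    if "0 \<le> (u \<bullet> y - s) * (u \<bullet> x - s)" for x y
  proof (cases "x = y")
    case False
    have "(norm (x - y))\<^sup>2 \<le> (norm (x - ?r y))\<^sup>2" using that unfolding norm_diff_reflect[OF u] by (simp add: algebra_simps)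
    then show ?thesis using False \<open>0 < \<alpha>\<close> by (intro disjI1 kern_antimono) auto
  qed auto
  have k2: "kern \<alpha> (x - y) \<le> kern \<alpha> (x - ?r y) \<or> (g x = g (?r y) \<and> g (?r x) = g y)"
    if "(u \<bullet> y - s) * (u \<bullet> x - s) \<le> 0" for x y
  proof (cases "x = ?r y")
    case False
    have "(norm (x - ?r y))\<^sup>2 \<le> (norm (x - y))\<^sup>2" using that unfolding norm_diff_reflect[OF u] by (simp add: algebra_simps)
    then show ?thesis using False \<open>0 < \<alpha>\<close> by (intro disjI1 kern_antimono) auto
  qed (use u in auto)
  have le: "(\<bar>?p x - ?p y\<bar> + \<bar>?p (?r x) - ?p (?r y)\<bar>) * kern \<alpha> (x - y)
        + (\<bar>?p (?r x) - ?p y\<bar> + \<bar>?p x - ?p (?r y)\<bar>) * kern \<alpha> (x - ?r y)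
      \<le> (\<bar>g x - g y\<bar> + \<bar>g (?r x) - g (?r y)\<bar>) * kern \<alpha> (x - y)
        + (\<bar>g (?r x) - g y\<bar> + \<bar>g x - g (?r y)\<bar>) * kern \<alpha> (x - ?r y)" for x y
  proof -
    consider "u \<bullet> x \<le> s" "u \<bullet> y \<le> s" | "s \<le> u \<bullet> x" "s \<le> u \<bullet> y" | "u \<bullet> x \<le> s" "s \<le> u \<bullet> y" | "s \<le> u \<bullet> x" "u \<bullet> y \<le> s"
      by linarith
    then show ?thesis
    proof cases
      case 1
      then have "0 \<le> (u \<bullet> y - s) * (u \<bullet> x - s)" by (simp add: mult_nonpos_nonpos)
      from two_point_ineq[OF kern_nonneg kern_nonneg k1[OF this]]
      show ?thesis using 1 by (simp add: polarize_le[OF u])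
    next
      case 2
      then have "0 \<le> (u \<bullet> y - s) * (u \<bullet> x - s)" by simp
      from two_point_ineq[OF kern_nonneg kern_nonneg k1[OF this]]
      show ?thesis using 2 by (simp add: polarize_ge[OF u] add.commute)
    next
      case 3
      then have "(u \<bullet> y - s) * (u \<bullet> x - s) \<le> 0" by (simp add: mult_nonneg_nonpos)
      from two_point_ineq[OF kern_nonneg kern_nonneg k2[OF this]]
      show ?thesis using 3 by (simp add: polarize_le[OF u] polarize_ge[OF u] max.commute min.commute add.commute)
    next
      case 4
      then have "(u \<bullet> y - s) * (u \<bullet> x - s) \<le> 0" by (simp add: mult_nonpos_nonneg)
      from two_point_ineq[OF kern_nonneg kern_nonneg k2[OF this]]
      show ?thesis using 4 by (simp add: polarize_le[OF u] polarize_ge[OF u] max.commute min.commute add.commute)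
    qed
  qed
  have "4 * gagliardo \<alpha> ?p = (\<integral>\<^sup>+x. \<integral>\<^sup>+y. (F ?p x y + F ?p (?r x) (?r y)) + (F ?p (?r x) y + F ?p x (?r y)))"
    by (subst nn_integral_reflect4[OF u], measurable) (simp only: gag)
  also have "\<dots> \<le> (\<integral>\<^sup>+x. \<integral>\<^sup>+y. (F g x y + F g (?r x) (?r y)) + (F g (?r x) y + F g x (?r y)))"
    unfolding eq by (intro nn_integral_mono ennreal_leI le)
  also have "\<dots> = 4 * gagliardo \<alpha> g"
    by (subst nn_integral_reflect4[OF u], measurable) (simp only: gag)
  finally show ?thesis
    by (subst (asm) ennreal_mult_le_mult_iff) auto
qed

text \<open>Equimeasurability: the pair of values at \<open>x\<close> and its mirror image is kept
  as an unordered pair, and the integral is folded along the hyperplane.\<close>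

lemma nn_integral_polarize:
  fixes g :: "'a::euclidean_space \<Rightarrow> real" and \<phi> :: "real \<Rightarrow> ennreal"
  assumes u: "norm u = 1" and [measurable]: "g \<in> borel_measurable borel" "\<phi> \<in> borel_measurable borel"
  shows "(\<integral>\<^sup>+x. \<phi> (polarize u s g x)) = (\<integral>\<^sup>+x. \<phi> (g x))"
proof -
  let ?r = "reflect u s" and ?p = "polarize u s g"
  have 2: "2 * (\<integral>\<^sup>+x. \<phi> (h x)) = (\<integral>\<^sup>+x. \<phi> (h x) + \<phi> (h (?r x)))"
    if [measurable]: "h \<in> borel_measurable borel" for h
    using nn_integral_reflect[OF u, of "\<lambda>x. \<phi> (h x)" s] by (simp add: nn_integral_add mult_2)
  have "\<phi> (?p x) + \<phi> (?p (?r x)) = \<phi> (g x) + \<phi> (g (?r x))" for x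
    using polarize_le[OF u, of x s g] polarize_ge[OF u, of s x g]
    by (cases "u \<bullet> x \<le> s") (auto simp: max_def min_def add.commute)
  then have "2 * (\<integral>\<^sup>+x. \<phi> (?p x)) = 2 * (\<integral>\<^sup>+x. \<phi> (g x))"
    by (simp add: 2)
  then show ?thesis
    by (subst (asm) ennreal_mult_cancel_left) auto
qed

section \<open>Balls minimise the Gagliardo seminorm\<close>

lemma gagliardo_liminf:
  fixes G :: "nat \<Rightarrow> real ^ 'n \<Rightarrow> real"
  assumes [measurable]: "\<And>n. G n \<in> borel_measurable borel" and lim: "\<And>x. (\<lambda>n. G n x) \<longlonglongrightarrow> g x"
    and le: "\<And>n. gagliardo \<alpha> (G n) \<le> E"
  shows "gagliardo \<alpha> g \<le> E"
proof -
  let ?F = "\<lambda>h x y. ennreal (\<bar>h x - h y\<bar> * kern \<alpha> (x - y))"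
  have "?F g x y = liminf (\<lambda>n. ?F (G n) x y)" for x y
    by (rule lim_imp_Liminf[symmetric]) (auto intro!: tendsto_intros lim)
  then have "gagliardo \<alpha> g = (\<integral>\<^sup>+x. \<integral>\<^sup>+y. liminf (\<lambda>n. ?F (G n) x y))"
    by (simp add: gagliardo_def)
  also have "\<dots> \<le> (\<integral>\<^sup>+x. liminf (\<lambda>n. \<integral>\<^sup>+y. ?F (G n) x y))"
    by (intro nn_integral_mono nn_integral_liminf) measurable
  also have "\<dots> \<le> liminf (\<lambda>n. gagliardo \<alpha> (G n))"
    unfolding gagliardo_def by (intro nn_integral_liminf) measurable
  also have "\<dots> \<le> E"
    by (rule Liminf_le) (auto intro: le always_eventually)
  finally show ?thesis .
qed

text \<open>Finiteness allows the integral of \<open>Q\<close> to be cancelled, so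
  \<open>P - Q\<close> vanishes almost everywhere; the coincidence set is closed and of full
  measure, hence everything.\<close>

lemma eq_of_nn_integral_eq:
  fixes P Q :: "'a::euclidean_space \<Rightarrow> real"
  assumes cont: "continuous_on UNIV P" "continuous_on UNIV Q"
    and Q: "\<And>x. 0 \<le> Q x" "\<And>x. Q x \<le> P x"
    and le: "(\<integral>\<^sup>+x. ennreal (P x)) \<le> (\<integral>\<^sup>+x. ennreal (Q x))"
    and fin: "(\<integral>\<^sup>+x. ennreal (P x)) < \<infinity>"
  shows "P x = Q x"
proof -
  have [measurable]: "P \<in> borel_measurable borel" "Q \<in> borel_measurable borel"
    using cont by (auto intro: borel_measurable_continuous_onI)
  have "(\<integral>\<^sup>+x. ennreal (P x)) = (\<integral>\<^sup>+x. ennreal (Q x) + ennreal (P x - Q x))"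
    by (intro nn_integral_cong) (subst ennreal_plus[symmetric], use Q in auto)
  also have "\<dots> = (\<integral>\<^sup>+x. ennreal (Q x)) + (\<integral>\<^sup>+x. ennreal (P x - Q x))"
    by (rule nn_integral_add) measurable
  finally have eq: "(\<integral>\<^sup>+x. ennreal (P x)) = (\<integral>\<^sup>+x. ennreal (Q x)) + (\<integral>\<^sup>+x. ennreal (P x - Q x))" .
  have finQ: "(\<integral>\<^sup>+x. ennreal (Q x)) < \<infinity>"
    using fin by (rule le_less_trans[rotated]) (intro nn_integral_mono ennreal_leI Q)
  have "(\<integral>\<^sup>+x. ennreal (P x - Q x)) = 0"
  proof -
    have "(\<integral>\<^sup>+x. ennreal (Q x)) + (\<integral>\<^sup>+x. ennreal (P x - Q x)) \<le> (\<integral>\<^sup>+x. ennreal (Q x)) + 0"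
      using le eq by simp
    then show ?thesis using finQ by (auto simp: ennreal_add_left_cancel_le)
  qed
  then have "AE x in lborel. ennreal (P x - Q x) = 0"
    by (subst (asm) nn_integral_0_iff_AE) auto
  then have "AE x in lborel. x \<in> {x. P x = Q x}"
    using Q by (auto elim!: eventually_mono simp: ennreal_eq_0_iff intro: antisym)
  then have "AE x in lebesgue. x \<in> {x. P x = Q x}" by (rule AE_completion)
  moreover have "closed {x. P x = Q x}" using cont by (rule closed_Collect_eq)
  ultimately show ?thesis using mem_closed_if_AE_lebesgue by blast
qed

lemma continuous_on_modulus:
  fixes g :: "'a::metric_space \<Rightarrow> real"
  assumes "\<And>e. 0 < e \<Longrightarrow> 0 < \<delta> e" "\<And>e x y. 0 < e \<Longrightarrow> dist x y < \<delta> e \<Longrightarrow> \<bar>g x - g y\<bar> \<le> e"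
  shows "continuous_on A g"
proof (rule continuous_onI)
  fix x e :: real and y :: 'a assume "0 < e"
  then show "\<exists>d>0. \<forall>x'\<in>A. dist x' y < d \<longrightarrow> dist (g x') (g y) \<le> e"
    using assms by (intro exI[of _ "\<delta> e"]) (auto simp: dist_real_def)
qed

text \<open>\<open>\<delta>\<close> is one modulus of continuity for the whole class, which makes it
  equicontinuous. The volume is a lower bound for the closed condition \<open>1 \<le> g x\<close>,
  because the measure of such sets can only jump up in the limit.\<close>

definition competitors ::
    "real \<Rightarrow> real \<Rightarrow> ennreal \<Rightarrow> (real \<Rightarrow> real) \<Rightarrow> ennreal \<Rightarrow> (real ^ 'n \<Rightarrow> real) set" where
  "competitors \<alpha> R v \<delta> E = {g. (\<forall>x. 0 \<le> g x \<and> g x \<le> 1) \<and> (\<forall>x. R < norm x \<longrightarrow> g x = 0) \<and>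
     (\<forall>e>0. \<forall>x y. dist x y < \<delta> e \<longrightarrow> \<bar>g x - g y\<bar> \<le> e) \<and>
     v \<le> emeasure lborel {x. 1 \<le> g x} \<and> gagliardo \<alpha> g \<le> E}"

definition inertia :: "(real ^ 'n \<Rightarrow> real) \<Rightarrow> ennreal" where
  "inertia g = (\<integral>\<^sup>+x. ennreal (g x * (norm x)\<^sup>2))"

context
  fixes \<alpha> R :: real and v E :: ennreal and \<delta> :: "real \<Rightarrow> real"
  assumes alpha: "0 < \<alpha>" and \<delta>: "\<And>e. 0 < e \<Longrightarrow> 0 < \<delta> e"
begin

abbreviation "\<F> \<equiv> competitors \<alpha> R v \<delta> E :: (real ^ 'n \<Rightarrow> real) set"

lemma competitors_continuous: "g \<in> \<F> \<Longrightarrow> continuous_on A g"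
  using \<delta> by (intro continuous_on_modulus[of \<delta>]) (auto simp: competitors_def)

lemma competitors_measurable: "g \<in> \<F> \<Longrightarrow> g \<in> borel_measurable borel"
  by (intro borel_measurable_continuous_onI competitors_continuous)

lemma inertia_finite:
  fixes g :: "real ^ 'n \<Rightarrow> real"
  assumes "g \<in> \<F>" shows "inertia g < \<infinity>"
proof -
  have le: "ennreal (g x * (norm x)\<^sup>2) \<le> ennreal (R\<^sup>2) * indicator (cball 0 R) x" for x
    proof (cases "norm x \<le> R")
      case True
      then have "(norm x)\<^sup>2 \<le> R\<^sup>2" by (intro power_mono) auto
      then have "g x * (norm x)\<^sup>2 \<le> 1 * R\<^sup>2" using assms by (intro mult_mono) (auto simp: competitors_def)
      then show ?thesis using True by (simp add: ennreal_leI)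
    qed (use assms in \<open>auto simp: competitors_def\<close>)
  have "inertia g \<le> (\<integral>\<^sup>+x. ennreal (R\<^sup>2) * indicator (cball (0 :: real ^ 'n) R) x)"
    unfolding inertia_def by (intro nn_integral_mono le)
  also have "\<dots> = ennreal (R\<^sup>2) * emeasure lborel (cball (0 :: real ^ 'n) R)"
    by (rule nn_integral_cmult_indicator) simp
  also have "\<dots> < \<infinity>" using emeasure_lborel_cball_finite[of "0 :: real ^ 'n" R] by (simp add: ennreal_mult_less_top)
  finally show ?thesis .
qed

lemma polarize_competitors:
  fixes g :: "real ^ 'n \<Rightarrow> real"
  assumes g: "g \<in> \<F>" and u: "norm u = 1" and "0 \<le> s"
  shows "polarize u s g \<in> \<F>"
proof -
  note [measurable] = competitors_measurable[OF g]
  have "emeasure lborel {x. 1 \<le> h x} = (\<integral>\<^sup>+x. indicator {1..} (h x))"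
    if [measurable]: "h \<in> borel_measurable borel" for h :: "real ^ 'n \<Rightarrow> real"
  proof -
    have "(\<integral>\<^sup>+x. indicator {1..} (h x)) = (\<integral>\<^sup>+x. indicator {x. 1 \<le> h x} x)"
      by (intro nn_integral_cong) (auto simp: indicator_def)
    then show ?thesis by simp
  qed
  then have "emeasure lborel {x. 1 \<le> polarize u s g x} = emeasure lborel {x. 1 \<le> g x}"
    using nn_integral_polarize[OF u, of g "indicator {1..}" s] competitors_measurable[OF g] by simp
  moreover have "0 \<le> polarize u s g x \<and> polarize u s g x \<le> 1" for x
    using g by (auto simp: competitors_def polarize_def max_def min_def)
  moreover have "polarize u s g x = 0" if "R < norm x" for x
    by (rule polarize_support[OF u \<open>0 \<le> s\<close> _ _ that]) (use g in \<open>auto simp: competitors_def\<close>)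
  moreover have "\<bar>polarize u s g x - polarize u s g y\<bar> \<le> e" if "0 < e" "dist x y < \<delta> e" for e x y
    by (rule polarize_modulus[OF u _ that(2)]) (use g that in \<open>auto simp: competitors_def\<close>)
  moreover have "gagliardo \<alpha> (polarize u s g) \<le> E"
    using gagliardo_polarize_le[OF alpha u competitors_measurable[OF g], of s] g
    by (auto simp: competitors_def)
  ultimately show ?thesis using g by (simp add: competitors_def)
qed

lemma competitors_limit:
  fixes G :: "nat \<Rightarrow> real ^ 'n \<Rightarrow> real" and g :: "real ^ 'n \<Rightarrow> real"
  assumes G: "\<And>n. G n \<in> \<F>" and lim: "\<And>x. (\<lambda>n. G n x) \<longlonglongrightarrow> g x"
  shows "g \<in> \<F>"
proof -
  have [measurable]: "\<And>n. G n \<in> borel_measurable borel" by (rule competitors_measurable[OF G])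
  have 01: "0 \<le> g x \<and> g x \<le> 1" for x
    using G by (auto simp: competitors_def intro!: LIMSEQ_le_const[OF lim] LIMSEQ_le_const2[OF lim])
  have supp: "g x = 0" if "R < norm x" for x
  proof -
    have "(\<lambda>n. G n x) = (\<lambda>n. 0)" using G that by (auto simp: competitors_def)
    then show ?thesis using lim[of x] by (simp add: LIMSEQ_const_iff)
  qed
  have mod: "\<bar>g x - g y\<bar> \<le> e" if "0 < e" "dist x y < \<delta> e" for e x y
  proof (rule LIMSEQ_le_const2)
    show "(\<lambda>n. \<bar>G n x - G n y\<bar>) \<longlonglongrightarrow> \<bar>g x - g y\<bar>" by (intro tendsto_intros lim)
    show "\<exists>N. \<forall>n\<ge>N. \<bar>G n x - G n y\<bar> \<le> e" using G that by (auto simp: competitors_def)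
  qed
  have "continuous_on UNIV g" by (rule continuous_on_modulus[OF \<delta> mod])
  then have [measurable]: "g \<in> borel_measurable borel" by (rule borel_measurable_continuous_onI)
  let ?B = "cball (0 :: real ^ 'n) R" and ?I = "\<lambda>h x. indicator {x. 1 \<le> h x} x :: ennreal"
  have [measurable]: "?B \<in> sets borel" by simp
  \<comment> \<open>Reverse Fatou: the common support radius provides the integrable majorant, and a
    point with \<open>g x < 1\<close> eventually leaves the sets
    \<open>{x. 1 \<le> G n x}\<close>.\<close>
  have "v \<le> limsup (\<lambda>n. \<integral>\<^sup>+x. ?I (G n) x)"
  proof (rule le_Limsup)
    have "v \<le> (\<integral>\<^sup>+x. ?I (G n) x)" for n using G[of n] by (simp add: competitors_def)
    then show "eventually (\<lambda>n. v \<le> (\<integral>\<^sup>+x. ?I (G n) x)) sequentially" by (intro always_eventually allI)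
  qed simp
  also have "\<dots> \<le> (\<integral>\<^sup>+x. limsup (\<lambda>n. ?I (G n) x))"
  proof (rule nn_integral_limsup[where w="indicator ?B"])
    have "?I (G n) x \<le> indicator ?B x" for n x
      using G[of n] by (cases "R < norm x") (auto simp: competitors_def indicator_def)
    then show "AE x in lborel. ?I (G n) x \<le> indicator ?B x" for n by (intro AE_I2)
    show "(\<integral>\<^sup>+x. indicator ?B x) < \<infinity>" using emeasure_lborel_cball_finite[of "0 :: real ^ 'n" R] by simp
  qed measurable
  also have "\<dots> \<le> (\<integral>\<^sup>+x. ?I g x)"
  proof (rule nn_integral_mono)
    fix x
    show "limsup (\<lambda>n. ?I (G n) x) \<le> ?I g x"
    proof (cases "1 \<le> g x")
      case True
      then show ?thesis by (intro Limsup_bounded) (auto intro: always_eventually simp: indicator_def)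
    next
      case False
      then have "eventually (\<lambda>n. G n x < 1) sequentially" by (intro order_tendstoD(2)[OF lim]) simp
      then have "eventually (\<lambda>n. ?I (G n) x \<le> 0) sequentially" by eventually_elim simp
      from Limsup_bounded[OF this] show ?thesis using False by simp
    qed
  qed
  finally have "v \<le> emeasure lborel {x. 1 \<le> g x}" by simp
  moreover have "gagliardo \<alpha> g \<le> E"
    by (rule gagliardo_liminf[of G]) (use G lim in \<open>auto simp: competitors_def\<close>)
  ultimately show ?thesis using 01 supp mod by (simp add: competitors_def)
qed

lemma inertia_minimizer:
  assumes "(\<F> :: (real ^ 'n \<Rightarrow> real) set) \<noteq> {}"
  obtains g :: "real ^ 'n \<Rightarrow> real" where "g \<in> \<F>" "\<And>h :: real ^ 'n \<Rightarrow> real. h \<in> \<F> \<Longrightarrow> inertia g \<le> inertia h"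
proof -
  obtain f where f: "decseq f" "range f \<subseteq> inertia ` (\<F> :: (real ^ 'n \<Rightarrow> real) set)" "Inf (inertia ` (\<F> :: (real ^ 'n \<Rightarrow> real) set)) = (INF i. f i :: ennreal)"
    using ennreal_Inf_countable_INF[of "inertia ` (\<F> :: (real ^ 'n \<Rightarrow> real) set)"] assms by blast
  have "\<forall>n. \<exists>g :: real ^ 'n \<Rightarrow> real. g \<in> \<F> \<and> f n = inertia g" using f(2) by auto
  then obtain G :: "nat \<Rightarrow> real ^ 'n \<Rightarrow> real" where G: "\<And>n. G n \<in> \<F>" "\<And>n. f n = inertia (G n)" by metis
  have Jlim: "(\<lambda>n. inertia (G n)) \<longlonglongrightarrow> Inf (inertia ` (\<F> :: (real ^ 'n \<Rightarrow> real) set))"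
  proof -
    have "f = (\<lambda>n. inertia (G n))" using G(2) by auto
    then show ?thesis using LIMSEQ_INF[OF f(1)] f(3) by simp
  qed
  obtain g0 k where k: "strict_mono (k :: nat \<Rightarrow> nat)"
    and lim0: "\<And>e. 0 < e \<Longrightarrow> \<exists>N. \<forall>n x. n \<ge> N \<and> x \<in> cball 0 R \<longrightarrow> norm (G (k n) x - g0 x) < e"
  proof (rule Arzela_Ascoli[of "cball (0 :: real ^ 'n) R" G 1])
    show "norm (G n x) \<le> 1" for n x using G(1)[of n] by (auto simp: competitors_def)
    fix x :: "real ^ 'n" and e :: real assume "0 < e"
    have "norm (G n x - G n y) < e" if "norm (x - y) < \<delta> (e/2)" for n y
    proof -
      have "\<forall>e>0. \<forall>x y. dist x y < \<delta> e \<longrightarrow> \<bar>G n x - G n y\<bar> \<le> e" using G(1)[of n] by (simp add: competitors_def)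
      then have "\<bar>G n x - G n y\<bar> \<le> e / 2" using that \<open>0 < e\<close> by (metis dist_norm half_gt_zero)
      then show ?thesis using \<open>0 < e\<close> by simp
    qed
    then show "\<exists>d. 0 < d \<and> (\<forall>n y. y \<in> cball 0 R \<and> norm (x - y) < d \<longrightarrow> norm (G n x - G n y) < e)"
      using \<delta>[of "e/2"] \<open>0 < e\<close> by auto
  qed (auto intro: that)
  \<comment> \<open>Arzela-Ascoli yields a limit on the compact ball only; outside it all
    competitors vanish, so the limit is continued by 0.\<close>
  define g where "g x = (if norm x \<le> R then g0 x else 0)" for x
  have lim: "(\<lambda>n. G (k n) x) \<longlonglongrightarrow> g x" for x
  proof (cases "norm x \<le> R")
    case True
    then show ?thesis using lim0 by (force simp: g_def LIMSEQ_iff)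
  next
    case False
    then have "(\<lambda>n. G (k n) x) = (\<lambda>n. 0)" using G(1) by (auto simp: competitors_def)
    then show ?thesis using False by (simp add: g_def)
  qed
  have gF: "g \<in> \<F>" by (rule competitors_limit[OF _ lim]) (rule G(1))
  have [measurable]: "G n \<in> borel_measurable borel" for n by (rule competitors_measurable[OF G(1)])
  have "inertia g = (\<integral>\<^sup>+x. liminf (\<lambda>n. ennreal (G (k n) x * (norm x)\<^sup>2)))"
    unfolding inertia_def
    by (intro nn_integral_cong lim_imp_Liminf[symmetric]) (auto intro!: tendsto_intros lim)
  also have "\<dots> \<le> liminf (\<lambda>n. inertia (G (k n)))"
    unfolding inertia_def by (rule nn_integral_liminf) measurable
  also have "\<dots> = Inf (inertia ` (\<F> :: (real ^ 'n \<Rightarrow> real) set))"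
    using LIMSEQ_subseq_LIMSEQ[OF Jlim k] by (intro lim_imp_Liminf) (auto simp: o_def)
  finally have "inertia g \<le> Inf (inertia ` (\<F> :: (real ^ 'n \<Rightarrow> real) set))" .
  then show ?thesis by (intro that[OF gF]) (meson INF_lower order_trans)
qed

text \<open>For \<open>0 < s\<close> the favoured point of a mirror pair is strictly nearer to the
  origin, so moving the larger value there lowers the inertia unless it was there already. As the
  polarized function is again a competitor, minimality excludes any strict gain.\<close>

lemma minimizer_reflect_le:
  fixes g :: "real ^ 'n \<Rightarrow> real"
  assumes g: "g \<in> \<F>" and min: "\<And>h :: real ^ 'n \<Rightarrow> real. h \<in> \<F> \<Longrightarrow> inertia g \<le> inertia h"
    and u: "norm u = 1" and s: "0 < s" and x: "u \<bullet> x < s"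
  shows "g (reflect u s x) \<le> g x"
proof -
  let ?r = "reflect u s" and ?p = "polarize u s g"
  \<comment> \<open>Folding the inertia over mirror pairs makes the comparison pointwise: by
    \<open>diff\<close> the gain at \<open>x\<close> is the transferred amount of \<open>g\<close>
    times the difference of the squared norms.\<close>
  define P where "P h x = h x * (norm x)\<^sup>2 + h (?r x) * (norm (?r x))\<^sup>2" for h :: "real ^ 'n \<Rightarrow> real" and x
  have pF: "?p \<in> \<F>" using polarize_competitors[OF g u] s by simp
  have JP: "(\<integral>\<^sup>+x. ennreal (P h x)) = 2 * inertia h" if h: "h \<in> \<F>" for h
  proof -
    note [measurable] = competitors_measurable[OF h]
    have nn: "0 \<le> h x" for x using h by (auto simp: competitors_def)
    have "(\<integral>\<^sup>+x. ennreal (P h x)) = (\<integral>\<^sup>+x. ennreal (h x * (norm x)\<^sup>2) + ennreal (h (?r x) * (norm (?r x))\<^sup>2))"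
      unfolding P_def by (intro nn_integral_cong ennreal_plus) (auto simp: nn)
    also have "\<dots> = inertia h + (\<integral>\<^sup>+x. ennreal (h (?r x) * (norm (?r x))\<^sup>2))"
      unfolding inertia_def by (rule nn_integral_add) measurable
    also have "(\<integral>\<^sup>+x. ennreal (h (?r x) * (norm (?r x))\<^sup>2)) = inertia h"
      unfolding inertia_def by (rule nn_integral_reflect[OF u]) measurable
    finally show ?thesis by (simp add: mult_2)
  qed
  have diff: "P g x - P ?p x = (max (g x) (g (?r x)) - g x) * ((norm (?r x))\<^sup>2 - (norm x)\<^sup>2)" if "u \<bullet> x \<le> s" for x
    using polarize_le[OF u that, of g] by (simp add: P_def max_def min_def algebra_simps)
  have le: "P ?p x \<le> P g x" for x
  proof (cases "u \<bullet> x \<le> s")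
    case True
    have "0 \<le> P g x - P ?p x" unfolding diff[OF True]
      using True s by (intro mult_nonneg_nonneg) (auto simp: norm_reflect[OF u])
    then show ?thesis by simp
  next
    case False
    have "P h (?r x) = P h x" for h by (simp add: P_def u)
    moreover have "u \<bullet> ?r x \<le> s" using False by (simp add: inner_reflect[OF u])
    then have "0 \<le> P g (?r x) - P ?p (?r x)" unfolding diff[OF \<open>u \<bullet> ?r x \<le> s\<close>]
      using s by (intro mult_nonneg_nonneg) (auto simp: norm_reflect[OF u, of _ "?r x"] simp del: reflect_reflect)
    ultimately show ?thesis by simp
  qed
  have "P g x = P ?p x"
  proof (rule eq_of_nn_integral_eq[OF _ _ _ le])
    have c: "continuous_on UNIV (P h)" if h: "h \<in> \<F>" for h
      unfolding P_def
      by (intro continuous_intros competitors_continuous[OF h] reflect_continuous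
          continuous_on_compose2[OF competitors_continuous[OF h, of UNIV] reflect_continuous]) auto
    show "continuous_on UNIV (P g)" "continuous_on UNIV (P ?p)" using c g pF by auto
    show "0 \<le> P ?p x" for x using pF by (auto simp: P_def competitors_def)
    show "(\<integral>\<^sup>+x. ennreal (P g x)) \<le> (\<integral>\<^sup>+x. ennreal (P ?p x))"
      unfolding JP[OF g] JP[OF pF] by (intro mult_left_mono min pF) auto
    show "(\<integral>\<^sup>+x. ennreal (P g x)) < \<infinity>"
      unfolding JP[OF g] using inertia_finite[OF g] by (simp add: ennreal_mult_less_top)
  qed
  then have "(max (g x) (g (?r x)) - g x) * ((norm (?r x))\<^sup>2 - (norm x)\<^sup>2) = 0"
    using diff[of x] x by simp
  moreover have "(norm (?r x))\<^sup>2 - (norm x)\<^sup>2 > 0" using x s by (simp add: norm_reflect[OF u])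
  ultimately show ?thesis by (auto simp: max_def split: if_splits)
qed

lemma minimizer_radial:
  fixes g :: "real ^ 'n \<Rightarrow> real"
  assumes g: "g \<in> \<F>" and min: "\<And>h :: real ^ 'n \<Rightarrow> real. h \<in> \<F> \<Longrightarrow> inertia g \<le> inertia h"
    and xy: "norm x \<le> norm y"
  shows "g y \<le> g x"
proof -
  have strict: "g y \<le> g x" if xy: "norm x < norm y" for x y
  proof -
    define d where "d = norm (y - x)"
    have "d \<noteq> 0" using xy by (auto simp: d_def)
    then have d: "0 < d" by (simp add: d_def)
    \<comment> \<open>The hyperplane given by \<open>u\<close> and \<open>s\<close> is the
      perpendicular bisector of \<open>x\<close> and \<open>y\<close>, so the reflection carries
      \<open>x\<close> to \<open>y\<close>; \<open>s\<close> is positive because \<open>x\<close> is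
      nearer to the origin.\<close>
    define u where "u = (1 / d) *\<^sub>R (y - x)"
    define s where "s = ((norm y)\<^sup>2 - (norm x)\<^sup>2) / (2 * d)"
    have u: "norm u = 1" using d by (simp add: u_def d_def)
    have "(norm x)\<^sup>2 < (norm y)\<^sup>2" using xy by (intro power_strict_mono) auto
    then have s: "0 < s" using d by (simp add: s_def)
    have dd: "d\<^sup>2 = (norm x)\<^sup>2 + (norm y)\<^sup>2 - 2 * (x \<bullet> y)"
      by (simp add: d_def power2_norm_eq_inner inner_simps inner_commute)
    have ux: "u \<bullet> x - s = - d / 2"
    proof -
      have "u \<bullet> x = (x \<bullet> y - (norm x)\<^sup>2) / d"
        by (simp add: u_def inner_simps power2_norm_eq_inner inner_commute)
      then have "u \<bullet> x - s = - (d\<^sup>2) / (2 * d)"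
        using d by (simp add: s_def dd field_simps)
      then show ?thesis using d by (simp add: power2_eq_square)
    qed
    have "reflect u s x = y" using d by (simp add: reflect_def ux) (simp add: u_def)
    then show ?thesis using minimizer_reflect_le[OF g min u s, of x] ux d by simp
  qed
  show ?thesis
  proof (cases "norm x = norm y")
    case True
    show ?thesis
    proof (cases "y = 0")
      case False
      \<comment> \<open>Points of equal norm are not separated by such a hyperplane, so
        \<open>x\<close> is approached by the shorter vectors \<open>t n *\<^sub>R x\<close>, to
        which the strict case applies.\<close>
      define t where "t n = 1 - inverse (real (Suc n))" for n
      have t: "t \<longlonglongrightarrow> 1" unfolding t_def
        using tendsto_diff[OF tendsto_const LIMSEQ_inverse_real_of_nat, of 1] by simp
      have t01: "0 \<le> t n" "t n < 1" for n by (auto simp: t_def field_simps)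
      have "isCont g x" using competitors_continuous[OF g, of UNIV] by (simp add: continuous_on_eq_continuous_at)
      moreover have "(\<lambda>n. t n *\<^sub>R x) \<longlonglongrightarrow> x" using tendsto_scaleR[OF t tendsto_const[of x]] by simp
      ultimately have "(\<lambda>n. g (t n *\<^sub>R x)) \<longlonglongrightarrow> g x" by (rule isCont_tendsto_compose)
      moreover have "g y \<le> g (t n *\<^sub>R x)" for n
        using True False t01[of n] by (intro strict) (simp add: mult_less_cancel_right2)
      ultimately show ?thesis by (intro LIMSEQ_le_const) auto
    qed (use True in simp)
  qed (use strict xy in auto)
qed

end

text \<open>The radius is the supremum of the norms; openness prevents it from being
  attained.\<close>

lemma open_radial_ball:
  fixes U :: "'a::euclidean_space set"
  assumes U: "open U" "bounded U" and down: "\<And>x y. x \<in> U \<Longrightarrow> norm y \<le> norm x \<Longrightarrow> y \<in> U"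
  obtains r where "0 \<le> r" "U = ball 0 r"
proof (cases "U = {}")
  case True then show ?thesis using that[of 0] by simp
next
  case False
  have bdd: "bdd_above (norm ` U)" using U(2) by (auto simp: bounded_iff bdd_above_def)
  define r where "r = Sup (norm ` U)"
  have "x \<in> ball 0 r" if x: "x \<in> U" for x
  proof -
    obtain e where e: "0 < e" "cball x e \<subseteq> U" using U(1) x open_contains_cball by blast
    \<comment> \<open>A unit vector along which the norm grows at full speed; at the origin any
      direction will do.\<close>
    define z where "z = (if x = 0 then (SOME b. b \<in> Basis) else (1 / norm x) *\<^sub>R x)"
    have z: "norm (x + e *\<^sub>R z) = norm x + e" "norm z = 1"
    proof -
      show 1: "norm z = 1" by (use some_in_eq[of "Basis :: 'a set"] in \<open>auto simp: z_def\<close>)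
      show "norm (x + e *\<^sub>R z) = norm x + e"
      proof (cases "x = 0")
        case False
        then have "x + e *\<^sub>R z = (1 + e / norm x) *\<^sub>R x" by (simp add: z_def algebra_simps)
        then have "norm (x + e *\<^sub>R z) = (1 + e / norm x) * norm x" using e by (simp add: abs_of_pos add_pos_nonneg)
        also have "\<dots> = norm x + e" using False by (simp add: distrib_right)
        finally show ?thesis .
      qed (use 1 e in auto)
    qed
    then have "x + e *\<^sub>R z \<in> U" using e by (auto simp: dist_norm)
    then have "norm x + e \<le> r" unfolding r_def z(1)[symmetric] by (intro cSup_upper bdd imageI)
    then show ?thesis using e by simp
  qed
  moreover have "x \<in> U" if "x \<in> ball 0 r" for x
  proof -
    have "norm x < r" using that by simp
    then obtain y where "y \<in> U" "norm x < norm y" unfolding r_def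
      using less_cSup_iff[of "norm ` U"] False bdd by auto
    then show ?thesis using down by auto
  qed
  moreover have "0 \<le> r"
  proof -
    obtain x where "x \<in> U" using False by auto
    then have "norm x < r" using calculation(1)[of x] by simp
    then show ?thesis using norm_ge_zero[of x] by linarith
  qed
  ultimately show ?thesis by (intro that[of r]) auto
qed

lemma compact_support_modulus:
  fixes f :: "'a::euclidean_space \<Rightarrow> real"
  assumes f: "continuous_on UNIV f" "\<And>x. R < norm x \<Longrightarrow> f x = 0" and e: "0 < e"
  shows "\<exists>d>0. \<forall>x y. dist x y < d \<longrightarrow> \<bar>f x - f y\<bar> \<le> e"
proof -
  have "uniformly_continuous_on (cball 0 (R + 1)) f"
    using f by (intro compact_uniformly_continuous continuous_on_subset[OF f(1)]) auto
  then obtain d where d: "0 < d" "\<And>x y. x \<in> cball 0 (R + 1) \<Longrightarrow> y \<in> cball 0 (R + 1) \<Longrightarrow> dist x y < d \<Longrightarrow> dist (f x) (f y) < e"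
    using e unfolding uniformly_continuous_on_def by metis
  \<comment> \<open>The margin 1 in \<open>R + 1\<close> and in \<open>min d 1\<close> ensures that
    a point outside the larger ball has only neighbours outside the support.\<close>
  have *: "\<bar>f x - f y\<bar> \<le> e" if "dist x y < min d 1" "R + 1 < norm x" for x y
  proof -
    have "norm x \<le> norm y + dist x y" by (metis dist_norm norm_triangle_sub add.commute)
    then show ?thesis using that f(2) e by simp
  qed
  have "\<bar>f x - f y\<bar> \<le> e" if "dist x y < min d 1" for x y
  proof (cases "x \<in> cball 0 (R + 1) \<and> y \<in> cball 0 (R + 1)")
    case True
    then show ?thesis using d(2)[of x y] that by (simp add: dist_real_def)
  next
    case False
    then show ?thesis using *[of x y] *[of y x] that by (auto simp: dist_commute abs_minus_commute)
  qed
  then show ?thesis using d(1) by (intro exI[of _ "min d 1"]) auto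
qed

text \<open>The bound is read off from the inertia minimiser \<open>g\<close> of the class
  containing the truncation \<open>min 1 f\<close>. For every level in \<open>[0, 1)\<close> its
  superlevel set is a ball of volume at least \<open>m\<close>; these levels have total length 1, so
  the coarea formula reproduces the bound for a single ball.\<close>

lemma gagliardo_ge_ball:
  fixes f :: "real ^ 'n \<Rightarrow> real"
  assumes alpha: "0 < \<alpha>" "\<alpha> < 1"
    and f: "continuous_on UNIV f" "\<And>x. 0 \<le> f x" "\<And>x. R < norm x \<Longrightarrow> f x = 0"
  defines "N \<equiv> real CARD('n)"
  shows "ennreal ((measure lborel {x. 1 \<le> f x} / unit_ball_vol N) powr ((N - \<alpha>) / N)) * (2 * perimeter \<alpha> (ball (0 :: real ^ 'n) 1))
    \<le> gagliardo \<alpha> f"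
proof -
  let ?P = "perimeter \<alpha> (ball (0 :: real ^ 'n) 1)"
  define m where "m = measure lborel {x. 1 \<le> f x}"
  define W where "W = unit_ball_vol N"
  define q where "q = (N - \<alpha>) / N"
  have N: "1 \<le> N" by (simp add: N_def Suc_leI)
  have W: "0 < W" using N by (simp add: W_def)
  obtain \<delta> where \<delta>: "\<And>e. 0 < e \<Longrightarrow> 0 < \<delta> e" "\<And>e x y. 0 < e \<Longrightarrow> dist x y < \<delta> e \<Longrightarrow> \<bar>f x - f y\<bar> \<le> e"
    using compact_support_modulus[OF f(1,3)] by metis
  have [measurable]: "f \<in> borel_measurable borel" using f(1) by (rule borel_measurable_continuous_onI)
  have sub: "{x. 1 \<le> f x} \<subseteq> cball 0 R" using f(3) by (force simp: not_less[symmetric])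
  have fin: "emeasure lborel {x. 1 \<le> f x} < \<infinity>"
    by (rule le_less_trans[OF emeasure_mono[OF sub] emeasure_lborel_cball_finite]) simp
  then have v: "emeasure lborel {x. 1 \<le> f x} = ennreal m"
    unfolding m_def by (intro emeasure_eq_ennreal_measure) simp
  define f0 where "f0 x = min 1 (f x)" for x
  have "f0 \<in> competitors \<alpha> R (ennreal m) \<delta> (gagliardo \<alpha> f)"
  proof -
    have "\<bar>f0 x - f0 y\<bar> \<le> \<bar>f x - f y\<bar>" for x y by (auto simp: f0_def min_def)
    then have "gagliardo \<alpha> f0 \<le> gagliardo \<alpha> f" "\<And>e x y. 0 < e \<Longrightarrow> dist x y < \<delta> e \<Longrightarrow> \<bar>f0 x - f0 y\<bar> \<le> e"
      using \<delta> by (blast intro: gagliardo_mono order_trans)+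
    moreover have "{x. 1 \<le> f0 x} = {x. 1 \<le> f x}" by (auto simp: f0_def)
    ultimately show ?thesis using f v by (auto simp: competitors_def f0_def)
  qed
  then have ne: "(competitors \<alpha> R (ennreal m) \<delta> (gagliardo \<alpha> f) :: (real ^ 'n \<Rightarrow> real) set) \<noteq> {}" by auto
  obtain g :: "real ^ 'n \<Rightarrow> real" where g: "g \<in> competitors \<alpha> R (ennreal m) \<delta> (gagliardo \<alpha> f)"
    and min: "\<And>h :: real ^ 'n \<Rightarrow> real. h \<in> competitors \<alpha> R (ennreal m) \<delta> (gagliardo \<alpha> f) \<Longrightarrow> inertia g \<le> inertia h"
    by (rule inertia_minimizer[where \<delta>=\<delta>, OF alpha(1) \<delta>(1) ne]) auto
  have cont: "continuous_on UNIV g" by (rule competitors_continuous[OF alpha(1) \<delta>(1) g])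
  then have [measurable]: "g \<in> borel_measurable borel" by (rule borel_measurable_continuous_onI)
  have level: "ennreal ((m / W) powr q) * (2 * ?P) \<le> gagliardo \<alpha> (indicator {x. t < g x})" if t: "0 \<le> t" "t < 1" for t
  proof -
    have "open {x. t < g x}" using cont by (intro open_Collect_less continuous_intros)
    moreover have "{x. t < g x} \<subseteq> cball 0 R" using g t by (force simp: competitors_def not_less[symmetric])
    then have "bounded {x. t < g x}" using bounded_cball bounded_subset by blast
    ultimately obtain r where r: "0 \<le> r" "{x. t < g x} = ball 0 r"
    proof (rule open_radial_ball)
      show "y \<in> {x. t < g x}" if "x \<in> {x. t < g x}" "norm y \<le> norm x" for x y
        using minimizer_radial[OF alpha(1) \<delta>(1) g min that(2)] that(1) by auto
    qed
    have "ennreal m \<le> emeasure lborel {x. 1 \<le> g x}" using g by (simp add: competitors_def)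
    also have "\<dots> \<le> emeasure lborel {x. t < g x}" using t by (intro emeasure_mono) auto
    also have "\<dots> = ennreal (W * r ^ CARD('n))" using r by (simp add: emeasure_ball W_def N_def)
    finally have "m \<le> W * r ^ CARD('n)" using W r by simp
    then have "m / W \<le> r ^ CARD('n)" using W by (simp add: field_simps)
    then have 1: "(m / W) powr q \<le> (r ^ CARD('n)) powr q"
      using N alpha W by (intro powr_mono2) (auto simp: q_def m_def)
    have "ennreal ((m / W) powr q) * (2 * ?P) \<le> 2 * perimeter \<alpha> (ball (0 :: real ^ 'n) r)"
    proof (cases "r = 0")
      case True
      then show ?thesis using 1 N W by (simp add: zero_power)
    next
      case False
      then have "(r ^ CARD('n)) powr q = r powr (N - \<alpha>)"
        using r N by (simp add: powr_realpow[symmetric] powr_powr N_def[symmetric] q_def)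
      then have "2 * perimeter \<alpha> (ball (0 :: real ^ 'n) r) = ennreal ((r ^ CARD('n)) powr q) * (2 * ?P)"
        using False r perimeter_ball_scale[of r \<alpha>, where 'n='n] by (simp add: N_def mult_ac)
      then show ?thesis using 1 by (auto intro!: mult_right_mono ennreal_leI)
    qed
    then show ?thesis using r by (simp add: gagliardo_indicator)
  qed
  have "ennreal ((m / W) powr q) * (2 * ?P) = (\<integral>\<^sup>+t. ennreal ((m / W) powr q) * (2 * ?P) * indicator {0..<1::real} t)"
    by (subst nn_integral_cmult_indicator) auto
  also have "\<dots> \<le> (\<integral>\<^sup>+t\<in>{0..}. gagliardo \<alpha> (indicator {x. t < g x}) \<partial>lborel)"
    by (intro nn_integral_mono) (use level in \<open>auto simp: indicator_def\<close>)
  also have "\<dots> = gagliardo \<alpha> g"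
    by (rule gagliardo_coarea[symmetric]) (use g in \<open>auto simp: competitors_def\<close>)
  also have "\<dots> \<le> gagliardo \<alpha> f" using g by (simp add: competitors_def)
  finally show ?thesis by (simp add: m_def W_def q_def)
qed

section \<open>Mollification\<close>

lemma Ck_on_subset: "Ck_on k U f \<Longrightarrow> V \<subseteq> U \<Longrightarrow> Ck_on k V f"
  by (induction k arbitrary: f) (auto intro: continuous_on_subset)

lemma Ck_on_Suc_D: "Ck_on (Suc k) U f \<Longrightarrow> Ck_on k U f"
proof (induction k arbitrary: f)
  case 0
  then show ?case
    by (auto intro!: continuous_at_imp_continuous_on differentiable_imp_continuous_within)
next
  case (Suc k)
  then show ?case by (metis Ck_on.simps(2))
qed

lemma Ck_on_SucI:
  assumes "\<And>x. (f has_derivative f' x) (at x)" "\<And>v. Ck_on k UNIV (\<lambda>x. f' x v)"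
  shows "Ck_on (Suc k) UNIV f"
proof -
  have "frechet_derivative f (at x) = f' x" for x
    using frechet_derivative_at[OF assms(1)] by simp
  then show ?thesis using assms by (auto simp: differentiable_def)
qed

lemma Ck_on_has_derivative:
  "Ck_on (Suc k) U f \<Longrightarrow> x \<in> U \<Longrightarrow> (f has_derivative frechet_derivative f (at x)) (at x)"
  by (simp add: frechet_derivative_works[symmetric])

lemma Ck_on_const: "Ck_on k UNIV (\<lambda>x. c)"
proof (induction k arbitrary: c)
  case (Suc k)
  show ?case by (rule Ck_on_SucI[OF has_derivative_const]) (rule Suc)
qed auto

lemma Ck_on_add:
  "Ck_on k UNIV f \<Longrightarrow> Ck_on k UNIV g \<Longrightarrow> Ck_on k UNIV (\<lambda>x. f x + g x)"
proof (induction k arbitrary: f g)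
  case (Suc k)
  show ?case
    by (rule Ck_on_SucI[OF has_derivative_add[OF Ck_on_has_derivative[OF Suc.prems(1)] Ck_on_has_derivative[OF Suc.prems(2)]]])
       (use Suc in auto)
qed (auto intro: continuous_intros)

lemma Ck_on_mult:
  "Ck_on k UNIV f \<Longrightarrow> Ck_on k UNIV g \<Longrightarrow> Ck_on k UNIV (\<lambda>x. f x * g x)"
proof (induction k arbitrary: f g)
  case (Suc k)
  show ?case
  proof (rule Ck_on_SucI[OF has_derivative_mult[OF Ck_on_has_derivative[OF Suc.prems(1)] Ck_on_has_derivative[OF Suc.prems(2)]]])
    show "Ck_on k UNIV (\<lambda>x. f x * frechet_derivative g (at x) v + frechet_derivative f (at x) v * g x)" for v
      using Suc by (intro Ck_on_add Suc.IH) (auto dest: Ck_on_Suc_D simp del: Ck_on.simps(2), auto)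
  qed auto
qed (auto intro: continuous_intros)

lemma Ck_on_cmult: "Ck_on k UNIV f \<Longrightarrow> Ck_on k UNIV (\<lambda>x. c * f x)"
  by (intro Ck_on_mult Ck_on_const)

lemma Ck_on_inner: "Ck_on k UNIV (\<lambda>x. x \<bullet> a)"
proof (cases k)
  case (Suc j)
  have "((\<lambda>x. x \<bullet> a) has_derivative (\<lambda>v. v \<bullet> a)) (at x)" for x
    by (auto intro!: derivative_eq_intros)
  then show ?thesis unfolding Suc by (rule Ck_on_SucI) (rule Ck_on_const)
qed (auto intro!: continuous_intros)

lemma Ck_on_norm_square: "Ck_on k UNIV (\<lambda>x. c + d * (x \<bullet> x))"
proof -
  have "Ck_on k UNIV (\<lambda>x::'a. x \<bullet> x)"
  proof (cases k)
    case (Suc j)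
    have "((\<lambda>x::'a. x \<bullet> x) has_derivative (\<lambda>v. 2 * (x \<bullet> v))) (at x)" for x
      by (auto intro!: derivative_eq_intros simp: inner_commute)
    then show ?thesis unfolding Suc
      by (rule Ck_on_SucI) (use Ck_on_cmult[OF Ck_on_inner] in blast)
  qed (auto intro!: continuous_intros)
  then show ?thesis by (intro Ck_on_add Ck_on_const Ck_on_cmult)
qed

text \<open>The powers of \<open>t\<close> in the denominator make the family stable: the derivative
  of \<open>flat m\<close> is a combination of \<open>flat (m + 2)\<close> and
  \<open>flat (m + 1)\<close>, so smoothness follows by an induction over all \<open>m\<close> at
  once.\<close>

definition flat :: "nat \<Rightarrow> real \<Rightarrow> real" where
  "flat m t = (if 0 < t then exp (- (1 / t)) / t ^ m else 0)"

text \<open>This is the difference quotient of \<open>flat m\<close> at 0; from the right, with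
  \<open>1 / t\<close> as variable, the exponential beats the power.\<close>

lemma flat_div_tendsto: "((\<lambda>t. flat m t / t) \<longlongrightarrow> 0) (at 0)"
proof (rule filterlim_split_at)
  have "((\<lambda>t. inverse t ^ Suc m / exp (inverse t)) \<longlongrightarrow> (0::real)) (at_right 0)"
    by (rule filterlim_compose[OF tendsto_power_div_exp_0 filterlim_inverse_at_top_right])
  then show "((\<lambda>t. flat m t / t) \<longlongrightarrow> 0) (at_right 0)"
  proof (rule Lim_transform_eventually)
    show "eventually (\<lambda>t. inverse t ^ Suc m / exp (inverse t) = flat m t / t) (at_right 0)"
      using eventually_at_right_less[of "0::real"]
      by eventually_elim (simp add: flat_def exp_minus field_simps)
  qed
  show "((\<lambda>t. flat m t / t) \<longlongrightarrow> 0) (at_left 0)"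
  proof (rule Lim_transform_eventually[OF tendsto_const])
    show "eventually (\<lambda>t. 0 = flat m t / t) (at_left 0)"
      using eventually_at_left_real[of "-1" 0] by (auto simp: flat_def elim: eventually_mono)
  qed
qed

lemma flat_deriv: "(flat m has_real_derivative (flat (m + 2) t - real m * flat (m + 1) t)) (at t)"
proof -
  consider "t < 0" | "t = 0" | "0 < t" by linarith
  then show ?thesis
  proof cases
    case 1
    have "((\<lambda>_. 0) has_real_derivative 0) (at t)" by simp
    then have "(flat m has_real_derivative 0) (at t)"
      by (rule has_field_derivative_transform_within_open[of _ _ _ "{..<0}"]) (use 1 in \<open>auto simp: flat_def\<close>)
    then show ?thesis using 1 by (simp add: flat_def)
  next
    case 2
    then show ?thesis using flat_div_tendsto[of m] by (simp add: DERIV_def flat_def)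
  next
    case 3
    have "((\<lambda>t. exp (- (1 / t)) / t ^ m) has_real_derivative
       ((exp (- (1 / t)) * (1 / t\<^sup>2)) * t ^ m - exp (- (1 / t)) * (real m * t ^ (m - 1))) / (t ^ m)\<^sup>2) (at t)"
      using 3 by (auto intro!: derivative_eq_intros simp: power2_eq_square)
    also have "((exp (- (1 / t)) * (1 / t\<^sup>2)) * t ^ m - exp (- (1 / t)) * (real m * t ^ (m - 1))) / (t ^ m)\<^sup>2
      = flat (m + 2) t - real m * flat (m + 1) t"
      using 3 by (cases m) (auto simp: flat_def field_simps power2_eq_square power_add)
    finally have "((\<lambda>t. exp (- (1 / t)) / t ^ m) has_real_derivative (flat (m + 2) t - real m * flat (m + 1) t)) (at t)" .
    then show ?thesis
      by (rule has_field_derivative_transform_within_open[of _ _ _ "{0<..}"]) (use 3 in \<open>auto simp: flat_def\<close>)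
  qed
qed

lemma Ck_on_flat:
  fixes q :: "'a::euclidean_space \<Rightarrow> real"
  assumes q: "\<And>k. Ck_on k UNIV q"
  shows "Ck_on k UNIV (\<lambda>x. flat m (q x))"
proof (induction k arbitrary: m)
  case 0
  have "continuous_on UNIV (flat m)"
    using flat_deriv by (meson DERIV_continuous continuous_at_imp_continuous_on)
  then show ?case using q[of 0] by (auto intro: continuous_on_compose2)
next
  case (Suc k)
  have "((\<lambda>x. flat m (q x)) has_derivative (\<lambda>v. frechet_derivative q (at x) v * (flat (m + 2) (q x) - real m * flat (m + 1) (q x)))) (at x)" for x
    using has_derivative_compose[OF Ck_on_has_derivative[OF q[of "Suc 0"] UNIV_I] flat_deriv[unfolded has_field_derivative_def]]
    by (simp add: mult.commute)
  then show ?case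
  proof (rule Ck_on_SucI)
    fix v
    have "Ck_on k UNIV (\<lambda>x. flat (m + 2) (q x) + (- real m) * flat (m + 1) (q x))"
      by (intro Ck_on_add Ck_on_cmult Suc)
    moreover have "Ck_on k UNIV (\<lambda>x. frechet_derivative q (at x) v)" using q[of "Suc k"] by simp
    ultimately show "Ck_on k UNIV (\<lambda>x. frechet_derivative q (at x) v * (flat (m + 2) (q x) - real m * flat (m + 1) (q x)))"
      by (intro Ck_on_mult) auto
  qed
qed

lemma test_functionsI:
  fixes f :: "'a::euclidean_space \<Rightarrow> real"
  assumes "\<And>k. Ck_on k UNIV f" "\<And>x. R < norm x \<Longrightarrow> f x = 0"
  shows "f \<in> test_functions"
proof -
  have "{x. f x \<noteq> 0} \<subseteq> cball 0 R" using assms(2) by (force simp: not_less[symmetric])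
  then have "bounded {x. f x \<noteq> 0}" using bounded_cball bounded_subset by blast
  then show ?thesis using assms(1) by (simp add: test_functions_def smooth_on_def compact_closure)
qed

lemma test_functionsD:
  fixes f :: "'a::euclidean_space \<Rightarrow> real"
  assumes "f \<in> test_functions"
  shows "Ck_on k UNIV f" "continuous_on UNIV f" "f \<in> borel_measurable borel"
    "\<exists>R>0. \<forall>x. R < norm x \<longrightarrow> f x = 0"
proof -
  show 1: "Ck_on k UNIV f" for k using assms by (simp add: test_functions_def smooth_on_def)
  show "continuous_on UNIV f" using 1[of 0] by simp
  then show "f \<in> borel_measurable borel" by (rule borel_measurable_continuous_onI)
  have "bounded {x. f x \<noteq> 0}" using assms by (simp add: test_functions_def compact_closure)
  then obtain R where "\<And>x. f x \<noteq> 0 \<Longrightarrow> norm x \<le> R" "0 < R" unfolding bounded_pos by auto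
  then show "\<exists>R>0. \<forall>x. R < norm x \<longrightarrow> f x = 0" by (metis not_less)
qed

lemma compact_support_bounded:
  fixes f :: "'a::euclidean_space \<Rightarrow> real"
  assumes "continuous_on UNIV f" "\<And>x. R < norm x \<Longrightarrow> f x = 0"
  obtains M where "0 < M" "\<And>x. \<bar>f x\<bar> \<le> M"
proof -
  have "compact (f ` cball 0 R)"
    using assms(1) by (intro compact_continuous_image) (auto intro: continuous_on_subset)
  then obtain M where "0 < M" "\<And>x. x \<in> cball 0 R \<Longrightarrow> \<bar>f x\<bar> \<le> M"
    using compact_imp_bounded bounded_pos by (metis imageI real_norm_def)
  then show ?thesis using assms(2) by (intro that[of M]) (metis abs_zero less_imp_le mem_cball_0 not_less)+
qed

lemma frechet_derivative_test_function:
  fixes f :: "'a::euclidean_space \<Rightarrow> real"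
  assumes f: "f \<in> test_functions"
  shows "(\<lambda>x. frechet_derivative f (at x) v) \<in> test_functions"
proof -
  obtain R where R: "\<And>x. R < norm x \<Longrightarrow> f x = 0" using test_functionsD(4)[OF f] by auto
  show ?thesis
  proof (rule test_functionsI[of _ R])
    show "Ck_on k UNIV (\<lambda>x. frechet_derivative f (at x) v)" for k
      using test_functionsD(1)[OF f, of "Suc k"] by simp
    fix x :: 'a assume x: "R < norm x"
    have "open {x::'a. R < norm x}" by (intro open_Collect_less continuous_intros)
    then have "(f has_derivative (\<lambda>_. 0)) (at x)"
      by (rule has_derivative_transform_within_open[OF has_derivative_const]) (use x R in auto)
    then show "frechet_derivative f (at x) v = 0" using frechet_derivative_at by metis
  qed
qed

text \<open>The mean value theorem on the segment, together with uniform continuity of the partial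
  derivatives, which are test functions themselves. Uniformity in \<open>a\<close> is what allows
  differentiation under the integral of a convolution.\<close>

lemma test_function_uniform_derivative:
  fixes f :: "'a::euclidean_space \<Rightarrow> real"
  assumes f: "f \<in> test_functions" and e: "0 < e"
  shows "\<exists>d>0. \<forall>a w. norm w < d \<longrightarrow> \<bar>f (a + w) - f a - frechet_derivative f (at a) w\<bar> \<le> e * norm w"
proof -
  define D where "D x = frechet_derivative f (at x)" for x
  have D: "(f has_derivative D x) (at x)" for x
    using Ck_on_has_derivative[OF test_functionsD(1)[OF f, of "Suc 0"]] by (simp add: D_def)
  define e' where "e' = e / DIM('a)"
  have e': "0 < e'" using e by (simp add: e'_def)
  have "\<exists>d>0. \<forall>x y. dist x y < d \<longrightarrow> \<bar>D x b - D y b\<bar> \<le> e'" for b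
  proof -
    have t: "(\<lambda>x. D x b) \<in> test_functions" unfolding D_def by (rule frechet_derivative_test_function[OF f])
    obtain R where "\<And>x. R < norm x \<Longrightarrow> D x b = 0" using test_functionsD(4)[OF t] by auto
    from compact_support_modulus[OF test_functionsD(2)[OF t] this e'] show ?thesis .
  qed
  then obtain d where d: "\<And>b. 0 < d b" "\<And>b x y. dist x y < d b \<Longrightarrow> \<bar>D x b - D y b\<bar> \<le> e'" by metis
  define d0 where "d0 = Min (d ` (Basis :: 'a set))"
  have d0: "0 < d0" "\<And>b. b \<in> Basis \<Longrightarrow> d0 \<le> d b" using d(1) by (auto simp: d0_def)
  have "\<bar>f (a + w) - f a - D a w\<bar> \<le> e * norm w" if w: "norm w < d0" for a w
  proof -
    have lin: "linear (D x)" for x using D has_derivative_bounded_linear bounded_linear.linear by blast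
    have Dw: "D x w = (\<Sum>b\<in>Basis. (w \<bullet> b) * D x b)" for x
    proof -
      have "D x w = D x (\<Sum>b\<in>Basis. (w \<bullet> b) *\<^sub>R b)" by (simp only: euclidean_representation)
      also have "\<dots> = (\<Sum>b\<in>Basis. (w \<bullet> b) * D x b)"
        by (simp add: linear_sum[OF lin] linear_cmul[OF lin] del: euclidean_representation)
      finally show ?thesis .
    qed
    have "((\<lambda>t. f (a + t *\<^sub>R w)) has_derivative (\<lambda>h. D (a + t *\<^sub>R w) (h *\<^sub>R w))) (at t)" for t
      by (rule has_derivative_compose[OF _ D, where f="\<lambda>t. a + t *\<^sub>R w"]) (auto intro!: derivative_eq_intros)
    note has_derivative_at_withinI[OF this, of _ "{0..1}"]
    from mvt_simple[of 0 1 "\<lambda>t. f (a + t *\<^sub>R w)" "\<lambda>t h. D (a + t *\<^sub>R w) (h *\<^sub>R w)", OF _ this]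
    obtain t where t: "0 < t" "t < 1" "f (a + w) - f a = D (a + t *\<^sub>R w) w" by auto
    have tw: "norm (t *\<^sub>R w) < d0" using t w by (auto intro: le_less_trans[OF mult_left_le_one_le])
    have "\<bar>f (a + w) - f a - D a w\<bar> = \<bar>\<Sum>b\<in>Basis. (w \<bullet> b) * (D (a + t *\<^sub>R w) b - D a b)\<bar>"
      unfolding t(3) Dw by (simp add: sum_subtractf right_diff_distrib)
    also have "\<dots> \<le> (\<Sum>b\<in>Basis. \<bar>w \<bullet> b\<bar> * \<bar>D (a + t *\<^sub>R w) b - D a b\<bar>)"
      by (intro order_trans[OF sum_abs]) (simp add: abs_mult)
    also have "\<dots> \<le> (\<Sum>b\<in>(Basis :: 'a set). norm w * e')"
      using tw d0 by (intro sum_mono mult_mono d(2) Basis_le_norm) (force simp: dist_norm)+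
    also have "\<dots> = e * norm w" by (simp add: e'_def)
    finally show ?thesis .
  qed
  then show ?thesis using d0(1) unfolding D_def by blast
qed

section \<open>Convolution and mollifiers\<close>

definition convolution :: "('a::euclidean_space \<Rightarrow> real) \<Rightarrow> ('a \<Rightarrow> real) \<Rightarrow> 'a \<Rightarrow> real" where
  "convolution u f x = (\<integral>y. u y * f (x - y) \<partial>lborel)"

lemma convolution_integrable:
  assumes u: "integrable lborel u" and f: "f \<in> test_functions"
  shows "integrable lborel (\<lambda>y. u y * f (x - y))"
proof -
  note [measurable] = test_functionsD(3)[OF f] borel_measurable_integrable[OF u]
  obtain M where M: "0 < M" "\<And>x. \<bar>f x\<bar> \<le> M"
    using compact_support_bounded test_functionsD(2,4)[OF f] by metis
  show ?thesis
  proof (rule Bochner_Integration.integrable_bound)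
    show "integrable lborel (\<lambda>y. M * u y)" using u by simp
    show "AE y in lborel. norm (u y * f (x - y)) \<le> norm (M * u y)"
      using M by (auto simp: abs_mult mult.commute[of M] intro!: AE_I2 mult_left_mono)
  qed measurable
qed

lemma convolution_has_derivative:
  fixes u f :: "'a::euclidean_space \<Rightarrow> real"
  assumes u: "integrable lborel u" and f: "f \<in> test_functions"
  shows "(convolution u f has_derivative (\<lambda>v. convolution u (\<lambda>z. frechet_derivative f (at z) v) x)) (at x)"
proof -
  define D where "D x = frechet_derivative f (at x)" for x
  have D: "(f has_derivative D x) (at x)" for x
    using Ck_on_has_derivative[OF test_functionsD(1)[OF f, of "Suc 0"]] by (simp add: D_def)
  have lin: "linear (D x)" for x using D has_derivative_bounded_linear bounded_linear.linear by blast
  have t: "(\<lambda>x. D x b) \<in> test_functions" for b unfolding D_def by (rule frechet_derivative_test_function[OF f])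
  have int: "integrable lborel (\<lambda>y. u y * D (x - y) v)" for x v
    by (rule convolution_integrable[OF u t])
  define I where "I = (\<integral>y. \<bar>u y\<bar> \<partial>lborel)"
  have I: "0 \<le> I" by (simp add: I_def)
  show ?thesis unfolding has_derivative_at_alt D_def[symmetric]
  proof (intro conjI allI impI)
    show "bounded_linear (\<lambda>v. convolution u (\<lambda>z. D z v) x)"
      unfolding convolution_def
      by (subst linear_conv_bounded_linear[symmetric], rule linearI)
        (simp_all add: linear_add[OF lin] linear_cmul[OF lin] distrib_left int mult.left_commute)
    fix e :: real assume e: "0 < e"
    \<comment> \<open>The summand 1 keeps the quotient meaningful when \<open>u\<close> vanishes
      almost everywhere.\<close>
    define e' where "e' = e / (I + 1)"
    have e': "0 < e'" "e' * I \<le> e" using e I by (auto simp: e'_def field_simps)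
    obtain d where d: "0 < d" "\<And>a w. norm w < d \<Longrightarrow> \<bar>f (a + w) - f a - D a w\<bar> \<le> e' * norm w"
      using test_function_uniform_derivative[OF f e'(1)] unfolding D_def by auto
    have "norm (convolution u f y - convolution u f x - convolution u (\<lambda>z. D z (y - x)) x) \<le> e * norm (y - x)"
      if y: "norm (y - x) < d" for y
    proof -
      have "convolution u f y - convolution u f x - convolution u (\<lambda>z. D z (y - x)) x
         = (\<integral>z. u z * (f (y - z) - f (x - z) - D (x - z) (y - x)) \<partial>lborel)"
        unfolding convolution_def
        by (simp add: right_diff_distrib convolution_integrable[OF u f] int)
      also have "norm \<dots> \<le> (\<integral>z. \<bar>u z\<bar> * (e' * norm (y - x)) \<partial>lborel)"
      proof (rule order_trans[OF integral_norm_bound], rule integral_mono')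
        show "integrable lborel (\<lambda>z. \<bar>u z\<bar> * (e' * norm (y - x)))" using u by simp
        fix z
        have "\<bar>f (y - z) - f (x - z) - D (x - z) (y - x)\<bar> \<le> e' * norm (y - x)"
          using d(2)[OF y, of "x - z"] by (simp add: algebra_simps)
        then show "norm (u z * (f (y - z) - f (x - z) - D (x - z) (y - x))) \<le> \<bar>u z\<bar> * (e' * norm (y - x))"
          by (simp add: abs_mult mult_left_mono)
      qed (use e' in auto)
      also have "\<dots> = (e' * I) * norm (y - x)" by (simp add: I_def)
      also have "\<dots> \<le> e * norm (y - x)" using e' by (intro mult_right_mono) auto
      finally show ?thesis .
    qed
    then show "\<exists>d>0. \<forall>y. norm (y - x) < d \<longrightarrow>
        norm (convolution u f y - convolution u f x - convolution u (\<lambda>z. D z (y - x)) x) \<le> e * norm (y - x)"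
      using d(1) by blast
  qed
qed

lemma Ck_on_convolution:
  fixes u f :: "'a::euclidean_space \<Rightarrow> real"
  assumes u: "integrable lborel u" and f: "f \<in> test_functions"
  shows "Ck_on k UNIV (convolution u f)"
  using f
proof (induction k arbitrary: f)
  case 0
  show ?case
    using convolution_has_derivative[OF u 0]
    by (auto intro!: continuous_at_imp_continuous_on has_derivative_continuous)
next
  case (Suc k)
  show ?case
    by (rule Ck_on_SucI[OF convolution_has_derivative[OF u Suc.prems]])
       (intro Suc.IH frechet_derivative_test_function Suc.prems)
qed

lemma mollifier_exists:
  assumes "0 < d"
  obtains h :: "'a::euclidean_space \<Rightarrow> real" where "h \<in> test_functions" "\<And>x. 0 \<le> h x"
    "\<And>x. d \<le> norm x \<Longrightarrow> h x = 0" "integrable lborel h" "(\<integral>x. h x \<partial>lborel) = 1"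
proof -
  define h0 :: "'a \<Rightarrow> real" where "h0 x = flat 0 (d\<^sup>2 + (- 1) * (x \<bullet> x))" for x
  have C: "Ck_on k UNIV h0" for k
    unfolding h0_def by (intro Ck_on_flat Ck_on_norm_square)
  have supp: "h0 x = 0" if "d \<le> norm x" for x
  proof -
    have "d\<^sup>2 \<le> (norm x)\<^sup>2" using that assms by (intro power_mono) auto
    then show ?thesis by (simp add: h0_def flat_def power2_norm_eq_inner)
  qed
  have nonneg: "0 \<le> h0 x" for x by (simp add: h0_def flat_def)
  have t: "h0 \<in> test_functions" by (rule test_functionsI[OF C, of d]) (simp add: supp)
  have cont: "continuous_on UNIV h0" using C[of 0] by simp
  have int: "integrable lborel h0"
  proof -
    have "integrable lborel (\<lambda>x. indicator (cball 0 d) x *\<^sub>R h0 x)"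
      using cont by (intro borel_integrable_compact) (auto intro: continuous_on_subset)
    moreover have "(\<lambda>x. indicator (cball 0 d) x *\<^sub>R h0 x) = h0"
      using supp by (auto simp: indicator_def fun_eq_iff)
    ultimately show ?thesis by simp
  qed
  define I where "I = (\<integral>x. h0 x \<partial>lborel)"
  \<comment> \<open>A zero integral would make the continuous function \<open>h0\<close> vanish
    everywhere, although it is positive at the centre.\<close>
  have "I \<noteq> 0"
  proof
    assume "I = 0"
    then have "AE x in lborel. h0 x = 0"
      unfolding I_def using int nonneg by (subst (asm) integral_nonneg_eq_0_iff_AE) auto
    then have "AE x in lebesgue. x \<in> {x. h0 x = 0}" by (intro AE_completion) simp
    moreover have "closed {x. h0 x = 0}" using cont by (intro closed_Collect_eq continuous_intros)
    ultimately have "h0 0 = 0" using mem_closed_if_AE_lebesgue by blast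
    then show False using assms by (simp add: h0_def flat_def)
  qed
  moreover have "0 \<le> I" unfolding I_def by (simp add: nonneg)
  ultimately have I: "0 < I" by simp
  show ?thesis
  proof (rule that[of "\<lambda>x. (1 / I) * h0 x"])
    show "(\<lambda>x. (1 / I) * h0 x) \<in> test_functions"
      by (rule test_functionsI[of _ d]) (intro Ck_on_cmult C, simp add: supp)
    show "(\<integral>x. 1 / I * h0 x \<partial>lborel) = 1" using I int by (simp add: I_def)
  qed (use I nonneg supp int in auto)
qed

lemma convolution_commute:
  fixes u h :: "'a::euclidean_space \<Rightarrow> real"
  assumes [measurable]: "u \<in> borel_measurable borel" "h \<in> borel_measurable borel"
  shows "convolution u h x = (\<integral>z. u (x - z) * h z \<partial>lborel)"
proof -
  have "lborel = distr lborel borel (\<lambda>z. x + (-1) *\<^sub>R z)"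
    by (subst lborel_affine[of "-1" x]) (auto simp: density_1)
  then have "convolution u h x = (\<integral>y. u y * h (x - y) \<partial>distr lborel borel (\<lambda>z. x + (-1) *\<^sub>R z))"
    by (simp add: convolution_def)
  also have "\<dots> = (\<integral>z. u (x - z) * h z \<partial>lborel)" by (subst integral_distr) auto
  finally show ?thesis .
qed

text \<open>Convolution with a probability density averages translates of \<open>u\<close>, and the
  seminorm is convex and translation invariant.\<close>

lemma gagliardo_convolution_le:
  fixes u h :: "real ^ 'n \<Rightarrow> real"
  assumes [measurable]: "u \<in> borel_measurable borel" and int: "\<And>x. integrable lborel (\<lambda>z. u (x - z) * h z)"
    and h: "integrable lborel h" "\<And>x. 0 \<le> h x" "(\<integral>x. h x \<partial>lborel) = 1"
  shows "gagliardo \<alpha> (convolution u h) \<le> gagliardo \<alpha> u"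
proof -
  have [measurable]: "h \<in> borel_measurable borel" using h(1) by auto
  have le: "ennreal (\<bar>convolution u h x - convolution u h y\<bar> * kern \<alpha> (x - y))
     \<le> (\<integral>\<^sup>+z. ennreal (h z) * ennreal (\<bar>u (x - z) - u (y - z)\<bar> * kern \<alpha> (x - y)))" for x y
  proof -
    have "convolution u h x - convolution u h y = (\<integral>z. u (x - z) * h z - u (y - z) * h z \<partial>lborel)"
      by (simp add: convolution_commute int)
    then have "ennreal \<bar>convolution u h x - convolution u h y\<bar> \<le> (\<integral>\<^sup>+z. ennreal (norm (u (x - z) * h z - u (y - z) * h z)))"
      using integral_norm_bound_ennreal[of lborel "\<lambda>z. u (x - z) * h z - u (y - z) * h z"] int by simp
    also have "\<dots> = (\<integral>\<^sup>+z. ennreal (h z) * ennreal \<bar>u (x - z) - u (y - z)\<bar>)"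
    proof (intro nn_integral_cong)
      fix z
      have "norm (u (x - z) * h z - u (y - z) * h z) = h z * \<bar>u (x - z) - u (y - z)\<bar>"
        unfolding left_diff_distrib[symmetric] by (simp add: abs_mult h)
      then show "ennreal (norm (u (x - z) * h z - u (y - z) * h z)) = ennreal (h z) * ennreal \<bar>u (x - z) - u (y - z)\<bar>"
        by (simp add: ennreal_mult h)
    qed
    finally have "ennreal \<bar>convolution u h x - convolution u h y\<bar> * ennreal (kern \<alpha> (x - y))
      \<le> (\<integral>\<^sup>+z. ennreal (h z) * ennreal \<bar>u (x - z) - u (y - z)\<bar>) * ennreal (kern \<alpha> (x - y))"
      by (rule mult_right_mono) simp
    also have "\<dots> = (\<integral>\<^sup>+z. ennreal (h z) * ennreal \<bar>u (x - z) - u (y - z)\<bar> * ennreal (kern \<alpha> (x - y)))"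
      by (rule nn_integral_multc[symmetric]) measurable
    finally show ?thesis by (simp add: ennreal_mult mult.assoc)
  qed
  define H where "H x y = ennreal (\<bar>u x - u y\<bar> * kern \<alpha> (x - y))" for x y
  have [measurable]: "case_prod H \<in> borel_measurable (borel \<Otimes>\<^sub>M borel)" unfolding H_def by measurable
  have H: "ennreal (\<bar>u (x - z) - u (y - z)\<bar> * kern \<alpha> (x - y)) = H (- z + x) (- z + y)" for x y z
    by (simp add: H_def)
  have tr: "(\<integral>\<^sup>+x. \<integral>\<^sup>+y. H (- z + x) (- z + y)) = gagliardo \<alpha> u" for z
  proof -
    have "(\<integral>\<^sup>+y. H (- z + x) (- z + y)) = (\<integral>\<^sup>+y. H (- z + x) y)" for x
      by (rule nn_integral_lborel_translate) measurable
    then have "(\<integral>\<^sup>+x. \<integral>\<^sup>+y. H (- z + x) (- z + y)) = (\<integral>\<^sup>+x. \<integral>\<^sup>+y. H (- z + x) y)" by simp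
    also have "\<dots> = (\<integral>\<^sup>+x. \<integral>\<^sup>+y. H x y)"
      by (rule nn_integral_lborel_translate[where g="\<lambda>x. \<integral>\<^sup>+y. H x y"]) measurable
    finally show ?thesis by (simp add: gagliardo_def H_def)
  qed
  have "gagliardo \<alpha> (convolution u h) \<le> (\<integral>\<^sup>+x. \<integral>\<^sup>+y. \<integral>\<^sup>+z. ennreal (h z) * H (- z + x) (- z + y))"
    unfolding gagliardo_def H[symmetric] by (intro nn_integral_mono le)
  also have "\<dots> = (\<integral>\<^sup>+x. \<integral>\<^sup>+z. \<integral>\<^sup>+y. ennreal (h z) * H (- z + x) (- z + y))"
    by (intro nn_integral_cong lborel_pair.Fubini') measurable
  also have "\<dots> = (\<integral>\<^sup>+z. \<integral>\<^sup>+x. \<integral>\<^sup>+y. ennreal (h z) * H (- z + x) (- z + y))"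
    by (rule lborel_pair.Fubini') measurable
  also have "\<dots> = (\<integral>\<^sup>+z. ennreal (h z) * gagliardo \<alpha> u)"
  proof (rule nn_integral_cong)
    fix z
    have "(\<integral>\<^sup>+y. ennreal (h z) * H (- z + x) (- z + y)) = ennreal (h z) * (\<integral>\<^sup>+y. H (- z + x) (- z + y))" for x
      by (rule nn_integral_cmult) measurable
    then have "(\<integral>\<^sup>+x. \<integral>\<^sup>+y. ennreal (h z) * H (- z + x) (- z + y))
      = (\<integral>\<^sup>+x. ennreal (h z) * (\<integral>\<^sup>+y. H (- z + x) (- z + y)))" by simp
    also have "\<dots> = ennreal (h z) * (\<integral>\<^sup>+x. \<integral>\<^sup>+y. H (- z + x) (- z + y))"
      by (rule nn_integral_cmult) measurable
    finally show "(\<integral>\<^sup>+x. \<integral>\<^sup>+y. ennreal (h z) * H (- z + x) (- z + y)) = ennreal (h z) * gagliardo \<alpha> u"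
      by (simp only: tr)
  qed
  also have "\<dots> = (\<integral>\<^sup>+z. ennreal (h z)) * gagliardo \<alpha> u" by (rule nn_integral_multc) measurable
  also have "(\<integral>\<^sup>+z. ennreal (h z)) = 1"
    using h by (subst nn_integral_eq_integral) auto
  finally show ?thesis by simp
qed

text \<open>The limit step of every approximation below; it includes the case that \<open>b\<close>
  is infinite or zero.\<close>

lemma ennreal_le_of_factor_gt_1:
  fixes a b :: ennreal
  assumes "\<And>c. 1 < c \<Longrightarrow> a \<le> ennreal c * b"
  shows "a \<le> b"
proof (cases b)
  case (real r)
  have "a \<le> ennreal 2 * ennreal r" using assms[of 2] real by simp
  then have "a < top" using real by (auto simp: ennreal_mult[symmetric] top_unique intro: le_less_trans simp del: ennreal_numeral)
  then obtain s where s: "a = ennreal s" "0 \<le> s" by (cases a) auto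
  have "s \<le> r"
  proof (rule field_le_epsilon)
    fix e :: real assume e: "0 < e"
    have "a \<le> ennreal (1 + e / (r + 1)) * b" using e real by (intro assms) (simp add: field_simps)
    then have "s \<le> (1 + e / (r + 1)) * r" using s real e by (simp add: ennreal_mult[symmetric] del: ennreal_plus)
    also have "\<dots> = r + e * (r / (r + 1))" by (simp add: field_simps)
    also have "\<dots> \<le> r + e * 1" using e real by (intro add_left_mono mult_left_mono) auto
    finally show "s \<le> r + e" by simp
  qed
  then show ?thesis using s real by (simp add: ennreal_leI)
qed auto

text \<open>The last two conclusions say that the mollified value at \<open>x\<close> lies between
  the bounds of \<open>u\<close> on the ball of radius \<open>d\<close> around \<open>x\<close>.
  They replace any later reference to the convolution.\<close>

lemma mollification_exists:
  fixes u :: "real ^ 'n \<Rightarrow> real"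
  assumes [measurable]: "u \<in> borel_measurable borel" and M: "\<And>x. 0 \<le> u x" "\<And>x. u x \<le> M"
    and supp: "\<And>x. R < norm x \<Longrightarrow> u x = 0" and d: "0 < d"
  obtains f where "f \<in> test_functions" "gagliardo \<alpha> f \<le> gagliardo \<alpha> u" "\<And>x. R + d < norm x \<Longrightarrow> f x = 0"
    "\<And>x c. (\<And>z. norm z < d \<Longrightarrow> c \<le> u (x - z)) \<Longrightarrow> c \<le> f x"
    "\<And>x c. (\<And>z. norm z < d \<Longrightarrow> u (x - z) \<le> c) \<Longrightarrow> f x \<le> c"
proof -
  obtain h :: "real ^ 'n \<Rightarrow> real" where h: "h \<in> test_functions" "\<And>x. 0 \<le> h x"
    "\<And>x. d \<le> norm x \<Longrightarrow> h x = 0" "integrable lborel h" "(\<integral>x. h x \<partial>lborel) = 1"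
    using mollifier_exists[OF d] by metis
  have [measurable]: "h \<in> borel_measurable borel" using h(4) by auto
  have iu: "integrable lborel u"
  proof (rule Bochner_Integration.integrable_bound)
    show "integrable lborel (\<lambda>x. M * indicator (cball (0 :: real ^ 'n) R) x :: real)"
      using emeasure_lborel_cball_finite[of "0 :: real ^ 'n" R]
      by (intro integrable_mult_right integrable_real_indicator) auto
    have "norm (u x) \<le> norm (M * indicator (cball 0 R) x)" for x
      using M[of x] supp[of x] by (cases "R < norm x") auto
    then show "AE x in lborel. norm (u x) \<le> norm (M * indicator (cball 0 R) x)" by simp
  qed measurable
  have int: "integrable lborel (\<lambda>z. u (x - z) * h z)" for x
  proof (rule Bochner_Integration.integrable_bound)
    show "integrable lborel (\<lambda>z. M * h z)" using h(4) by simp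
    have "norm (u (x - z) * h z) \<le> norm (M * h z)" for z
      using M[of "x - z"] h(2)[of z] by (auto simp: abs_mult intro!: mult_right_mono)
    then show "AE z in lborel. norm (u (x - z) * h z) \<le> norm (M * h z)" by simp
  qed measurable
  define f where "f = convolution u h"
  have fx: "f x = (\<integral>z. u (x - z) * h z \<partial>lborel)" for x by (simp add: f_def convolution_commute)
  have ch: "integrable lborel (\<lambda>z. c * h z)" "(\<integral>z. c * h z \<partial>lborel) = c" for c using h(4,5) by auto
  have lower: "c \<le> f x" if c: "\<And>z. norm z < d \<Longrightarrow> c \<le> u (x - z)" for x c
  proof -
    have "c * h z \<le> u (x - z) * h z" for z
      using mult_right_mono[OF c h(2)] h(3)[of z] by (cases "norm z < d") auto
    from integral_mono[OF ch(1) int this] show ?thesis by (simp only: ch(2) fx)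
  qed
  have upper: "f x \<le> c" if c: "\<And>z. norm z < d \<Longrightarrow> u (x - z) \<le> c" for x c
  proof -
    have "u (x - z) * h z \<le> c * h z" for z
      using mult_right_mono[OF c h(2)] h(3)[of z] by (cases "norm z < d") auto
    from integral_mono[OF int ch(1) this] show ?thesis by (simp only: ch(2) fx)
  qed
  have f0: "f x = 0" if x: "R + d < norm x" for x
  proof -
    have "u (x - z) = 0" if "norm z < d" for z
      using x that norm_triangle_ineq2[of x z] by (intro supp) linarith
    then show ?thesis using lower[of 0 x] upper[of x 0] by (intro antisym) auto
  qed
  have "f \<in> test_functions"
    by (rule test_functionsI[of _ "R + d"]) (use Ck_on_convolution[OF iu h(1)] f0 in \<open>auto simp: f_def[symmetric]\<close>)
  moreover have "gagliardo \<alpha> f \<le> gagliardo \<alpha> u"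
    unfolding f_def by (intro gagliardo_convolution_le int h) measurable
  ultimately show ?thesis using that[of f] f0 lower upper by blast
qed

text \<open>Smoothness is traded for room: if \<open>u\<close> is almost 1 on a uniform
  neighbourhood of \<open>K\<close>, its mollification is at least \<open>1 / c\<close> on
  \<open>K\<close>, and multiplication by \<open>c\<close> makes it admissible at the cost of a
  factor \<open>c\<close> close to 1.\<close>

lemma sobolev_cap_le_gagliardo:
  fixes u :: "real ^ 'n \<Rightarrow> real"
  assumes u: "u \<in> borel_measurable borel" and M: "\<And>x. 0 \<le> u x" "\<And>x. u x \<le> M"
    and supp: "\<And>x. R < norm x \<Longrightarrow> u x = 0"
    and K: "\<And>e. 0 < e \<Longrightarrow> \<exists>d>0. \<forall>x\<in>K. \<forall>z. norm z < d \<longrightarrow> 1 - e \<le> u (x - z)"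
  shows "sobolev_cap \<alpha> K \<le> gagliardo \<alpha> u"
proof (rule ennreal_le_of_factor_gt_1)
  fix c :: real assume c: "1 < c"
  obtain d where d: "0 < d" "\<And>x z. x \<in> K \<Longrightarrow> norm z < d \<Longrightarrow> 1 / c \<le> u (x - z)"
    using K[of "1 - 1 / c"] c by auto
  obtain f where f: "f \<in> test_functions" "gagliardo \<alpha> f \<le> gagliardo \<alpha> u" "\<And>x. R + d < norm x \<Longrightarrow> f x = 0"
    "\<And>x c. (\<And>z. norm z < d \<Longrightarrow> c \<le> u (x - z)) \<Longrightarrow> c \<le> f x"
    by (rule mollification_exists[OF u M supp d(1), where \<alpha>=\<alpha>]) auto
  have [measurable]: "f \<in> borel_measurable borel" by (rule test_functionsD(3)[OF f(1)])
  have "indicator K x \<le> c * f x" for x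
  proof (cases "x \<in> K")
    case True
    then have "1 / c \<le> f x" by (intro f(4) d(2))
    then show ?thesis using True c by (simp add: field_simps)
  next
    case False
    have "0 \<le> f x" by (intro f(4) M)
    then show ?thesis using False c by simp
  qed
  moreover have "(\<lambda>x. c * f x) \<in> test_functions"
    by (rule test_functionsI[of _ "R + d"]) (intro Ck_on_cmult test_functionsD(1)[OF f(1)], simp add: f(3))
  ultimately have "sobolev_cap \<alpha> K \<le> sobolev_norm \<alpha> (\<lambda>x. c * f x)"
    unfolding sobolev_cap_def by (intro INF_lower) auto
  also have "\<dots> = ennreal c * gagliardo \<alpha> f"
    using c by (simp add: sobolev_norm_eq_gagliardo gagliardo_cmult)
  also have "\<dots> \<le> ennreal c * gagliardo \<alpha> u" by (intro mult_left_mono f) auto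
  finally show "sobolev_cap \<alpha> K \<le> ennreal c * gagliardo \<alpha> u" .
qed

section \<open>Domains with smooth boundary\<close>

text \<open>Pulling the kernel back along \<open>T\<close> costs the power of \<open>A\<close>, and
  each of the two integrations costs \<open>L ^ n\<close>. For a perturbation of the identity all
  these factors tend to 1.\<close>

lemma perimeter_vimage_le:
  fixes T S :: "real ^ 'n \<Rightarrow> real ^ 'n"
  assumes alpha: "0 < \<alpha>" and T: "\<And>x y. dist (T x) (T y) \<le> A * dist x y" "0 < A"
    and S: "\<And>x y. dist (S x) (S y) \<le> L * dist x y" "0 < L" "\<And>x. S (T x) = x"
    and [measurable]: "T \<in> borel_measurable borel" "E \<in> sets borel"
  shows "perimeter \<alpha> (T -` E) \<le> ennreal (A powr (real CARD('n) + \<alpha>) * (L ^ CARD('n))\<^sup>2) * perimeter \<alpha> E"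
proof -
  let ?a = "A powr (real CARD('n) + \<alpha>)" and ?l = "L ^ CARD('n)"
  define F where "F x y = ennreal (indicator E x * indicator (- E) y * kern \<alpha> (x - y))" for x y
  have [measurable]: "case_prod F \<in> borel_measurable (borel \<Otimes>\<^sub>M borel)" unfolding F_def by measurable
  have kern: "kern \<alpha> (x - y) \<le> ?a * kern \<alpha> (T x - T y)" for x y
  proof (cases "x = y")
    case False
    then have "T x \<noteq> T y" using S(3) by metis
    have "norm (T x - T y) powr (real CARD('n) + \<alpha>) \<le> (A * norm (x - y)) powr (real CARD('n) + \<alpha>)"
      using T(1)[of x y] alpha by (intro powr_mono2) (auto simp: dist_norm)
    then have "norm (T x - T y) powr (real CARD('n) + \<alpha>) \<le> ?a * norm (x - y) powr (real CARD('n) + \<alpha>)"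
      using T(2) by (simp add: powr_mult)
    then show ?thesis using False \<open>T x \<noteq> T y\<close> by (simp add: kern_def field_simps)
  qed (simp add: kern_def)
  have [measurable]: "T -` E \<in> sets borel" using measurable_sets[of T borel borel E] by simp
  have F: "ennreal (indicator (T -` E) x * indicator (- (T -` E)) y * kern \<alpha> (x - y)) \<le> ennreal ?a * F (T x) (T y)" for x y
    unfolding F_def using kern[of x y] by (subst ennreal_mult[symmetric]) (auto simp: indicator_def intro: ennreal_leI)
  have "perimeter \<alpha> (T -` E) \<le> (\<integral>\<^sup>+x. \<integral>\<^sup>+y. ennreal ?a * F (T x) (T y))"
    by (subst perimeter_eq_kern) (measurable, intro nn_integral_mono F)
  also have "\<dots> = (\<integral>\<^sup>+x. ennreal ?a * (\<integral>\<^sup>+y. F (T x) (T y)))"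
    by (intro nn_integral_cong nn_integral_cmult) measurable
  also have "\<dots> = ennreal ?a * (\<integral>\<^sup>+x. \<integral>\<^sup>+y. F (T x) (T y))"
    by (rule nn_integral_cmult) measurable
  also have "(\<integral>\<^sup>+x. \<integral>\<^sup>+y. F (T x) (T y)) \<le> (\<integral>\<^sup>+x. ennreal ?l * (\<integral>\<^sup>+y. F (T x) y))"
  proof (rule nn_integral_mono)
    fix x
    show "(\<integral>\<^sup>+y. F (T x) (T y)) \<le> ennreal ?l * (\<integral>\<^sup>+y. F (T x) y)"
      using nn_integral_comp_le[OF S, of "F (T x)"] by simp
  qed
  also have "\<dots> = ennreal ?l * (\<integral>\<^sup>+x. \<integral>\<^sup>+y. F (T x) y)"
    by (rule nn_integral_cmult) measurable
  also have "(\<integral>\<^sup>+x. \<integral>\<^sup>+y. F (T x) y) \<le> ennreal ?l * (\<integral>\<^sup>+x. \<integral>\<^sup>+y. F x y)"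
    using nn_integral_comp_le[OF S, of "\<lambda>x. \<integral>\<^sup>+y. F x y"] by simp
  also have "(\<integral>\<^sup>+x. \<integral>\<^sup>+y. F x y) = perimeter \<alpha> E"
    unfolding F_def by (subst perimeter_eq_kern) auto
  finally show ?thesis using S(2)
    by (simp add: ennreal_mult power2_eq_square mult_left_mono mult.assoc)
qed

text \<open>A compact set has positive distance from the closed complement of \<open>E\<close>, so
  the indicator of \<open>E\<close> equals 1 on a uniform neighbourhood of \<open>K\<close>.\<close>

lemma sobolev_cap_le_perimeter:
  fixes K E :: "(real ^ 'n) set"
  assumes "compact K" "open E" "bounded E" "K \<subseteq> E"
  shows "sobolev_cap \<alpha> K \<le> 2 * perimeter \<alpha> E"
proof -
  have [measurable]: "E \<in> sets borel" using assms by auto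
  obtain R where R: "\<And>x. x \<in> E \<Longrightarrow> norm x \<le> R" using assms(3) unfolding bounded_iff by auto
  obtain d where d: "0 < d" "\<And>x y. x \<in> K \<Longrightarrow> y \<in> - E \<Longrightarrow> d \<le> dist x y"
  proof -
    have "\<exists>d>0. \<forall>x\<in>K. \<forall>y\<in>- E. d \<le> dist x y"
      using assms by (intro separate_compact_closed) auto
    then show ?thesis using that by blast
  qed
  have "sobolev_cap \<alpha> K \<le> gagliardo \<alpha> (indicator E)"
  proof (rule sobolev_cap_le_gagliardo[of _ 1 R])
    fix e :: real assume "0 < e"
    have "1 - e \<le> indicator E (x - z)" if "x \<in> K" "norm z < d" for x z
      using d(2)[of x "x - z"] that \<open>0 < e\<close> by (auto simp: indicator_def dist_norm)
    then show "\<exists>d>0. \<forall>x\<in>K. \<forall>z. norm z < d \<longrightarrow> 1 - e \<le> indicator E (x - z)" using d(1) by blast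
  next
    show "indicator E x = (0 :: real)" if "R < norm x" for x using R[of x] that by (auto simp: indicator_def)
  qed (auto simp: indicator_def)
  then show ?thesis by (simp add: gagliardo_indicator)
qed

definition defining_function :: "'a::euclidean_space set \<Rightarrow> 'a set \<Rightarrow> ('a \<Rightarrow> real) \<Rightarrow> bool" where
  "defining_function S U \<phi> \<longleftrightarrow> open U \<and> smooth_on U \<phi> \<and>
     (\<forall>x\<in>U. frechet_derivative \<phi> (at x) \<noteq> (\<lambda>v. 0)) \<and>
     S \<inter> U = {x\<in>U. \<phi> x < 0} \<and> frontier S \<inter> U = {x\<in>U. \<phi> x = 0}"

lemma smooth_boundary_iff:
  "smooth_boundary S \<longleftrightarrow> (\<forall>p\<in>frontier S. \<exists>U \<phi>. p \<in> U \<and> defining_function S U \<phi>)"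
  unfolding smooth_boundary_def defining_function_def
  by (intro ball_cong arg_cong[where f=Ex] ext refl) (simp only: conj_ac)

lemma defining_function_has_derivative:
  assumes "defining_function S U \<phi>" "x \<in> U"
  shows "(\<phi> has_derivative frechet_derivative \<phi> (at x)) (at x)"
proof -
  have "Ck_on (Suc 0) U \<phi>" using assms by (simp add: defining_function_def smooth_on_def del: Ck_on.simps)
  then show ?thesis using assms(2) by (rule Ck_on_has_derivative)
qed

lemma defining_function_linear:
  assumes "defining_function S U \<phi>" "x \<in> U"
  shows "linear (frechet_derivative \<phi> (at x))"
  using defining_function_has_derivative[OF assms] has_derivative_bounded_linear bounded_linear.linear by blast

lemma defining_function_continuous_derivative:
  assumes "defining_function S U \<phi>"
  shows "continuous_on U (\<lambda>x. frechet_derivative \<phi> (at x) v)"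
proof -
  have "Ck_on (Suc 0) U \<phi>" using assms by (simp add: defining_function_def smooth_on_def del: Ck_on.simps)
  then show ?thesis by simp
qed

lemma has_real_derivative_along:
  fixes f :: "'a::real_normed_vector \<Rightarrow> real"
  assumes "(f has_derivative D) (at (q + t *\<^sub>R v))"
  shows "((\<lambda>t. f (q + t *\<^sub>R v)) has_real_derivative D v) (at t)"
proof -
  have lin: "linear D" using assms has_derivative_bounded_linear bounded_linear.linear by blast
  have "((\<lambda>t. f (q + t *\<^sub>R v)) has_derivative (\<lambda>h. D (h *\<^sub>R v))) (at t)"
    by (rule has_derivative_compose[where f="\<lambda>t. q + t *\<^sub>R v", OF _ assms]) (auto intro!: derivative_eq_intros)
  moreover have "(\<lambda>h. D (h *\<^sub>R v)) = (*) (D v)" by (simp add: fun_eq_iff linear_cmul[OF lin])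
  ultimately show ?thesis by (simp add: has_field_derivative_def)
qed

text \<open>Being outward does not depend on the defining function. This makes directions obtained
  from different charts compatible, so that they can be added.\<close>

lemma defining_function_outward:
  assumes \<phi>: "defining_function S U \<phi>" and \<psi>: "defining_function S V \<psi>"
    and q: "q \<in> frontier S" "q \<in> U" "q \<in> V" and v: "0 < frechet_derivative \<phi> (at q) v"
  shows "0 < frechet_derivative \<psi> (at q) v"
proof -
  let ?F = "frechet_derivative \<phi> (at q)" and ?G = "frechet_derivative \<psi> (at q)"
  \<comment> \<open>If the derivatives had opposite signs, a short step along \<open>v\<close> would
    lead into \<open>S\<close> according to \<open>\<psi>\<close> and out of \<open>S\<close>
    according to \<open>\<phi>\<close>.\<close>
  have weak: "0 \<le> ?G v" if v: "0 < ?F v" for v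
  proof (rule ccontr)
    assume "\<not> 0 \<le> ?G v"
    have 0: "\<phi> q = 0" "\<psi> q = 0" using \<phi> \<psi> q by (auto simp: defining_function_def)
    have d: "((\<lambda>t. \<phi> (q + t *\<^sub>R v)) has_real_derivative ?F v) (at 0)"
      "((\<lambda>t. \<psi> (q + t *\<^sub>R v)) has_real_derivative ?G v) (at 0)"
      using defining_function_has_derivative[OF \<phi> q(2)] defining_function_has_derivative[OF \<psi> q(3)]
      by (auto intro!: has_real_derivative_along)
    obtain d1 where d1: "0 < d1" "\<And>h. 0 < h \<Longrightarrow> h < d1 \<Longrightarrow> 0 < \<phi> (q + h *\<^sub>R v)"
      using DERIV_pos_inc_right[OF d(1) v] 0 by auto
    obtain d2 where d2: "0 < d2" "\<And>h. 0 < h \<Longrightarrow> h < d2 \<Longrightarrow> \<psi> (q + h *\<^sub>R v) < 0"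
      using DERIV_neg_dec_right[OF d(2)] 0 \<open>\<not> 0 \<le> ?G v\<close> by auto
    have "open (U \<inter> V)" using \<phi> \<psi> by (auto simp: defining_function_def)
    then obtain r where r: "0 < r" "ball q r \<subseteq> U \<inter> V" using q openE[of "U \<inter> V" q] by auto
    define h where "h = min (min (d1 / 2) (d2 / 2)) (r / (2 * (norm v + 1)))"
    have h: "0 < h" "h < d1" "h < d2" using d1 d2 r by (auto simp: h_def min_less_iff_disj add_nonneg_pos)
    have "h * norm v \<le> r / (2 * (norm v + 1)) * norm v" by (intro mult_right_mono) (auto simp: h_def)
    also have "\<dots> = r / 2 * (norm v / (norm v + 1))" by simp
    also have "\<dots> \<le> r / 2 * 1" using r by (intro mult_left_mono) (auto simp: divide_le_eq_1 add_nonneg_pos)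
    finally have "q + h *\<^sub>R v \<in> U \<inter> V" using r h by (intro subsetD[OF r(2)]) (auto simp: dist_norm)
    then have "q + h *\<^sub>R v \<in> S" "\<phi> (q + h *\<^sub>R v) < 0"
      using d2(2)[OF h(1,3)] \<phi> \<psi> by (auto simp: defining_function_def)
    then show False using d1(2)[OF h(1,2)] by simp
  qed
  have linF: "linear ?F" "linear ?G" using defining_function_linear \<phi> \<psi> q by blast+
  have "?G \<noteq> (\<lambda>v. 0)" using \<psi> q by (auto simp: defining_function_def)
  then obtain w0 where "?G w0 \<noteq> 0" by auto
  then obtain w where w: "?G w < 0"
    using linear_neg[OF linF(2), of w0] by (cases "?G w0 < 0") (auto intro: that[of w0] that[of "- w0"])
  \<comment> \<open>Strictness by perturbation: \<open>s\<close> is so small that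
    \<open>v + s *\<^sub>R w\<close> is still outward for \<open>\<phi>\<close>. The weak inequality
    for this vector and \<open>?G w < 0\<close> leave room for \<open>?G v > 0\<close>.\<close>
  define s where "s = ?F v / (2 * (\<bar>?F w\<bar> + 1))"
  have s: "0 < s" using v by (simp add: s_def add_nonneg_pos)
  have "s * \<bar>?F w\<bar> < ?F v"
  proof -
    have "s * \<bar>?F w\<bar> = ?F v * (\<bar>?F w\<bar> / (2 * (\<bar>?F w\<bar> + 1)))" by (simp add: s_def)
    also have "\<dots> < ?F v * 1" using v by (intro mult_strict_left_mono) (auto simp: divide_less_eq_1 add_nonneg_pos)
    finally show ?thesis by simp
  qed
  moreover have "s * (- \<bar>?F w\<bar>) \<le> s * ?F w" using s by (intro mult_left_mono) auto
  ultimately have "0 < ?F v + s * ?F w" by simp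
  then have "0 < ?F (v + s *\<^sub>R w)" by (simp add: linear_add[OF linF(1)] linear_cmul[OF linF(1)])
  from weak[OF this] have "0 \<le> ?G v + s * ?G w" by (simp add: linear_add[OF linF(2)] linear_cmul[OF linF(2)])
  moreover have "s * ?G w < 0" using s w by (simp add: mult_pos_neg)
  ultimately show ?thesis by linarith
qed

text \<open>Near each boundary point a constant direction is outward. Finitely many of them are
  added with nonnegative weights; outward directions form a convex cone, so positivity survives and
  the weights may stay unnormalised.\<close>

lemma outward_field_exists:
  fixes S :: "'a::euclidean_space set"
  assumes bdd: "bounded S" and S: "smooth_boundary S"
  obtains X :: "'a \<Rightarrow> 'a" and L M where "0 \<le> L" "0 \<le> M" "\<And>x y. dist (X x) (X y) \<le> L * dist x y" "\<And>x. norm (X x) \<le> M"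
    "\<And>q V \<psi>. q \<in> frontier S \<Longrightarrow> q \<in> V \<Longrightarrow> defining_function S V \<psi> \<Longrightarrow> 0 < frechet_derivative \<psi> (at q) (X q)"
proof -
  have "\<exists>U \<phi> a r. defining_function S U \<phi> \<and> 0 < r \<and> ball p r \<subseteq> U \<and> (\<forall>x\<in>ball p r. 0 < frechet_derivative \<phi> (at x) a)"
    if p: "p \<in> frontier S" for p
  proof -
    obtain U \<phi> where U: "p \<in> U" "defining_function S U \<phi>" using S p by (auto simp: smooth_boundary_iff)
    have lin: "linear (frechet_derivative \<phi> (at p))" using defining_function_linear U by blast
    have "frechet_derivative \<phi> (at p) \<noteq> (\<lambda>v. 0)" using U by (auto simp: defining_function_def)
    then obtain b where "frechet_derivative \<phi> (at p) b \<noteq> 0" by auto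
    then obtain a where a: "0 < frechet_derivative \<phi> (at p) a"
      using linear_neg[OF lin, of b] by (cases "0 < frechet_derivative \<phi> (at p) b") (auto intro: that[of b] that[of "- b"])
    have "open {x \<in> U. 0 < frechet_derivative \<phi> (at x) a}"
      using continuous_on_open_vimage[of U "\<lambda>x. frechet_derivative \<phi> (at x) a"] defining_function_continuous_derivative[OF U(2), of a] U(2)
      by (auto simp: defining_function_def vimage_def Int_def conj_commute dest: spec[of _ "{0<..}"])
    then obtain r where "0 < r" "ball p r \<subseteq> {x \<in> U. 0 < frechet_derivative \<phi> (at x) a}" using a U openE by blast
    then show ?thesis using U(2) by blast
  qed
  then obtain U \<phi> a r where ch: "\<And>p. p \<in> frontier S \<Longrightarrow> defining_function S (U p) (\<phi> p)"
    "\<And>p. p \<in> frontier S \<Longrightarrow> 0 < r p" "\<And>p. p \<in> frontier S \<Longrightarrow> ball p (r p) \<subseteq> U p"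
    "\<And>p x. p \<in> frontier S \<Longrightarrow> x \<in> ball p (r p) \<Longrightarrow> 0 < frechet_derivative (\<phi> p) (at x) (a p)"
    by metis
  have "compact (frontier S)" using bdd by (rule compact_frontier_bounded)
  then obtain C where C: "C \<subseteq> frontier S" "finite C" "frontier S \<subseteq> (\<Union>p\<in>C. ball p (r p))"
    by (rule compactE_image[of _ "frontier S" "\<lambda>p. ball p (r p)"]) (use ch(2) in auto)
  have rC: "0 < r p" if "p \<in> C" for p using ch C that by auto
  \<comment> \<open>Tent functions as weights keep the field bounded and globally Lipschitz.\<close>
  define X where "X x = (\<Sum>p\<in>C. max 0 (r p - dist x p) *\<^sub>R a p)" for x
  show ?thesis
  proof (rule that[of "\<Sum>p\<in>C. norm (a p)" "\<Sum>p\<in>C. r p * norm (a p)" X])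
    show "dist (X x) (X y) \<le> (\<Sum>p\<in>C. norm (a p)) * dist x y" for x y
    proof -
      have *: "\<bar>max 0 (r p - dist x p) - max 0 (r p - dist y p)\<bar> \<le> dist x y" for p
        using dist_triangle[of x p y] dist_triangle[of y p x] by (auto simp: max_def dist_commute)
      have "X x - X y = (\<Sum>p\<in>C. (max 0 (r p - dist x p) - max 0 (r p - dist y p)) *\<^sub>R a p)"
        by (simp add: X_def sum_subtractf scaleR_diff_left)
      then have "dist (X x) (X y) \<le> (\<Sum>p\<in>C. norm ((max 0 (r p - dist x p) - max 0 (r p - dist y p)) *\<^sub>R a p))"
        by (simp only: dist_norm norm_sum)
      also have "\<dots> \<le> (\<Sum>p\<in>C. dist x y * norm (a p))"
        using * by (intro sum_mono) (auto intro: mult_right_mono)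
      finally show ?thesis by (simp add: sum_distrib_left mult.commute)
    qed
    show "norm (X x) \<le> (\<Sum>p\<in>C. r p * norm (a p))" for x
    proof -
      have "norm (X x) \<le> (\<Sum>p\<in>C. norm (max 0 (r p - dist x p) *\<^sub>R a p))" unfolding X_def by (rule norm_sum)
      also have "\<dots> \<le> (\<Sum>p\<in>C. r p * norm (a p))"
        using rC by (intro sum_mono) (auto intro!: mult_right_mono simp: max_def less_imp_le)
      finally show ?thesis .
    qed
    show "0 < frechet_derivative \<psi> (at q) (X q)" if q: "q \<in> frontier S" "q \<in> V" "defining_function S V \<psi>" for q V \<psi>
    proof -
      have lin: "linear (frechet_derivative \<psi> (at q))" using defining_function_linear q by blast
      have pos: "0 < frechet_derivative \<psi> (at q) (a p)" if "p \<in> C" "dist q p < r p" for p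
      proof -
        have p: "p \<in> frontier S" "q \<in> ball p (r p)" using that C by (auto simp: dist_commute)
        then have "q \<in> U p" using ch(3) by blast
        from defining_function_outward[OF ch(1)[OF p(1)] q(3) q(1) this q(2) ch(4)[OF p]] show ?thesis .
      qed
      obtain p where p: "p \<in> C" "dist q p < r p" using C(3) q(1) by (auto simp: dist_commute)
      have "0 < (\<Sum>p\<in>C. max 0 (r p - dist q p) * frechet_derivative \<psi> (at q) (a p))"
      proof (rule sum_pos2[OF C(2) p(1)])
        show "0 < max 0 (r p - dist q p) * frechet_derivative \<psi> (at q) (a p)" using p pos by simp
        show "0 \<le> max 0 (r p - dist q p) * frechet_derivative \<psi> (at q) (a p)" if "p \<in> C" for p
          using pos[OF that] by (cases "dist q p < r p") (auto simp: max_def)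
      qed
      then show ?thesis by (simp add: X_def linear_sum[OF lin] linear_cmul[OF lin])
    qed
  qed (use rC in \<open>auto intro!: sum_nonneg mult_nonneg_nonneg simp: less_imp_le\<close>)
qed

text \<open>Near a boundary point \<open>\<psi>\<close> strictly decreases along the segment from
  \<open>x\<close> in direction \<open>- X x\<close>, and it starts at a value at most 0 for
  \<open>x\<close> in the closure. Compactness of the closure makes the admissible step length
  uniform.\<close>

lemma push_inside:
  fixes S :: "'a::euclidean_space set" and X :: "'a \<Rightarrow> 'a"
  assumes "open S" and bdd: "bounded S" and S: "smooth_boundary S"
    and X: "\<And>x y. dist (X x) (X y) \<le> L * dist x y" "0 \<le> M" "\<And>x. norm (X x) \<le> M"
    and out: "\<And>q V \<psi>. q \<in> frontier S \<Longrightarrow> q \<in> V \<Longrightarrow> defining_function S V \<psi> \<Longrightarrow> 0 < frechet_derivative \<psi> (at q) (X q)"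
  obtains e0 where "0 < e0" "\<And>e x. 0 < e \<Longrightarrow> e < e0 \<Longrightarrow> x \<in> closure S \<Longrightarrow> x - e *\<^sub>R X x \<in> S"
proof -
  \<comment> \<open>The bound \<open>r / (2 * (M + 1))\<close> limits the displacement to half the
    radius; the summand 1 allows for \<open>M = 0\<close>.\<close>
  have small: "norm (e *\<^sub>R X x) < r / 2" if "0 \<le> e" "e < r / (2 * (M + 1))" "0 < r" for e r x
  proof -
    have "norm (e *\<^sub>R X x) \<le> e * (M + 1)" using that X(3)[of x] by (auto intro: mult_left_mono)
    also have "\<dots> < r / (2 * (M + 1)) * (M + 1)" using that X(2) by (intro mult_strict_right_mono) auto
    also have "\<dots> = r / 2" using X(2) by (simp add: field_simps)
    finally show ?thesis .
  qed
  have contX: "continuous_on UNIV X"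
  proof (rule continuous_onI)
    fix x :: 'a and e :: real assume e: "0 < e"
    have "dist (X y) (X x) \<le> e" if "dist y x < e / (\<bar>L\<bar> + 1)" for y
    proof -
      have "dist (X y) (X x) \<le> (\<bar>L\<bar> + 1) * dist y x" by (rule order_trans[OF X(1)]) (intro mult_right_mono, auto)
      also have "\<dots> \<le> (\<bar>L\<bar> + 1) * (e / (\<bar>L\<bar> + 1))" using that by (intro mult_left_mono) auto
      finally show ?thesis by simp
    qed
    then show "\<exists>d>0. \<forall>x'\<in>UNIV. dist x' x < d \<longrightarrow> dist (X x') (X x) \<le> e"
      using e by (intro exI[of _ "e / (\<bar>L\<bar> + 1)"]) (auto simp: add_nonneg_pos)
  qed
  have "\<exists>r>0. \<exists>e0>0. \<forall>x\<in>ball q r \<inter> closure S. \<forall>e. 0 < e \<and> e < e0 \<longrightarrow> x - e *\<^sub>R X x \<in> S" if q: "q \<in> closure S" for q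
  proof (cases "q \<in> S")
    case True
    then obtain r where r: "0 < r" "ball q r \<subseteq> S" using \<open>open S\<close> openE by blast
    have "x - e *\<^sub>R X x \<in> S" if x: "x \<in> ball q (r / 2)" "0 < e" "e < r / (2 * (M + 1))" for x e
    proof -
      have "dist q (x - e *\<^sub>R X x) \<le> dist q x + norm (e *\<^sub>R X x)"
        using dist_triangle[of q "x - e *\<^sub>R X x" x] by (simp add: dist_norm)
      then show ?thesis using small[of e r x] x r by auto
    qed
    then show ?thesis using r X(2) by (intro exI[of _ "r / 2"] conjI exI[of _ "r / (2 * (M + 1))"]) (auto simp: add_nonneg_pos)
  next
    case False
    then have fr: "q \<in> frontier S" using q \<open>open S\<close> by (simp add: frontier_def interior_open)
    then obtain U \<psi> where U: "q \<in> U" "defining_function S U \<psi>" using S by (auto simp: smooth_boundary_iff)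
    let ?D = "\<lambda>y. frechet_derivative \<psi> (at y)"
    have oU: "open U" using U by (simp add: defining_function_def)
    \<comment> \<open>The field and the derivative get separate base points, since along the segment
      \<open>X x\<close> stays fixed while the derivative is taken at the moving point. Expansion in
      a basis makes joint continuity visible.\<close>
    define G where "G z = (\<Sum>b\<in>Basis. (X (fst z) \<bullet> b) * ?D (snd z) b)" for z
    have G: "G (x, y) = ?D y (X x)" if "y \<in> U" for x y
    proof -
      have lin: "linear (?D y)" using defining_function_linear U that by blast
      have "?D y (X x) = ?D y (\<Sum>b\<in>Basis. (X x \<bullet> b) *\<^sub>R b)" by (simp only: euclidean_representation)
      also have "\<dots> = G (x, y)"
        by (simp add: G_def linear_sum[OF lin] linear_cmul[OF lin] del: euclidean_representation)
      finally show ?thesis ..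
    qed
    have "continuous_on (UNIV \<times> U) G" unfolding G_def
      by (intro continuous_intros continuous_on_compose2[OF contX]
          continuous_on_compose2[OF defining_function_continuous_derivative[OF U(2)]]) auto
    then have "open (G -` {0<..} \<inter> (UNIV \<times> U))"
      using continuous_on_open_vimage[of "UNIV \<times> U" G] oU by (auto simp: open_Times)
    moreover have "(q, q) \<in> G -` {0<..} \<inter> (UNIV \<times> U)" using G U out[OF fr U] by simp
    ultimately obtain A B where AB: "open A" "open B" "q \<in> A" "q \<in> B" "A \<times> B \<subseteq> G -` {0<..} \<inter> (UNIV \<times> U)"
      by (auto elim!: open_prod_elim)
    have "open (A \<inter> B)" using AB by auto
    then obtain r where r: "0 < r" "ball q r \<subseteq> A \<inter> B" using AB openE[of "A \<inter> B" q] by auto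
    have BU: "B \<subseteq> U" using AB by auto
    have pos: "0 < ?D y (X x)" if "x \<in> ball q r" "y \<in> ball q r" for x y
    proof -
      have "(x, y) \<in> A \<times> B" using that r by auto
      then have "0 < G (x, y)" "y \<in> U" using AB(5) BU by auto
      then show ?thesis using G by simp
    qed
    have "x - e *\<^sub>R X x \<in> S" if x: "x \<in> ball q (r / 2)" "x \<in> closure S" "0 < e" "e < r / (2 * (M + 1))" for x e
    proof -
      have seg: "x + t *\<^sub>R (- X x) \<in> ball q r" if t: "0 \<le> t" "t \<le> e" for t
      proof -
        have "dist q (x - t *\<^sub>R X x) \<le> dist q x + norm (t *\<^sub>R X x)"
          using dist_triangle[of q "x - t *\<^sub>R X x" x] by (simp add: dist_norm)
        then show ?thesis using small[of t r x] x r t by auto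
      qed
      have xr: "x \<in> ball q r" using seg[of 0] x by simp
      have "\<psi> (x + e *\<^sub>R (- X x)) < \<psi> (x + 0 *\<^sub>R (- X x))"
      proof (rule DERIV_neg_imp_decreasing[OF x(3)])
        fix t assume t: "0 \<le> t" "t \<le> e"
        let ?y = "x + t *\<^sub>R (- X x)"
        have y: "?y \<in> U" using seg[OF t] r BU by blast
        have "((\<lambda>t. \<psi> (x + t *\<^sub>R (- X x))) has_real_derivative ?D ?y (- X x)) (at t)"
          by (rule has_real_derivative_along[OF defining_function_has_derivative[OF U(2) y]])
        moreover have "?D ?y (- X x) < 0"
          using pos[OF xr seg[OF t]] linear_neg[OF defining_function_linear[OF U(2) y], of "X x"] by simp
        ultimately show "\<exists>y. ((\<lambda>t. \<psi> (x + t *\<^sub>R (- X x))) has_real_derivative y) (at t) \<and> y < 0" by blast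
      qed
      moreover have "\<psi> x \<le> 0"
      proof -
        have "x \<in> U" using xr r BU by blast
        moreover have "x \<in> S \<or> x \<in> frontier S" using x(2) \<open>open S\<close> by (auto simp: frontier_def interior_open)
        moreover have "S \<inter> U = {x \<in> U. \<psi> x < 0}" "frontier S \<inter> U = {x \<in> U. \<psi> x = 0}"
          using U(2) by (simp_all add: defining_function_def)
        ultimately have "x \<in> {x \<in> U. \<psi> x < 0} \<or> x \<in> {x \<in> U. \<psi> x = 0}" by blast
        then show ?thesis by auto
      qed
      ultimately have "\<psi> (x - e *\<^sub>R X x) < 0" by simp
      moreover have "x - e *\<^sub>R X x \<in> U" using seg[of e] x r BU by auto
      ultimately show ?thesis using U(2) by (auto simp: defining_function_def)
    qed
    then show ?thesis using r X(2) by (intro exI[of _ "r / 2"] conjI exI[of _ "r / (2 * (M + 1))"]) (auto simp: add_nonneg_pos)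
  qed
  then obtain r e0 where re: "\<And>q. q \<in> closure S \<Longrightarrow> 0 < r q" "\<And>q. q \<in> closure S \<Longrightarrow> 0 < e0 q"
    "\<And>q x e. q \<in> closure S \<Longrightarrow> x \<in> ball q (r q) \<Longrightarrow> x \<in> closure S \<Longrightarrow> 0 < e \<Longrightarrow> e < e0 q \<Longrightarrow> x - e *\<^sub>R X x \<in> S"
    by (metis IntI)
  have "compact (closure S)" using bdd by (simp add: compact_closure)
  then obtain C where C: "C \<subseteq> closure S" "finite C" "closure S \<subseteq> (\<Union>q\<in>C. ball q (r q))"
    by (rule compactE_image[of _ "closure S" "\<lambda>q. ball q (r q)"]) (use re(1) in auto)
  show ?thesis
  \<comment> \<open>The inserted 1 keeps the minimum meaningful when \<open>C\<close> is
    empty.\<close>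
  proof (rule that[of "Min (insert 1 (e0 ` C))"])
    show "0 < Min (insert 1 (e0 ` C))" using C re(2) by auto
    fix e x assume e: "0 < e" "e < Min (insert 1 (e0 ` C))" and x: "x \<in> closure S"
    then obtain q where "q \<in> C" "x \<in> ball q (r q)" using C by auto
    then show "x - e *\<^sub>R X x \<in> S" using re(3)[of q x e] e x C by auto
  qed
qed

text \<open>\<open>T\<close> is the identity minus a field with Lipschitz constant
  \<open>e * L\<close>. For \<open>e * L < 1\<close> it is a homeomorphism with Lipschitz constants
  \<open>1 + e * L\<close> and \<open>1 / (1 - e * L)\<close>, and it maps the closure of
  \<open>S\<close> into \<open>S\<close>.\<close>

lemma sobolev_cap_closure_le:
  fixes S :: "(real ^ 'n) set"
  assumes alpha: "0 < \<alpha>" and "open S" "bounded S" "smooth_boundary S"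
  shows "sobolev_cap \<alpha> (closure S) \<le> 2 * perimeter \<alpha> S"
proof -
  obtain X :: "real ^ 'n \<Rightarrow> real ^ 'n" and L M where X: "0 \<le> L" "0 \<le> M" "\<And>x y. dist (X x) (X y) \<le> L * dist x y" "\<And>x. norm (X x) \<le> M"
    and out: "\<And>q V \<psi>. q \<in> frontier S \<Longrightarrow> q \<in> V \<Longrightarrow> defining_function S V \<psi> \<Longrightarrow> 0 < frechet_derivative \<psi> (at q) (X q)"
    using outward_field_exists[OF assms(3,4)] by metis
  obtain e0 where e0: "0 < e0" "\<And>e x. 0 < e \<Longrightarrow> e < e0 \<Longrightarrow> x \<in> closure S \<Longrightarrow> x - e *\<^sub>R X x \<in> S"
    by (rule push_inside[OF assms(2-4) X(3,2,4)]) (use out in auto)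
  define c where "c e = (1 + e * L) powr (real CARD('n) + \<alpha>) * ((1 / (1 - e * L)) ^ CARD('n))\<^sup>2" for e
  have le: "sobolev_cap \<alpha> (closure S) \<le> 2 * (ennreal (c e) * perimeter \<alpha> S)" if e: "0 < e" "e < e0" "e * L < 1" for e
  proof -
    define T where "T x = x - e *\<^sub>R X x" for x
    have eX: "dist (e *\<^sub>R X x) (e *\<^sub>R X y) \<le> (e * L) * dist x y" for x y
      using X(3)[of x y] e by (simp add: dist_norm scaleR_diff_right[symmetric] mult.assoc mult_left_mono del: scaleR_diff_right)
    have T1: "dist (T x) (T y) \<le> (1 + e * L) * dist x y" for x y
    proof -
      have "dist (T x) (T y) \<le> dist x y + dist (e *\<^sub>R X x) (e *\<^sub>R X y)"
        using norm_triangle_ineq4[of "x - y" "e *\<^sub>R X x - e *\<^sub>R X y"] by (simp add: T_def dist_norm algebra_simps)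
      then show ?thesis using eX[of x y] by (simp add: distrib_right)
    qed
    have T2: "(1 - e * L) * dist x y \<le> dist (T x) (T y)" for x y
    proof -
      have "dist x y \<le> dist (T x) (T y) + dist (e *\<^sub>R X x) (e *\<^sub>R X y)"
        using norm_triangle_ineq[of "T x - T y" "e *\<^sub>R X x - e *\<^sub>R X y"] by (simp add: T_def dist_norm)
      then show ?thesis using eX[of x y] by (simp add: left_diff_distrib)
    qed
    have injT: "inj T"
    proof (rule injI)
      fix x y assume "T x = T y"
      then have "(1 - e * L) * dist x y \<le> 0" using T2[of x y] by simp
      then show "x = y" using e by (simp add: mult_le_0_iff)
    qed
    have surjT: "surj T"
    proof -
      have "\<exists>x. y = T x" for y
      proof -
        \<comment> \<open>The equation \<open>T x = y\<close> is a fixed point equation for a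
          contraction.\<close>
        have "\<exists>!x. y + e *\<^sub>R X x = x"
          by (rule banach_fix_type[of "e * L"]) (use e X eX in auto)
        then obtain x where "y + e *\<^sub>R X x = x" by blast
        then have "y = T x" unfolding T_def by (metis add_diff_cancel_right')
        then show ?thesis ..
      qed
      then show ?thesis by (simp add: surj_def)
    qed
    have lipI: "dist (inv T x) (inv T y) \<le> (1 / (1 - e * L)) * dist x y" for x y
      using T2[of "inv T x" "inv T y"] e by (simp add: surj_f_inv_f[OF surjT] field_simps)
    have contT: "continuous_on UNIV T"
    proof (rule continuous_onI)
      fix x :: "real ^ 'n" and d :: real assume d: "0 < d"
      have A: "0 < 1 + e * L" using e X by (simp add: add_pos_nonneg)
      have "dist (T y) (T x) \<le> d" if "dist y x < d / (1 + e * L)" for y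
        using T1[of y x] that A by (simp add: field_simps)
      then show "\<exists>h>0. \<forall>x'\<in>UNIV. dist x' x < h \<longrightarrow> dist (T x') (T x) \<le> d"
        using d A by (intro exI[of _ "d / (1 + e * L)"]) auto
    qed
    then have [measurable]: "T \<in> borel_measurable borel" by (rule borel_measurable_continuous_onI)
    have "open (T -` S)" using contT \<open>open S\<close> by (rule open_vimage[rotated])
    moreover have "bounded (T -` S)"
    proof -
      obtain R where R: "\<And>x. x \<in> S \<Longrightarrow> norm x \<le> R" using assms(3) unfolding bounded_iff by auto
      have "norm x \<le> R + e * M" if "T x \<in> S" for x
      proof -
        have "norm x \<le> norm (T x) + norm (e *\<^sub>R X x)" using norm_triangle_ineq[of "T x" "e *\<^sub>R X x"] by (simp add: T_def)
        also have "norm (e *\<^sub>R X x) \<le> e * M" using e X(4)[of x] by (simp add: mult_left_mono)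
        finally show ?thesis using R[OF that] by simp
      qed
      then show ?thesis unfolding bounded_iff by auto
    qed
    moreover have "closure S \<subseteq> T -` S" using e0(2)[OF e(1,2)] by (auto simp: T_def)
    ultimately have "sobolev_cap \<alpha> (closure S) \<le> 2 * perimeter \<alpha> (T -` S)"
      using assms(3) by (intro sobolev_cap_le_perimeter) (auto simp: compact_closure)
    also have "\<dots> \<le> 2 * (ennreal (c e) * perimeter \<alpha> S)"
      unfolding c_def
      by (intro mult_left_mono perimeter_vimage_le[OF alpha T1 _ lipI])
         (use e X injT \<open>open S\<close> in \<open>auto simp: add_pos_nonneg\<close>)
    finally show ?thesis .
  qed
  show ?thesis
  proof (rule ennreal_le_of_factor_gt_1)
    fix C :: real assume C: "1 < C"
    have "(c \<longlongrightarrow> (1 + 0 * L) powr (real CARD('n) + \<alpha>) * ((1 / (1 - 0 * L)) ^ CARD('n))\<^sup>2) (at_right 0)"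
      unfolding c_def by (intro tendsto_intros) auto
    then have "eventually (\<lambda>e. c e < C) (at_right 0)" using C by (intro order_tendstoD) auto
    moreover have "eventually (\<lambda>e. e * L < 1) (at_right 0)"
    proof (rule order_tendstoD)
      show "((\<lambda>e. e * L) \<longlongrightarrow> 0 * L) (at_right 0)" by (intro tendsto_intros)
    qed simp
    moreover have "eventually (\<lambda>e. e \<in> {0<..<e0}) (at_right 0)" using e0(1) by (intro eventually_at_right_real) auto
    ultimately have "eventually (\<lambda>e. c e < C \<and> e * L < 1 \<and> e \<in> {0<..<e0}) (at_right 0)" by eventually_elim auto
    then obtain e where e: "c e < C" "e * L < 1" "e \<in> {0<..<e0}"
      using eventually_happens'[OF trivial_limit_at_right_real] by blast
    have "sobolev_cap \<alpha> (closure S) \<le> 2 * (ennreal (c e) * perimeter \<alpha> S)" using e by (intro le) auto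
    also have "\<dots> \<le> 2 * (ennreal C * perimeter \<alpha> S)" using e by (intro mult_left_mono mult_right_mono ennreal_leI) auto
    finally show "sobolev_cap \<alpha> (closure S) \<le> ennreal C * (2 * perimeter \<alpha> S)" by (simp add: mult.left_commute)
  qed
qed

section \<open>The perimeter of a ball\<close>

text \<open>The unit ball and the shell up to radius 2 are at mutual distance at most 3, where the
  kernel is bounded below.\<close>

lemma perimeter_unit_ball_pos:
  assumes alpha: "0 < \<alpha>"
  shows "0 < perimeter \<alpha> (ball (0 :: real ^ 'n) 1)"
proof -
  let ?B = "ball (0 :: real ^ 'n) 1" and ?A = "ball (0 :: real ^ 'n) 2 - ball 0 1"
  define c where "c = 1 / 3 powr (real CARD('n) + \<alpha>)"
  have c: "0 < c" by (simp add: c_def)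
  have k: "ennreal c * indicator ?B x * indicator ?A y \<le> ennreal (indicator ?B x * indicator (- ?B) y * kern \<alpha> (x - y))" for x y
  proof (cases "x \<in> ?B \<and> y \<in> ?A")
    case True
    have "norm (x - y) \<le> 3" using norm_triangle_ineq4[of x y] True by auto
    moreover have "x \<noteq> y" using True by auto
    ultimately have "norm (x - y) powr (real CARD('n) + \<alpha>) \<le> 3 powr (real CARD('n) + \<alpha>)" "0 < norm (x - y) powr (real CARD('n) + \<alpha>)"
      using alpha by (auto intro!: powr_mono2)
    then have "c \<le> kern \<alpha> (x - y)" unfolding kern_def c_def by (intro divide_left_mono) auto
    then show ?thesis using True by (auto simp: indicator_def intro: ennreal_leI)
  qed auto
  have "emeasure lborel ?A = emeasure lborel (ball (0 :: real ^ 'n) 2) - emeasure lborel ?B"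
    using emeasure_lborel_ball_finite[of "0 :: real ^ 'n" 1] by (intro emeasure_Diff) auto
  also have "\<dots> = ennreal (unit_ball_vol (real CARD('n)) * 2 ^ CARD('n) - unit_ball_vol (real CARD('n)))"
    by (simp add: emeasure_ball ennreal_minus)
  finally have A: "emeasure lborel ?A = ennreal (unit_ball_vol (real CARD('n)) * (2 ^ CARD('n) - 1))"
    by (simp add: right_diff_distrib)
  have "(2::real) ^ CARD('n) > 1" by (intro one_less_power) auto
  then have posA: "0 < emeasure lborel ?A" unfolding A by simp
  have "ennreal c * emeasure lborel ?B * emeasure lborel ?A
     = (\<integral>\<^sup>+x. ennreal c * indicator ?B x * emeasure lborel ?A)"
  proof -
    have "(\<integral>\<^sup>+x. ennreal c * indicator ?B x) = ennreal c * emeasure lborel ?B"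
      by (rule nn_integral_cmult_indicator) simp
    moreover have [measurable]: "?B \<in> sets borel" by simp
    have "(\<lambda>x. ennreal c * indicator ?B x) \<in> borel_measurable lborel"
      by measurable
    ultimately show ?thesis by (simp only: nn_integral_multc)
  qed
  also have "\<dots> = (\<integral>\<^sup>+x. \<integral>\<^sup>+y. ennreal c * indicator ?B x * indicator ?A y)"
    by (intro nn_integral_cong nn_integral_cmult_indicator[symmetric]) auto
  also have "\<dots> \<le> perimeter \<alpha> ?B"
    by (subst perimeter_eq_kern) (simp, intro nn_integral_mono k)
  finally have le: "ennreal c * emeasure lborel ?B * emeasure lborel ?A \<le> perimeter \<alpha> ?B" .
  have "0 < ennreal c * emeasure lborel ?B * emeasure lborel ?A"
    using posA c by (simp add: ennreal_zero_less_mult_iff emeasure_ball)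
  then show ?thesis using le by (rule less_le_trans)
qed

text \<open>Writing the kernel as a superposition of indicators of balls reduces integrals over
  \<open>h\<close> to volumes of balls, so polar coordinates are avoided.\<close>

lemma kern_layer_cake:
  fixes h :: "real ^ 'n"
  assumes alpha: "0 < \<alpha>" and h: "h \<noteq> 0"
  defines "b \<equiv> real CARD('n) + \<alpha>"
  shows "ennreal (kern \<alpha> h) = (\<integral>\<^sup>+s. ennreal (b * s powr (- b - 1)) * indicator {norm h..} s)"
proof -
  have b: "0 < b" using alpha by (simp add: b_def)
  have "(\<integral>\<^sup>+s. ennreal (b * s powr (- b - 1)) * indicator {norm h..} s) = ennreal (0 - (- (norm h powr (- b))))"
  proof (rule nn_integral_FTC_atLeast)
    fix s assume "norm h \<le> s"
    then have "0 < s" using h by (smt (verit) zero_less_norm_iff)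
    then show "((\<lambda>s. - (s powr (- b))) has_real_derivative b * s powr (- b - 1)) (at s)"
      by (auto intro!: derivative_eq_intros)
    show "0 \<le> b * s powr (- b - 1)" using b by simp
  next
    have "((\<lambda>s. s powr (- b)) \<longlongrightarrow> 0) at_top" using b by (intro tendsto_neg_powr filterlim_ident) auto
    then show "((\<lambda>s. - (s powr (- b))) \<longlongrightarrow> 0) at_top" using tendsto_minus by fastforce
  qed measurable
  then show ?thesis by (simp add: kern_def b_def powr_minus_divide del: minus_add_distrib)
qed

text \<open>After the layer cake the integrand in \<open>s\<close> is a constant times
  \<open>s powr - \<alpha>\<close> on \<open>[0, 1]\<close> and
  \<open>s powr (- \<alpha> - 1)\<close> beyond 1: the first is integrable since
  \<open>\<alpha> < 1\<close>, the second since \<open>0 < \<alpha>\<close>.\<close>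

lemma gagliardo_finite:
  fixes f :: "real ^ 'n \<Rightarrow> real"
  assumes alpha: "0 < \<alpha>" "\<alpha> < 1" and [measurable]: "f \<in> borel_measurable borel" and C: "0 \<le> C"
    and D: "\<And>h. (\<integral>\<^sup>+x. ennreal \<bar>f (x + h) - f x\<bar>) \<le> ennreal (C * min 1 (norm h))"
  shows "gagliardo \<alpha> f < \<infinity>"
proof -
  define b where "b = real CARD('n) + \<alpha>"
  define W where "W = unit_ball_vol (real CARD('n))"
  have b: "0 < b" using alpha by (simp add: b_def)
  have W: "0 < W" by (simp add: W_def)
  let ?D = "\<lambda>h :: real ^ 'n. ennreal (C * min 1 (norm h))"
  let ?w = "\<lambda>s. ennreal (b * s powr (- b - 1))"
  have "gagliardo \<alpha> f = (\<integral>\<^sup>+h. (\<integral>\<^sup>+x. ennreal \<bar>f (x + h) - f x\<bar>) * ennreal (kern \<alpha> h))"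
    using sobolev_norm_eq_gagliardo[of f \<alpha>] by (simp add: sobolev_norm_def kern_def)
  also have "\<dots> \<le> (\<integral>\<^sup>+h. \<integral>\<^sup>+s. ?D h * (?w s * indicator {norm h..} s))"
  proof (rule nn_integral_mono)
    fix h :: "real ^ 'n"
    show "(\<integral>\<^sup>+x. ennreal \<bar>f (x + h) - f x\<bar>) * ennreal (kern \<alpha> h)
      \<le> (\<integral>\<^sup>+s. ?D h * (?w s * indicator {norm h..} s))"
    proof (cases "h = 0")
      case False
      have "(\<integral>\<^sup>+s. ?D h * (?w s * indicator {norm h..} s)) = ?D h * ennreal (kern \<alpha> h)"
        unfolding kern_layer_cake[OF alpha(1) False] b_def by (rule nn_integral_cmult) measurable
      then show ?thesis using D[of h] by (simp add: mult_right_mono)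
    qed simp
  qed
  also have "\<dots> = (\<integral>\<^sup>+s. \<integral>\<^sup>+h. ?D h * (?w s * indicator {norm h..} s))"
    by (rule lborel_pair.Fubini') (unfold indicator_def atLeast_iff, measurable)
  also have "\<dots> \<le> (\<integral>\<^sup>+s. ennreal (C * W * b) * (ennreal (s powr - \<alpha>) * indicator {0..1} s)
      + ennreal (C * W * b) * (ennreal (s powr (- \<alpha> - 1)) * indicator {1..} s))"
  proof (rule nn_integral_mono)
    fix s :: real
    show "(\<integral>\<^sup>+h. ?D h * (?w s * indicator {norm (h :: real ^ 'n)..} s)) \<le> ennreal (C * W * b) * (ennreal (s powr - \<alpha>) * indicator {0..1} s)
      + ennreal (C * W * b) * (ennreal (s powr (- \<alpha> - 1)) * indicator {1..} s)"
    proof (cases "s \<le> 0")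
      case True
      \<comment> \<open>For \<open>s \<le> 0\<close> only \<open>h = 0\<close> can satisfy
        \<open>norm h \<le> s\<close>, and there the factor \<open>min 1 (norm h)\<close>
        vanishes.\<close>
      have "?D h * (?w s * indicator {norm h..} s) = 0" for h :: "real ^ 'n"
      proof (cases "norm h \<le> s")
        case le: True
        then have "h = 0" using order_trans[OF le True] by simp
        then show ?thesis by simp
      qed auto
      then have "(\<integral>\<^sup>+h. ?D h * (?w s * indicator {norm (h :: real ^ 'n)..} s)) = integral\<^sup>N lborel (\<lambda>h :: real ^ 'n. 0)"
        by (intro nn_integral_cong)
      then show ?thesis by simp
    next
      case False
      then have s: "0 < s" by simp
      have "(\<integral>\<^sup>+h. ?D h * (?w s * indicator {norm (h :: real ^ 'n)..} s))
         \<le> (\<integral>\<^sup>+h. ennreal (C * min 1 s) * ?w s * indicator (cball (0 :: real ^ 'n) s) h)"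
        using C s by (intro nn_integral_mono) (auto simp: indicator_def intro!: mult_right_mono ennreal_leI mult_left_mono)
      also have "\<dots> = ennreal (C * min 1 s) * ?w s * ennreal (W * s ^ CARD('n))"
        using s by (subst nn_integral_cmult_indicator) (auto simp: emeasure_cball W_def)
      also have "\<dots> = ennreal (C * min 1 s * (b * s powr (- b - 1)) * (W * s ^ CARD('n)))"
        using s b C W by (simp add: ennreal_mult[symmetric])
      also have "C * min 1 s * (b * s powr (- b - 1)) * (W * s ^ CARD('n)) = C * W * b * (min 1 s * s powr (- \<alpha> - 1))"
        using s by (simp add: powr_realpow[symmetric] b_def mult.assoc flip: powr_add)
      also have "min 1 s * s powr (- \<alpha> - 1) = (if s \<le> 1 then s powr - \<alpha> else s powr (- \<alpha> - 1))"
        using s by (simp add: powr_diff)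
      finally show ?thesis using s C W b by (auto simp: ennreal_mult[symmetric] intro: order_trans)
    qed
  qed
  also have "\<dots> = ennreal (C * W * b) * (\<integral>\<^sup>+s. ennreal (s powr - \<alpha>) * indicator {0..1} s)
      + ennreal (C * W * b) * (\<integral>\<^sup>+s. ennreal (s powr (- \<alpha> - 1)) * indicator {1..} s)"
    by (simp add: nn_integral_add nn_integral_cmult)
  also have "(\<integral>\<^sup>+s. ennreal (s powr - \<alpha>) * indicator {0..1} s) = ennreal (1 / (1 - \<alpha>))"
  proof -
    have "((\<lambda>s. s powr - \<alpha>) has_integral (1 powr (- \<alpha> + 1) / (- \<alpha> + 1))) {0..1}"
      using alpha by (intro has_integral_powr_from_0) auto
    then have "((\<lambda>s. if s \<in> {0..1} then s powr - \<alpha> else 0) has_integral (1 / (1 - \<alpha>))) UNIV"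
      by (subst has_integral_restrict_UNIV) simp
    then have "(\<integral>\<^sup>+s. ennreal (if s \<in> {0..1} then s powr - \<alpha> else 0)) = ennreal (1 / (1 - \<alpha>))"
      by (intro nn_integral_has_integral_lborel) auto
    moreover have "(\<integral>\<^sup>+s. ennreal (if s \<in> {0..1} then s powr - \<alpha> else 0))
       = (\<integral>\<^sup>+s. ennreal (s powr - \<alpha>) * indicator {0..1} s)"
      by (intro nn_integral_cong) auto
    ultimately show ?thesis by simp
  qed
  also have "(\<integral>\<^sup>+s. ennreal (s powr (- \<alpha> - 1)) * indicator {1..} s) = ennreal (0 - (- (1 powr (- \<alpha>) / \<alpha>)))"
  proof (rule nn_integral_FTC_atLeast)
    fix s :: real assume "1 \<le> s"
    then show "((\<lambda>s. - (s powr (- \<alpha>) / \<alpha>)) has_real_derivative s powr (- \<alpha> - 1)) (at s)"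
      using alpha by (auto intro!: derivative_eq_intros)
    show "0 \<le> s powr (- \<alpha> - 1)" by simp
  next
    have "((\<lambda>s. s powr (- \<alpha>)) \<longlongrightarrow> 0) at_top" using alpha by (intro tendsto_neg_powr filterlim_ident) auto
    then have "((\<lambda>s. - (s powr (- \<alpha>) / \<alpha>)) \<longlongrightarrow> - (0 / \<alpha>)) at_top" using alpha by (intro tendsto_intros) auto
    then show "((\<lambda>s. - (s powr (- \<alpha>) / \<alpha>)) \<longlongrightarrow> 0) at_top" by simp
  qed measurable
  also have "ennreal (C * W * b) * ennreal (1 / (1 - \<alpha>)) + ennreal (C * W * b) * ennreal (0 - - (1 powr - \<alpha> / \<alpha>)) < \<infinity>"
    by (simp add: ennreal_mult_less_top)
  finally show ?thesis .
qed

text \<open>The tent function has finite norm, and its level sets are balls; by scaling, the perimeters of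
  these balls are either all finite or all infinite.\<close>
lemma perimeter_unit_ball_finite:
  assumes alpha: "0 < \<alpha>" "\<alpha> < 1"
  shows "perimeter \<alpha> (ball (0 :: real ^ 'n) 1) < \<infinity>"
proof (rule ccontr)
  assume "\<not> perimeter \<alpha> (ball (0 :: real ^ 'n) 1) < \<infinity>"
  then have inf: "perimeter \<alpha> (ball (0 :: real ^ 'n) 1) = \<infinity>" by (simp add: less_top[symmetric])
  define f where "f x = max 0 (1 - norm x)" for x :: "real ^ 'n"
  define W where "W = unit_ball_vol (real CARD('n))"
  have [measurable]: "f \<in> borel_measurable borel" unfolding f_def by measurable
  have [measurable]: "ball (0 :: real ^ 'n) 1 \<in> sets borel" by simp
  have "gagliardo \<alpha> f < \<infinity>"
  proof (rule gagliardo_finite[OF alpha, where C="2 * W"])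
    fix h :: "real ^ 'n"
    let ?m = "ennreal (min 1 (norm h))" and ?I = "indicator (ball (0 :: real ^ 'n) 1) :: real ^ 'n \<Rightarrow> ennreal"
    \<comment> \<open>The tent is 1-Lipschitz with values in \<open>[0, 1]\<close>, and the
      difference vanishes unless one of the two points lies in the unit ball.\<close>
    have "ennreal \<bar>f (x + h) - f x\<bar> \<le> ?m * ?I (h + x) + ?m * ?I x" for x
    proof (cases "norm (x + h) < 1 \<or> norm x < 1")
      case True
      have "\<bar>norm (x + h) - norm x\<bar> \<le> norm h" using norm_triangle_ineq3[of "x + h" x] by simp
      then have "\<bar>f (x + h) - f x\<bar> \<le> norm h" by (auto simp: f_def max_def abs_if split: if_splits)
      moreover have "0 \<le> f y \<and> f y \<le> 1" for y using norm_ge_zero[of y] by (auto simp: f_def)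
      from this[of x] this[of "x + h"] have "\<bar>f (x + h) - f x\<bar> \<le> 1" by linarith
      ultimately have "\<bar>f (x + h) - f x\<bar> \<le> min 1 (norm h)" by simp
      then have "ennreal \<bar>f (x + h) - f x\<bar> \<le> ?m" by (rule ennreal_leI)
      also have "?m \<le> ?m * ?I (h + x) + ?m * ?I x" using True by (auto simp: indicator_def add.commute)
      finally show ?thesis .
    qed (auto simp: f_def max_def)
    then have "(\<integral>\<^sup>+x. ennreal \<bar>f (x + h) - f x\<bar>) \<le> (\<integral>\<^sup>+x. ?m * ?I (h + x) + ?m * ?I x)"
      by (intro nn_integral_mono)
    also have "\<dots> = ?m * (\<integral>\<^sup>+x. ?I (h + x)) + ?m * (\<integral>\<^sup>+x. ?I x)"
    proof -
      have 1: "(\<integral>\<^sup>+x. ?m * ?I (h + x)) = ?m * (\<integral>\<^sup>+x. ?I (h + x))"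
        "(\<integral>\<^sup>+x. ?m * ?I x) = ?m * (\<integral>\<^sup>+x. ?I x)"
        by (rule nn_integral_cmult, measurable)+
      have "(\<integral>\<^sup>+x. ?m * ?I (h + x) + ?m * ?I x) = (\<integral>\<^sup>+x. ?m * ?I (h + x)) + (\<integral>\<^sup>+x. ?m * ?I x)"
        by (rule nn_integral_add) measurable
      then show ?thesis by (simp only: 1)
    qed
    also have "(\<integral>\<^sup>+x. ?I (h + x)) = (\<integral>\<^sup>+x. ?I x)"
      by (rule nn_integral_lborel_translate) measurable
    also have "(\<integral>\<^sup>+x. ?I x) = ennreal W" by (simp add: emeasure_ball W_def)
    also have "?m * ennreal W + ?m * ennreal W = ennreal (2 * W * min 1 (norm h))"
      by (simp add: ennreal_mult[symmetric] ennreal_plus[symmetric] W_def mult_ac del: ennreal_plus)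
    finally show "(\<integral>\<^sup>+x. ennreal \<bar>f (x + h) - f x\<bar>) \<le> ennreal (2 * W * min 1 (norm h))" .
  qed (auto simp: W_def)
  moreover have "gagliardo \<alpha> f = (\<integral>\<^sup>+t\<in>{0..}. gagliardo \<alpha> (indicator {x. t < f x}) \<partial>lborel)"
    by (rule gagliardo_coarea) (auto simp: f_def)
  moreover have "(\<integral>\<^sup>+t. \<infinity> * indicator {0..1/2::real} t) \<le> (\<integral>\<^sup>+t\<in>{0..}. gagliardo \<alpha> (indicator {x. t < f x}) \<partial>lborel)"
  proof (rule nn_integral_mono)
    fix t :: real
    show "\<infinity> * indicator {0..1/2::real} t \<le> gagliardo \<alpha> (indicator {x. t < f x}) * indicator {0..} t"
    proof (cases "t \<in> {0..1/2}")
      case True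
      then have "{x. t < f x} = ball 0 (1 - t)" by (auto simp: f_def max_def)
      then have "gagliardo \<alpha> (indicator {x. t < f x}) = \<infinity>"
        using True inf perimeter_ball_scale[of "1 - t" \<alpha>, where 'n='n]
        by (simp add: gagliardo_indicator ennreal_mult_top)
      then show ?thesis using True by simp
    qed simp
  qed
  moreover have "(\<integral>\<^sup>+t. \<infinity> * indicator {0..1/2::real} t) = \<infinity>"
    by (subst nn_integral_cmult_indicator) (auto simp: ennreal_top_mult)
  ultimately show False by (auto simp: top_unique)
qed

lemma ball_smooth_domain: "ball (0 :: real ^ 'n) 1 \<in> smooth_domains"
proof -
  let ?B = "ball (0 :: real ^ 'n) 1"
  define \<phi> where "\<phi> x = - 1 + 1 * (x \<bullet> x)" for x :: "real ^ 'n"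
  have C: "Ck_on k UNIV \<phi>" for k unfolding \<phi>_def by (rule Ck_on_norm_square)
  have D: "(\<phi> has_derivative (\<lambda>v. 2 * (x \<bullet> v))) (at x)" for x
    unfolding \<phi>_def by (auto intro!: derivative_eq_intros simp: inner_commute)
  have F: "frechet_derivative \<phi> (at x) = (\<lambda>v. 2 * (x \<bullet> v))" for x
    using frechet_derivative_at[OF D] by simp
  have \<phi>: "\<phi> x < 0 \<longleftrightarrow> norm x < 1" "\<phi> x = 0 \<longleftrightarrow> norm x = 1" for x
  proof -
    have eq: "\<phi> x = (norm x)\<^sup>2 - 1" by (simp add: \<phi>_def power2_norm_eq_inner)
    show "\<phi> x < 0 \<longleftrightarrow> norm x < 1" using abs_square_less_1[of "norm x"] by (simp add: eq)
    have "norm x \<noteq> - 1" using norm_ge_zero[of x] by linarith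
    then show "\<phi> x = 0 \<longleftrightarrow> norm x = 1" using power2_eq_1_iff[of "norm x"] by (simp add: eq)
  qed
  have "smooth_boundary ?B" unfolding smooth_boundary_def
  proof
    fix p :: "real ^ 'n" assume p: "p \<in> frontier ?B"
    show "\<exists>U \<phi>. open U \<and> p \<in> U \<and> smooth_on U \<phi> \<and> (\<forall>x\<in>U. frechet_derivative \<phi> (at x) \<noteq> (\<lambda>v. 0)) \<and>
        ?B \<inter> U = {x \<in> U. \<phi> x < 0} \<and> frontier ?B \<inter> U = {x \<in> U. \<phi> x = 0}"
    \<comment> \<open>One chart serves all boundary points: the gradient of
      \<open>x \<bullet> x - 1\<close> vanishes at the origin only.\<close>
    proof (intro exI[of _ "- {0}"] exI[of _ \<phi>] conjI ballI)
      show "open (- {0 :: real ^ 'n})" by auto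
      show "p \<in> - {0}" using p by auto
      show "smooth_on (- {0}) \<phi>" using Ck_on_subset[OF C] by (simp add: smooth_on_def)
      show "frechet_derivative \<phi> (at x) \<noteq> (\<lambda>v. 0)" if "x \<in> - {0}" for x
      proof
        assume "frechet_derivative \<phi> (at x) = (\<lambda>v. 0)"
        then have "2 * (x \<bullet> x) = 0" unfolding F by (rule fun_cong)
        then show False using that by simp
      qed
      show "?B \<inter> - {0} = {x \<in> - {0}. \<phi> x < 0}" using \<phi> by auto
      show "frontier ?B \<inter> - {0} = {x \<in> - {0}. \<phi> x = 0}" using \<phi> by auto
    qed
  qed
  then show ?thesis by (simp add: smooth_domains_def)
qed

section \<open>Capacitary inequalities and their sharpness\<close>

lemma sobolev_cap_mono: "K \<subseteq> K' \<Longrightarrow> sobolev_cap \<alpha> K \<le> sobolev_cap \<alpha> K'"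
  unfolding sobolev_cap_def
  by (rule INF_superset_mono) (auto simp: indicator_def split: if_splits)

lemma sobolev_cap_empty: "sobolev_cap \<alpha> ({} :: (real ^ 'n) set) = 0"
proof -
  have "(\<lambda>x :: real ^ 'n. 0) \<in> test_functions"
    by (rule test_functionsI[of _ 0]) (auto intro: Ck_on_const)
  then have "sobolev_cap \<alpha> ({} :: (real ^ 'n) set) \<le> sobolev_norm \<alpha> (\<lambda>x :: real ^ 'n. 0)"
    unfolding sobolev_cap_def by (intro INF_lower) auto
  also have "\<dots> = 0" by (simp add: sobolev_norm_def)
  finally show ?thesis by simp
qed

lemma ennpowr_ennreal: "0 \<le> r \<Longrightarrow> ennpowr (ennreal r) p = ennreal (r powr p)"
  by (simp add: ennpowr_def)

lemma ennpowr_top: "ennpowr \<infinity> p = \<infinity>"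
  by (simp add: ennpowr_def)

lemma ennpowr_mono: "x \<le> y \<Longrightarrow> 0 < p \<Longrightarrow> ennpowr x p \<le> ennpowr y p"
  by (cases x; cases y) (auto simp: ennpowr_def top_unique intro!: ennreal_leI powr_mono2)

lemma ennpowr_inverse: "0 < p \<Longrightarrow> ennpowr (ennpowr x p) (1 / p) = x"
  by (cases x) (auto simp: ennpowr_def powr_powr)

lemma ennpowr_cmult:
  assumes "0 < k" "0 < p"
  shows "ennpowr (ennreal k * x) p = ennreal (k powr p) * ennpowr x p"
  using assms by (cases x) (auto simp: ennpowr_ennreal ennreal_mult[symmetric] powr_mult ennreal_mult_top ennpowr_top[unfolded infinity_ennreal_def])

text \<open>The superlevel sets are intervals. This gives measurability of the capacity as a
  function of the level, for which no formula is available.\<close>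

lemma borel_measurable_antimono:
  fixes f :: "real \<Rightarrow> ennreal"
  assumes "antimono f"
  shows "f \<in> borel_measurable borel"
proof (rule borel_measurableI_greater)
  fix y
  have "is_interval {x. y < f x}"
    unfolding is_interval_1 using antimonoD[OF assms] by (auto intro: less_le_trans)
  then show "{x \<in> space borel. y < f x} \<in> sets borel" by (simp add: real_interval_borel_measurable)
qed

lemma nn_integral_powr_deriv:
  fixes a b p :: real
  assumes "0 < a" "a \<le> b" "1 \<le> p"
  shows "(\<integral>\<^sup>+t. ennreal (p * t powr (p - 1)) * indicator {a..b} t) = ennreal (b powr p - a powr p)"
proof (rule nn_integral_FTC_Icc)
  fix t assume "t \<in> {a..b}"
  then show "((\<lambda>t. t powr p) has_real_derivative p * t powr (p - 1)) (at t)"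
    using assms by (auto intro!: derivative_eq_intros)
qed (use assms in auto)

lemma nn_integral_powr_deriv_0:
  fixes b p :: real
  assumes "0 \<le> b" "1 \<le> p"
  shows "(\<integral>\<^sup>+t. ennreal (p * t powr (p - 1)) * indicator {0<..b} t) = ennreal (b powr p)"
proof -
  have "((\<lambda>t. p * t powr (p - 1)) has_integral (p * (b powr (p - 1 + 1) / (p - 1 + 1)))) {0..b}"
    using assms by (intro has_integral_mult_right has_integral_powr_from_0) auto
  then have "((\<lambda>t. if t \<in> {0..b} then p * t powr (p - 1) else 0) has_integral (b powr p)) UNIV"
    using assms by (subst has_integral_restrict_UNIV) simp
  then have "(\<integral>\<^sup>+t. ennreal (if t \<in> {0..b} then p * t powr (p - 1) else 0)) = ennreal (b powr p)"
    by (rule nn_integral_has_integral_lborel[rotated 2]) (use assms in auto)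
  moreover have "(\<integral>\<^sup>+t. ennreal (p * t powr (p - 1)) * indicator {0<..b} t)
     = (\<integral>\<^sup>+t. ennreal (if t \<in> {0..b} then p * t powr (p - 1) else 0))"
    by (intro nn_integral_cong) (auto simp: indicator_def)
  ultimately show ?thesis by simp
qed

text \<open>Convexity of \<open>z powr p\<close>: increments of fixed length grow with the base
  point.\<close>

lemma powr_increment_mono:
  fixes x y b p :: real
  assumes "0 < x" "x \<le> y" "0 \<le> b" "1 \<le> p"
  shows "(x + b) powr p - x powr p \<le> (y + b) powr p - y powr p"
proof (rule DERIV_nonneg_imp_nondecreasing[OF assms(2)])
  fix z assume z: "x \<le> z" "z \<le> y"
  have "((\<lambda>z. (z + b) powr p - z powr p) has_real_derivative p * (z + b) powr (p - 1) - p * z powr (p - 1)) (at z)"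
    using z assms by (auto intro!: derivative_eq_intros)
  moreover have "z powr (p - 1) \<le> (z + b) powr (p - 1)" using z assms by (intro powr_mono2) auto
  ultimately show "\<exists>d. ((\<lambda>z. (z + b) powr p - z powr p) has_real_derivative d) (at z) \<and> 0 \<le> d"
    using assms by (intro exI conjI) (assumption, simp add: mult_left_mono)
qed

text \<open>The preceding grid point, with 0 below the first one, so that the lowest slab starts at
  height 0.\<close>

definition lower_end :: "(nat \<Rightarrow> real) \<Rightarrow> nat \<Rightarrow> real" where
  "lower_end t i = (case i of 0 \<Rightarrow> 0 | Suc j \<Rightarrow> t j)"

lemma lower_end_simps [simp]: "lower_end t 0 = 0" "lower_end t (Suc i) = t i"
  by (auto simp: lower_end_def)

lemma sum_lower_end: "(\<Sum>i\<le>n. t i - lower_end t i) = t n"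
  by (induction n) auto

text \<open>A discrete form of the inequality between the integral of \<open>c^p\<close> against
  \<open>dt^p\<close> and the \<open>p\<close>-th power of the integral of \<open>c\<close>, for
  decreasing \<open>c\<close>. In the induction the new increment starts at \<open>t n * ?c\<close>,
  which is at most the sum \<open>A\<close> reached so far; by convexity it only grows when moved to
  \<open>A\<close>.\<close>

lemma sum_powr_le_powr_sum:
  fixes t c :: "nat \<Rightarrow> real"
  assumes t: "\<And>i. 0 < t i" "\<And>i. t i \<le> t (Suc i)" and c: "\<And>i. 0 \<le> c i" "\<And>i. c (Suc i) \<le> c i" and p: "1 \<le> p"
  shows "(\<Sum>i\<le>n. c i powr p * (t i powr p - lower_end t i powr p)) \<le> (\<Sum>i\<le>n. (t i - lower_end t i) * c i) powr p"
proof (induction n)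
  case 0
  then show ?case using t(1)[of 0] c(1)[of 0] by (simp add: powr_mult mult.commute)
next
  case (Suc n)
  define A where "A = (\<Sum>i\<le>n. (t i - lower_end t i) * c i)"
  let ?c = "c (Suc n)" and ?b = "(t (Suc n) - t n) * c (Suc n)"
  have anti: "?c \<le> c i" if "i \<le> n" for i
  proof -
    have "decseq c" using c(2) by (rule decseq_SucI)
    then show ?thesis using that by (auto simp: decseq_def)
  qed
  have w: "0 \<le> t i - lower_end t i" for i using t by (cases i) (auto simp: less_imp_le)
  \<comment> \<open>The left side is the sum \<open>A\<close> with every coefficient lowered to the
    last and smallest one.\<close>
  have "t n * ?c = (\<Sum>i\<le>n. (t i - lower_end t i) * ?c)" by (simp add: sum_distrib_right[symmetric] sum_lower_end)
  also have "\<dots> \<le> A" unfolding A_def using w anti by (intro sum_mono mult_left_mono) auto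
  finally have tA: "t n * ?c \<le> A" .
  have b: "0 \<le> ?b" using t(2)[of n] c(1) by simp
  have "?c powr p * (t (Suc n) powr p - t n powr p) \<le> (A + ?b) powr p - A powr p"
  proof (cases "?c = 0")
    case False
    then have pos: "0 < t n * ?c" using t(1)[of n] c(1)[of "Suc n"] by simp
    have "?c powr p * (t (Suc n) powr p - t n powr p) = (t n * ?c + ?b) powr p - (t n * ?c) powr p"
      using t(1)[of n] t(1)[of "Suc n"] c(1)[of "Suc n"] by (simp add: powr_mult[symmetric] algebra_simps)
    also have "\<dots> \<le> (A + ?b) powr p - A powr p" by (rule powr_increment_mono[OF pos tA b p])
    finally show ?thesis .
  qed auto
  then show ?case using Suc.IH by (simp add: A_def)
qed

text \<open>The slabs \<open>r i\<close> are nondecreasing functions of \<open>F\<close> with sum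
  \<open>min F (t n)\<close>, so their differences at two points all have the same sign and add up
  without cancellation.\<close>

lemma sobolev_cap_level_sum:
  fixes F :: "real ^ 'n \<Rightarrow> real"
  assumes F: "continuous_on UNIV F" "\<And>x. 0 \<le> F x" "\<And>x. R < norm x \<Longrightarrow> F x = 0"
    and t: "\<And>i. 0 < t i" "\<And>i. t i < t (Suc i)"
  shows "(\<Sum>i\<le>n. ennreal (t i - lower_end t i) * sobolev_cap \<alpha> {x. t i \<le> F x}) \<le> gagliardo \<alpha> F"
proof -
  have [measurable]: "F \<in> borel_measurable borel" using F(1) by (rule borel_measurable_continuous_onI)
  define a where "a i = t i - lower_end t i" for i
  define r where "r i x = min (max (F x - lower_end t i) 0) (a i)" for i x
  have a: "0 < a i" for i using t by (cases i) (auto simp: a_def)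
  have lo: "0 \<le> lower_end t i" for i using t by (cases i) (auto simp: less_imp_le)
  have [measurable]: "r i \<in> borel_measurable borel" for i unfolding r_def by measurable
  have cap: "sobolev_cap \<alpha> {x. t i \<le> F x} \<le> gagliardo \<alpha> (\<lambda>x. r i x / a i)" for i
  proof (rule sobolev_cap_le_gagliardo[of _ 1 R])
    show "0 \<le> r i x / a i" "r i x / a i \<le> 1" for x using a[of i] by (auto simp: r_def)
    show "r i x / a i = 0" if "R < norm x" for x using F(3)[OF that] lo[of i] a[of i] by (simp add: r_def)
    fix e :: real assume e: "0 < e"
    \<comment> \<open>The tolerance is scaled by the height \<open>a i\<close>, so that after
      division by it the slab is within \<open>e\<close> of 1 near the level set.\<close>
    obtain d where d: "0 < d" "\<And>x y. dist x y < d \<Longrightarrow> \<bar>F x - F y\<bar> \<le> e * a i"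
    proof -
      have "0 < e * a i" using e a[of i] by simp
      from compact_support_modulus[OF F(1,3) this] show ?thesis using that by blast
    qed
    have "1 - e \<le> r i (x - z) / a i" if x: "t i \<le> F x" and z: "norm z < d" for x z
    proof -
      have "t i - e * a i \<le> F (x - z)" using d(2)[of x "x - z"] z x by (simp add: dist_norm)
      moreover have "a i - e * a i \<le> a i" using e a[of i] by simp
      ultimately have "a i - e * a i \<le> r i (x - z)" unfolding r_def by (auto simp: a_def)
      then show ?thesis using a[of i] by (simp add: field_simps)
    qed
    then show "\<exists>d>0. \<forall>x\<in>{x. t i \<le> F x}. \<forall>z. norm z < d \<longrightarrow> 1 - e \<le> r i (x - z) / a i" using d(1) by blast
  qed measurable
  have scale: "ennreal (a i) * gagliardo \<alpha> (\<lambda>x. r i x / a i) = gagliardo \<alpha> (r i)" for i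
    using gagliardo_cmult[of "\<lambda>x. r i x / a i" \<alpha> "a i"] a[of i] by simp
  have step: "min u (t n) + min (max (u - t n) 0) (t (Suc n) - t n) = min u (t (Suc n))" for u n
    using t(2)[of n] by auto
  have tel: "(\<Sum>i\<le>n. min (max (u - lower_end t i) 0) (a i)) = min u (t n)" if "0 \<le> u" for u n
  proof (induction n)
    case 0 then show ?case using that t(1)[of 0] by (simp add: a_def)
  next
    case (Suc n) then show ?case using step[of u n] by (simp add: a_def)
  qed
  have sum: "(\<Sum>i\<le>n. \<bar>r i x - r i y\<bar>) \<le> \<bar>F x - F y\<bar>" for x y
  proof -
    have *: "(\<Sum>i\<le>n. \<bar>r i x - r i y\<bar>) \<le> \<bar>F x - F y\<bar>" if "F y \<le> F x" for x y
    proof -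
      have "\<bar>r i x - r i y\<bar> = r i x - r i y" for i using that by (auto simp: r_def)
      then have "(\<Sum>i\<le>n. \<bar>r i x - r i y\<bar>) = min (F x) (t n) - min (F y) (t n)"
        using tel[OF F(2)] by (simp add: sum_subtractf r_def)
      also have "\<dots> \<le> \<bar>F x - F y\<bar>" by auto
      finally show ?thesis .
    qed
    show ?thesis using *[of x y] *[of y x] by (cases "F y \<le> F x") (auto simp: abs_minus_commute)
  qed
  have "(\<Sum>i\<le>n. ennreal (a i) * sobolev_cap \<alpha> {x. t i \<le> F x}) \<le> (\<Sum>i\<le>n. gagliardo \<alpha> (r i))"
    by (intro sum_mono) (simp only: scale[symmetric] mult_left_mono[OF cap] zero_le)
  also have "\<dots> = (\<integral>\<^sup>+x. \<integral>\<^sup>+y. (\<Sum>i\<le>n. ennreal (\<bar>r i x - r i y\<bar> * kern \<alpha> (x - y))))"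
    unfolding gagliardo_def by (simp add: nn_integral_sum del: sum_ennreal)
  also have "\<dots> \<le> gagliardo \<alpha> F"
    unfolding gagliardo_def using sum
    by (intro nn_integral_mono) (simp add: sum_ennreal sum_distrib_right[symmetric] ennreal_leI mult_right_mono)
  finally show ?thesis by (simp add: a_def)
qed

lemma grid_interval_exists:
  fixes t :: "nat \<Rightarrow> real"
  assumes "t 0 \<le> x" "x < t n"
  shows "\<exists>i<n. t i \<le> x \<and> x < t (Suc i)"
  using assms
proof (induction n)
  case (Suc n)
  then show ?case by (cases "x < t n") (auto intro: less_SucI)
qed auto

context
  fixes \<alpha> N p q \<omega> :: real and P \<kappa> :: ennreal
  assumes alpha: "0 < \<alpha>" "\<alpha> < 1"
  defines "N \<equiv> real CARD('n::finite)" and "p \<equiv> N / (N - \<alpha>)" and "q \<equiv> (N - \<alpha>) / N"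
    and "\<omega> \<equiv> unit_ball_vol N" and "P \<equiv> perimeter \<alpha> (ball (0 :: real ^ 'n) 1)" and "\<kappa> \<equiv> kappa TYPE('n) \<alpha>"
begin

lemma N_ge_1: "1 \<le> N" by (simp add: N_def Suc_leI)

lemma p_gt_1: "1 < p" and q_pos: "0 < q" and p_minus_1: "\<alpha> / (N - \<alpha>) = p - 1"
  and inverse_p: "1 / p = q" and p_q: "p * q = 1" and q_p: "q * p = 1"
proof -
  have "N - \<alpha> > 0" using N_ge_1 alpha by simp
  then show "1 < p" "0 < q" "\<alpha> / (N - \<alpha>) = p - 1" "1 / p = q" "p * q = 1" "q * p = 1"
    using N_ge_1 alpha by (auto simp: p_def q_def field_simps)
qed

definition cap_density :: "(real ^ 'n \<Rightarrow> real) \<Rightarrow> real \<Rightarrow> ennreal" where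
  "cap_density f t = ennpowr (sobolev_cap \<alpha> {x. t \<le> \<bar>f x\<bar>}) p * ennreal (p * t powr (p - 1))"

lemma cap_integral_eq:
  fixes f :: "real ^ 'n \<Rightarrow> real"
  shows "cap_integral \<alpha> f = ennpowr (\<integral>\<^sup>+t\<in>{0<..}. cap_density f t \<partial>lborel) q"
  unfolding cap_integral_def cap_density_def Let_def N_def[symmetric] p_minus_1 p_def[symmetric] q_def[symmetric] ..

lemma sobolev_cap_level_antimono:
  fixes f :: "real ^ 'n \<Rightarrow> real"
  shows "antimono (\<lambda>t. sobolev_cap \<alpha> {x. t \<le> \<bar>f x\<bar>})"
  by (rule antimonoI, rule sobolev_cap_mono) auto

lemma borel_measurable_cap_density [measurable]: "cap_density f \<in> borel_measurable borel"
proof -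
  have "antimono (\<lambda>t. ennpowr (sobolev_cap \<alpha> {x. t \<le> \<bar>f x\<bar>}) p)"
    using p_gt_1 by (intro antimonoI ennpowr_mono antimonoD[OF sobolev_cap_level_antimono]) auto
  then have [measurable]: "(\<lambda>t. ennpowr (sobolev_cap \<alpha> {x. t \<le> \<bar>f x\<bar>}) p) \<in> borel_measurable borel"
    by (rule borel_measurable_antimono)
  show ?thesis unfolding cap_density_def by measurable
qed

text \<open>The grid is geometric because the weight of each interval is then at most \<open>C = l powr p\<close> times the
  weight of the preceding one, uniformly down to the lower cut-off \<open>e\<close>; in the limit \<open>C\<close> tends to 1.\<close>
lemma nn_integral_cap_density_le:
  fixes f :: "real ^ 'n \<Rightarrow> real"
  assumes f: "f \<in> test_functions" and g: "gagliardo \<alpha> (\<lambda>x. \<bar>f x\<bar>) = ennreal g" "0 \<le> g" and e: "0 < e"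
  shows "(\<integral>\<^sup>+t. cap_density f t * indicator {e..} t) \<le> ennreal (g powr p)"
proof (rule ennreal_le_of_factor_gt_1)
  fix C :: real assume C: "1 < C"
  define l where "l = C powr (1 / p)"
  have l: "1 < l" unfolding l_def using C p_gt_1 by (intro gr_one_powr) auto
  have lp: "l powr p = C" using C p_gt_1 by (simp add: l_def powr_powr)
  define t where "t i = e * l ^ i" for i
  have t: "0 < t i" "t i < t (Suc i)" for i using e l by (auto simp: t_def)
  obtain R where R: "\<And>x. R < norm x \<Longrightarrow> f x = 0" using test_functionsD(4)[OF f] by auto
  obtain M where M: "0 < M" "\<And>x. \<bar>f x\<bar> \<le> M" using compact_support_bounded[OF test_functionsD(2)[OF f] R] by metis
  \<comment> \<open>Beyond \<open>t n\<close> the level sets are empty, so finitely many intervals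
    suffice.\<close>
  obtain n where "M / e < l ^ n" using real_arch_pow[OF l] by blast
  then have n: "M < t n" using e by (simp add: t_def field_simps)
  let ?c = "\<lambda>t. sobolev_cap \<alpha> {x. t \<le> \<bar>f x\<bar>}"
  have sum_le: "(\<Sum>i\<le>n. ennreal (t i - lower_end t i) * ?c (t i)) \<le> ennreal g" for n
    unfolding g(1)[symmetric]
    by (rule sobolev_cap_level_sum[where R=R]) (use t R test_functionsD(2)[OF f] in \<open>auto intro: continuous_intros\<close>)
  have w: "0 < t i - lower_end t i" for i using t by (cases i) auto
  \<comment> \<open>The bound on the sum also makes each capacity finite, because its weight is
    positive; from here on real numbers can be used.\<close>
  have fin: "?c (t i) < \<infinity>" for i
  proof -
    have "ennreal (t i - lower_end t i) * ?c (t i) \<le> (\<Sum>i\<le>i. ennreal (t i - lower_end t i) * ?c (t i))"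
      by (rule member_le_sum) auto
    also have "\<dots> < \<infinity>" using sum_le[of i] by (rule le_less_trans) simp
    finally show ?thesis using w[of i] by (auto simp: ennreal_mult_less_top)
  qed
  define r where "r i = enn2real (?c (t i))" for i
  have r: "0 \<le> r i" "?c (t i) = ennreal (r i)" for i using fin[of i] by (auto simp: r_def)
  have rdec: "r (Suc i) \<le> r i" for i
  proof -
    have "?c (t (Suc i)) \<le> ?c (t i)" using antimonoD[OF sobolev_cap_level_antimono[of f] less_imp_le[OF t(2)[of i]]] .
    then show ?thesis using r by simp
  qed
  have sum_g: "(\<Sum>i\<le>n. (t i - lower_end t i) * r i) \<le> g"
    using sum_le[of n] w r g(2) by (simp add: ennreal_mult[symmetric] less_imp_le sum_ennreal)
  \<comment> \<open>On a grid interval the capacity is at most its value at the left end.\<close>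
  have dens: "cap_density f s * indicator {e..} s
     \<le> (\<Sum>i\<le>n. ennreal (r i powr p) * (ennreal (p * s powr (p - 1)) * indicator {t i..t (Suc i)} s))" for s
  proof (cases "e \<le> s \<and> s < t n")
    case True
    then obtain i where i: "i < n" "t i \<le> s" "s < t (Suc i)"
      using grid_interval_exists[of t s n] by (auto simp: t_def)
    have "?c s \<le> ?c (t i)" using antimonoD[OF sobolev_cap_level_antimono i(2)] .
    then have "ennpowr (?c s) p \<le> ennreal (r i powr p)"
      using ennpowr_mono[of "?c s" "?c (t i)" p] r[of i] p_gt_1 by (simp add: ennpowr_ennreal)
    then have "cap_density f s * indicator {e..} s \<le> ennreal (r i powr p) * (ennreal (p * s powr (p - 1)) * indicator {t i..t (Suc i)} s)"
      using True i by (simp add: cap_density_def mult_right_mono)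
    also have "\<dots> \<le> (\<Sum>i\<le>n. ennreal (r i powr p) * (ennreal (p * s powr (p - 1)) * indicator {t i..t (Suc i)} s))"
      using i by (intro member_le_sum) auto
    finally show ?thesis .
  next
    case False
    show ?thesis
    proof (cases "e \<le> s")
      case True
      then have "M < s" using False n by simp
      then have "{x. s \<le> \<bar>f x\<bar>} = {}" using M(2) by (auto simp: not_le intro: le_less_trans)
      then have "cap_density f s = 0" using p_gt_1 by (simp add: cap_density_def sobolev_cap_empty ennpowr_def)
      then show ?thesis by simp
    qed simp
  qed
  \<comment> \<open>Shifts the weights by one interval: capacities at left ends meet increments
    above them, while the slabs pair each capacity with the increment below. For the first interval
    \<open>lower_end t 0 = 0\<close> and the factor \<open>C - 1\<close> would suffice.\<close>
  have inc: "t (Suc i) powr p - t i powr p \<le> C * (t i powr p - lower_end t i powr p)" for i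
  proof (cases i)
    case 0
    have "t (Suc 0) powr p = C * t 0 powr p" using e l lp by (simp add: t_def powr_mult mult.commute)
    then show ?thesis using 0 p_gt_1 by simp
  next
    case (Suc j)
    have "t (Suc k) powr p = C * t k powr p" for k
      using e l by (simp add: t_def powr_mult lp mult_ac)
    then show ?thesis using Suc by (simp add: right_diff_distrib)
  qed
  have "(\<integral>\<^sup>+s. cap_density f s * indicator {e..} s)
    \<le> (\<integral>\<^sup>+s. (\<Sum>i\<le>n. ennreal (r i powr p) * (ennreal (p * s powr (p - 1)) * indicator {t i..t (Suc i)} s)))"
    by (intro nn_integral_mono dens)
  also have "\<dots> = (\<Sum>i\<le>n. ennreal (r i powr p) * ennreal (t (Suc i) powr p - t i powr p))"
    using t p_gt_1 by (simp add: nn_integral_sum nn_integral_cmult nn_integral_powr_deriv less_imp_le)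
  also have "\<dots> \<le> (\<Sum>i\<le>n. ennreal (r i powr p) * ennreal (C * (t i powr p - lower_end t i powr p)))"
    by (intro sum_mono mult_left_mono ennreal_leI inc) auto
  also have "\<dots> = ennreal (C * (\<Sum>i\<le>n. r i powr p * (t i powr p - lower_end t i powr p)))"
  proof -
    have nn: "0 \<le> t i powr p - lower_end t i powr p" for i
    proof -
      have "0 \<le> lower_end t i" using t(1) by (cases i) (auto simp: less_imp_le)
      then show ?thesis using w[of i] p_gt_1 by (simp add: powr_mono2)
    qed
    have "(\<Sum>i\<le>n. ennreal (r i powr p) * ennreal (C * (t i powr p - lower_end t i powr p)))
       = (\<Sum>i\<le>n. ennreal (C * (r i powr p * (t i powr p - lower_end t i powr p))))"
      using C nn by (intro sum.cong refl) (simp add: ennreal_mult[symmetric] mult_ac)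
    also have "\<dots> = ennreal (\<Sum>i\<le>n. C * (r i powr p * (t i powr p - lower_end t i powr p)))"
      using C nn by (intro sum_ennreal) auto
    finally show ?thesis by (simp add: sum_distrib_left)
  qed
  also have "\<dots> \<le> ennreal (C * g powr p)"
  proof (intro ennreal_leI mult_left_mono)
    have "(\<Sum>i\<le>n. r i powr p * (t i powr p - lower_end t i powr p)) \<le> (\<Sum>i\<le>n. (t i - lower_end t i) * r i) powr p"
      by (rule sum_powr_le_powr_sum) (use t r rdec p_gt_1 in \<open>auto simp: less_imp_le\<close>)
    also have "\<dots> \<le> g powr p" using sum_g w r p_gt_1 by (intro powr_mono2) (auto intro!: sum_nonneg simp: less_imp_le)
    finally show "(\<Sum>i\<le>n. r i powr p * (t i powr p - lower_end t i powr p)) \<le> g powr p" .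
  qed (use C in auto)
  finally show "(\<integral>\<^sup>+s. cap_density f s * indicator {e..} s) \<le> ennreal C * ennreal (g powr p)"
    using C by (simp add: ennreal_mult)
qed

text \<open>Monotone convergence removes the lower cut-off, and passing from \<open>f\<close> to
  \<open>\<bar>f\<bar>\<close> does not increase the seminorm.\<close>

lemma cap_integral_le_sobolev_norm:
  fixes f :: "real ^ 'n \<Rightarrow> real"
  assumes f: "f \<in> test_functions"
  shows "cap_integral \<alpha> f \<le> sobolev_norm \<alpha> f"
proof -
  have [measurable]: "f \<in> borel_measurable borel" by (rule test_functionsD(3)[OF f])
  have abs: "gagliardo \<alpha> (\<lambda>x. \<bar>f x\<bar>) \<le> sobolev_norm \<alpha> f"
    by (subst sobolev_norm_eq_gagliardo, simp, rule gagliardo_mono) auto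
  show ?thesis
  proof (cases "gagliardo \<alpha> (\<lambda>x. \<bar>f x\<bar>)")
    case (real g)
    let ?e = "\<lambda>k. inverse (real (Suc k))"
    have "(\<integral>\<^sup>+t\<in>{0<..}. cap_density f t \<partial>lborel) \<le> (\<integral>\<^sup>+t. (SUP k. cap_density f t * indicator {?e k..} t))"
    proof (rule nn_integral_mono)
      fix t :: real
      show "cap_density f t * indicator {0<..} t \<le> (SUP k. cap_density f t * indicator {?e k..} t)"
      proof (cases "0 < t")
        case True
        then obtain k where "?e k < t" using reals_Archimedean by blast
        then have "cap_density f t * indicator {0<..} t \<le> cap_density f t * indicator {?e k..} t" using True by simp
        also have "\<dots> \<le> (SUP k. cap_density f t * indicator {?e k..} t)" by (rule SUP_upper) simp
        finally show ?thesis .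
      qed simp
    qed
    also have "\<dots> = (SUP k. \<integral>\<^sup>+t. cap_density f t * indicator {?e k..} t)"
    proof (rule nn_integral_monotone_convergence_SUP)
      show "incseq (\<lambda>k t. cap_density f t * indicator {?e k..} t)"
        unfolding incseq_def le_fun_def
      proof (intro allI impI mult_left_mono)
        fix m n :: nat and t :: real assume "m \<le> n"
        then have "?e n \<le> ?e m" by (simp add: le_imp_inverse_le)
        then have "{?e m..} \<subseteq> {?e n..}" by (rule atLeast_subset_iff[THEN iffD2])
        then show "indicator {?e m..} t \<le> (indicator {?e n..} t :: ennreal)" by (intro indicator_leI) (rule subsetD)
      qed simp
    qed measurable
    also have "\<dots> \<le> ennreal (g powr p)"
      by (intro SUP_least nn_integral_cap_density_le f) (use real in auto)
    finally have "cap_integral \<alpha> f \<le> ennpowr (ennreal (g powr p)) q"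
      unfolding cap_integral_eq using q_pos by (rule ennpowr_mono)
    also have "\<dots> = ennreal g" using real by (simp add: ennpowr_ennreal powr_powr p_q)
    also have "\<dots> \<le> sobolev_norm \<alpha> f" using abs real by simp
    finally show ?thesis .
  qed (use abs in \<open>auto simp: top_unique\<close>)
qed

lemma unit_ball_measure: "emeasure lborel (ball (0 :: real ^ 'n) 1) = ennreal \<omega>" "0 < \<omega>"
  by (simp_all add: emeasure_ball N_def \<omega>_def)

lemma P_bounds: "0 < P" "P < \<infinity>"
  using perimeter_unit_ball_pos[OF alpha(1), where 'n='n] perimeter_unit_ball_finite[OF alpha, where 'n='n]
  by (simp_all add: P_def)

lemma kappa_eq:
  obtains k where "0 < k" "\<kappa> = ennreal k" "\<kappa> * (2 * P) = ennreal (\<omega> powr q)"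
proof -
  obtain c where c: "P = ennreal c" "0 < c" using P_bounds by (cases P) auto
  have two: "2 * P = ennreal (2 * c)" using c by (simp add: ennreal_mult)
  have k: "\<kappa> = ennreal (\<omega> powr q / (2 * c))"
    unfolding \<kappa>_def kappa_def Let_def P_def[symmetric] two N_def[symmetric] q_def[symmetric] unit_ball_measure(1)
    using unit_ball_measure(2) c(2) by (simp add: ennpowr_ennreal divide_ennreal del: ennreal_mult)
  show ?thesis
  proof (rule that[of "\<omega> powr q / (2 * c)"])
    show "\<kappa> * (2 * P) = ennreal (\<omega> powr q)"
      unfolding two k using c(2) by (subst ennreal_mult[symmetric]) auto
  qed (use c(2) k unit_ball_measure(2) in auto)
qed

lemma isocapacitary_inequality:
  fixes K :: "(real ^ 'n) set"
  assumes [measurable]: "K \<in> sets borel" and K: "bounded K"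
  shows "ennpowr (emeasure lborel K) q \<le> \<kappa> * sobolev_cap \<alpha> K"
proof -
  have fin: "emeasure lborel K < \<infinity>"
  proof -
    obtain R where "\<And>x. x \<in> K \<Longrightarrow> norm x \<le> R" using K unfolding bounded_iff by auto
    then have "K \<subseteq> cball 0 R" by auto
    then show ?thesis by (rule le_less_trans[OF emeasure_mono emeasure_lborel_cball_finite]) simp
  qed
  define m where "m = measure lborel K"
  have m: "emeasure lborel K = ennreal m" "0 \<le> m" using fin by (auto simp: m_def emeasure_eq_ennreal_measure)
  have "ennreal ((m / \<omega>) powr q) * (2 * P) \<le> sobolev_cap \<alpha> K"
    unfolding sobolev_cap_def
  proof (rule INF_greatest)
    fix f :: "real ^ 'n \<Rightarrow> real" assume "f \<in> {f \<in> test_functions. \<forall>x. indicator K x \<le> f x}"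
    then have f: "f \<in> test_functions" and fK: "\<And>x. indicator K x \<le> f x" by auto
    have [measurable]: "f \<in> borel_measurable borel" by (rule test_functionsD(3)[OF f])
    obtain R where R: "\<And>x. R < norm x \<Longrightarrow> f x = 0" using test_functionsD(4)[OF f] by auto
    have f0: "0 \<le> f x" for x using fK[of x] by (rule order_trans[rotated]) simp
    have sub: "{x. 1 \<le> f x} \<subseteq> cball 0 R" using R by (force simp: not_less[symmetric])
    have finf: "emeasure lborel {x. 1 \<le> f x} < \<infinity>"
      by (rule le_less_trans[OF emeasure_mono[OF sub] emeasure_lborel_cball_finite]) simp
    have "K \<subseteq> {x. 1 \<le> f x}"
    proof
      fix x assume "x \<in> K" then show "x \<in> {x. 1 \<le> f x}" using fK[of x] by simp
    qed
    then have "m \<le> measure lborel {x. 1 \<le> f x}"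
      unfolding m_def using finf by (intro measure_mono_fmeasurable) (auto simp: fmeasurable_def)
    then have "(m / \<omega>) powr q \<le> (measure lborel {x. 1 \<le> f x} / \<omega>) powr q"
      using m(2) unit_ball_measure(2) q_pos by (intro powr_mono2 divide_right_mono) auto
    then have "ennreal ((m / \<omega>) powr q) * (2 * P) \<le> ennreal ((measure lborel {x. 1 \<le> f x} / \<omega>) powr q) * (2 * P)"
      by (intro mult_right_mono ennreal_leI) auto
    also have "\<dots> \<le> gagliardo \<alpha> f"
      using gagliardo_ge_ball[OF alpha test_functionsD(2)[OF f] f0 R] by (simp add: N_def q_def \<omega>_def P_def)
    finally show "ennreal ((m / \<omega>) powr q) * (2 * P) \<le> sobolev_norm \<alpha> f"
      by (simp add: sobolev_norm_eq_gagliardo)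
  qed
  then have "\<kappa> * (ennreal ((m / \<omega>) powr q) * (2 * P)) \<le> \<kappa> * sobolev_cap \<alpha> K"
    by (rule mult_left_mono) simp
  moreover have "\<kappa> * (ennreal ((m / \<omega>) powr q) * (2 * P)) = ennpowr (emeasure lborel K) q"
  proof -
    obtain k where "\<kappa> * (2 * P) = ennreal (\<omega> powr q)" using kappa_eq by metis
    then have "\<kappa> * (ennreal ((m / \<omega>) powr q) * (2 * P)) = ennreal ((m / \<omega>) powr q) * ennreal (\<omega> powr q)"
      by (subst mult.left_commute) (simp only:)
    also have "\<dots> = ennreal (m powr q)"
      using m(2) unit_ball_measure(2) by (simp add: ennreal_mult[symmetric] powr_mult[symmetric])
    finally show ?thesis using m by (simp add: ennpowr_ennreal)
  qed
  ultimately show ?thesis by simp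
qed

lemma Lp_norm_le_cap_integral:
  fixes f :: "real ^ 'n \<Rightarrow> real"
  assumes f: "f \<in> test_functions"
  shows "Lp_norm p f \<le> \<kappa> * cap_integral \<alpha> f"
proof -
  have [measurable]: "f \<in> borel_measurable borel" by (rule test_functionsD(3)[OF f])
  obtain R where R: "\<And>x. R < norm x \<Longrightarrow> f x = 0" using test_functionsD(4)[OF f] by auto
  obtain k where k: "0 < k" "\<kappa> = ennreal k" using kappa_eq by metis
  let ?w = "\<lambda>t. ennreal (p * t powr (p - 1))"
  \<comment> \<open>Layer cake with respect to \<open>dt^p\<close>, the same measure as in
    \<open>cap_integral\<close>, so the two integrals can be compared level by level.\<close>
  have lc: "ennreal (\<bar>f x\<bar> powr p) = (\<integral>\<^sup>+t. ?w t * indicator {0<..\<bar>f x\<bar>} t)" for x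
    using nn_integral_powr_deriv_0[of "\<bar>f x\<bar>" p] p_gt_1 by simp
  have "(\<integral>\<^sup>+x. ennreal (\<bar>f x\<bar> powr p)) = (\<integral>\<^sup>+x. \<integral>\<^sup>+t. ?w t * indicator {0<..\<bar>f x\<bar>} t)"
    by (simp only: lc)
  also have "\<dots> = (\<integral>\<^sup>+t. \<integral>\<^sup>+x. ?w t * indicator {0<..\<bar>f x\<bar>} t)"
    by (rule lborel_pair.Fubini') (unfold indicator_def greaterThanAtMost_iff, measurable)
  also have "\<dots> \<le> (\<integral>\<^sup>+t. ennreal (k powr p) * (cap_density f t * indicator {0<..} t))"
  proof (rule nn_integral_mono)
    fix t :: real
    show "(\<integral>\<^sup>+x. ?w t * indicator {0<..\<bar>f x\<bar>} t) \<le> ennreal (k powr p) * (cap_density f t * indicator {0<..} t)"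
    proof (cases "0 < t")
      case True
      let ?K = "{x. t \<le> \<bar>f x\<bar>}"
      have [measurable]: "?K \<in> sets borel" by measurable
      have "?K \<subseteq> cball 0 R" using R True by (force simp: not_less[symmetric])
      then have bK: "bounded ?K" using bounded_cball bounded_subset by blast
      have "(\<integral>\<^sup>+x. ?w t * indicator {0<..\<bar>f x\<bar>} t) = (\<integral>\<^sup>+x. ?w t * indicator ?K x)"
        using True by (intro nn_integral_cong) (auto simp: indicator_def)
      also have "\<dots> = ?w t * emeasure lborel ?K" by (rule nn_integral_cmult_indicator) measurable
      finally have eq: "(\<integral>\<^sup>+x. ?w t * indicator {0<..\<bar>f x\<bar>} t) = ?w t * emeasure lborel ?K" .
      have "emeasure lborel ?K = ennpowr (ennpowr (emeasure lborel ?K) q) p"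
        using ennpowr_inverse[OF q_pos, of "emeasure lborel ?K"] p_gt_1 by (simp add: inverse_p[symmetric])
      also have "\<dots> \<le> ennpowr (\<kappa> * sobolev_cap \<alpha> ?K) p"
        using p_gt_1 by (intro ennpowr_mono isocapacitary_inequality bK) auto
      also have "\<dots> = ennreal (k powr p) * ennpowr (sobolev_cap \<alpha> ?K) p"
        unfolding k(2) using k(1) p_gt_1 by (intro ennpowr_cmult) auto
      finally have "?w t * emeasure lborel ?K \<le> ?w t * (ennreal (k powr p) * ennpowr (sobolev_cap \<alpha> ?K) p)"
        by (rule mult_left_mono) simp
      then show ?thesis unfolding eq using True by (simp add: cap_density_def mult_ac)
    qed (auto simp: indicator_def)
  qed
  also have "\<dots> = ennreal (k powr p) * (\<integral>\<^sup>+t\<in>{0<..}. cap_density f t \<partial>lborel)"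
    by (rule nn_integral_cmult) measurable
  finally have "Lp_norm p f \<le> ennpowr (ennreal (k powr p) * (\<integral>\<^sup>+t\<in>{0<..}. cap_density f t \<partial>lborel)) q"
    unfolding Lp_norm_def inverse_p using q_pos by (rule ennpowr_mono)
  also have "\<dots> = ennreal ((k powr p) powr q) * cap_integral \<alpha> f"
    unfolding cap_integral_eq using k(1) q_pos by (intro ennpowr_cmult) auto
  also have "(k powr p) powr q = k" using k(1) by (simp add: powr_powr p_q)
  finally show ?thesis by (simp add: k)
qed

section \<open>Sharpness of the constants\<close>

text \<open>A mollified indicator of the ball of radius \<open>1 + d\<close>, with mollification
  radius \<open>d\<close>, is exactly 1 on the unit ball; its norm is at most that of the indicator,
  which scaling evaluates.\<close>

lemma ball_cutoff_exists:
  assumes d: "0 < d"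
  obtains f :: "real ^ 'n \<Rightarrow> real" where "f \<in> test_functions" "\<And>x. 0 \<le> f x" "\<And>x. f x \<le> 1"
    "\<And>x. norm x \<le> 1 \<Longrightarrow> f x = 1" "\<And>x. 1 + 2 * d < norm x \<Longrightarrow> f x = 0"
    "sobolev_norm \<alpha> f \<le> ennreal ((1 + d) powr (N - \<alpha>)) * (2 * P)"
proof -
  let ?E = "ball (0 :: real ^ 'n) (1 + d)"
  define u where "u = (indicator ?E :: real ^ 'n \<Rightarrow> real)"
  have um: "u \<in> borel_measurable borel" unfolding u_def by (rule borel_measurable_indicator) simp
  have u: "\<And>x. 0 \<le> u x" "\<And>x. u x \<le> 1" "\<And>x. 1 + d < norm x \<Longrightarrow> u x = 0"
    unfolding u_def by simp_all
  obtain f where f: "f \<in> test_functions" "gagliardo \<alpha> f \<le> gagliardo \<alpha> u" "\<And>x. 1 + d + d < norm x \<Longrightarrow> f x = 0"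
    "\<And>x c. (\<And>z. norm z < d \<Longrightarrow> c \<le> u (x - z)) \<Longrightarrow> c \<le> f x"
    "\<And>x c. (\<And>z. norm z < d \<Longrightarrow> u (x - z) \<le> c) \<Longrightarrow> f x \<le> c"
    by (rule mollification_exists[OF um u d, where \<alpha>=\<alpha>]) auto
  have f01: "0 \<le> f x" "f x \<le> 1" for x by (intro f(4,5) u)+
  have f1: "f x = 1" if x: "norm x \<le> 1" for x
  proof -
    have "1 \<le> u (x - z)" if "norm z < d" for z
      using x that norm_triangle_ineq4[of x z] by (simp add: u_def)
    then show ?thesis using f(4)[of 1 x] f01(2)[of x] by (intro antisym) auto
  qed
  have "sobolev_norm \<alpha> f = gagliardo \<alpha> f" by (rule sobolev_norm_eq_gagliardo[OF test_functionsD(3)[OF f(1)]])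
  also note f(2)
  also have "gagliardo \<alpha> u = 2 * perimeter \<alpha> ?E" unfolding u_def by (rule gagliardo_indicator) simp
  also have "\<dots> = ennreal ((1 + d) powr (N - \<alpha>)) * (2 * P)"
    using d perimeter_ball_scale[of "1 + d" \<alpha>, where 'n='n] by (simp add: N_def P_def mult.left_commute)
  finally have "sobolev_norm \<alpha> f \<le> ennreal ((1 + d) powr (N - \<alpha>)) * (2 * P)" .
  with f01 f1 f(3) show ?thesis by (intro that[OF f(1)]) auto
qed

lemma Lp_norm_ge:
  fixes f :: "real ^ 'n \<Rightarrow> real"
  assumes "\<And>x. norm x \<le> 1 \<Longrightarrow> f x = 1"
  shows "ennreal (\<omega> powr q) \<le> Lp_norm p f"
proof -
  have "ennreal \<omega> = (\<integral>\<^sup>+x. indicator (ball (0 :: real ^ 'n) 1) x)"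
    using unit_ball_measure by simp
  also have "\<dots> \<le> (\<integral>\<^sup>+x. ennreal (\<bar>f x\<bar> powr p))"
    using assms by (intro nn_integral_mono) (auto simp: indicator_def)
  finally have "ennpowr (ennreal \<omega>) q \<le> Lp_norm p f"
    unfolding Lp_norm_def inverse_p using q_pos by (rule ennpowr_mono)
  then show ?thesis using unit_ball_measure(2) by (simp add: ennpowr_ennreal)
qed

lemma le_of_scaled_balls:
  assumes "\<And>d. 0 < d \<Longrightarrow> a \<le> ennreal ((1 + c * d) powr (N - \<alpha>)) * b" and c: "0 < c"
  shows "a \<le> b"
proof (rule ennreal_le_of_factor_gt_1)
  fix C :: real assume C: "1 < C"
  have na: "0 < N - \<alpha>" using N_ge_1 alpha by simp
  \<comment> \<open>Chosen so that the scaling factor is exactly \<open>C\<close>.\<close>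
  define d where "d = (C powr (1 / (N - \<alpha>)) - 1) / c"
  have "1 < C powr (1 / (N - \<alpha>))" using C na by (intro gr_one_powr) auto
  then have d: "0 < d" using c by (simp add: d_def)
  have "(1 + c * d) powr (N - \<alpha>) = C" using c C na by (simp add: d_def powr_powr)
  then show "a \<le> ennreal C * b" using assms(1)[OF d] by simp
qed

text \<open>Level sets lie in the closed ball for \<open>0 < t \<le> 1\<close> and are empty above
  1, and the interval from 0 to 1 has \<open>dt^p\<close>-measure 1.\<close>

lemma cap_integral_cutoff_le:
  fixes f :: "real ^ 'n \<Rightarrow> real"
  assumes f: "\<And>x. 0 \<le> f x" "\<And>x. f x \<le> 1" "\<And>x. r < norm x \<Longrightarrow> f x = 0"
  shows "cap_integral \<alpha> f \<le> sobolev_cap \<alpha> (cball (0 :: real ^ 'n) r)"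
proof -
  let ?Q = "ennpowr (sobolev_cap \<alpha> (cball (0 :: real ^ 'n) r)) p"
  have "(\<integral>\<^sup>+t\<in>{0<..}. cap_density f t \<partial>lborel) \<le> (\<integral>\<^sup>+t. ?Q * (ennreal (p * t powr (p - 1)) * indicator {0<..1} t))"
  proof (rule nn_integral_mono)
    fix t :: real
    show "cap_density f t * indicator {0<..} t \<le> ?Q * (ennreal (p * t powr (p - 1)) * indicator {0<..1} t)"
    proof (cases "0 < t")
      case True
      show ?thesis
      proof (cases "t \<le> 1")
        case le: True
        have "{x. t \<le> \<bar>f x\<bar>} \<subseteq> cball 0 r"
        proof
          fix x assume "x \<in> {x. t \<le> \<bar>f x\<bar>}"
          then have "f x \<noteq> 0" using True by auto
          then show "x \<in> cball 0 r" using f(3)[of x] by force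
        qed
        then have "ennpowr (sobolev_cap \<alpha> {x. t \<le> \<bar>f x\<bar>}) p \<le> ?Q"
          using p_gt_1 by (intro ennpowr_mono sobolev_cap_mono) auto
        then show ?thesis using True le by (simp add: cap_density_def mult_right_mono)
      next
        case False
        have "\<bar>f x\<bar> \<le> 1" for x using f(1,2)[of x] by simp
        then have "{x. t \<le> \<bar>f x\<bar>} = {}" using False by (auto simp: not_le intro: le_less_trans)
        then show ?thesis using p_gt_1 by (simp add: cap_density_def sobolev_cap_empty ennpowr_def)
      qed
    qed simp
  qed
  also have "\<dots> = ?Q * (\<integral>\<^sup>+t. ennreal (p * t powr (p - 1)) * indicator {0<..1} t)"
    by (rule nn_integral_cmult) measurable
  also have "\<dots> = ?Q" using nn_integral_powr_deriv_0[of 1 p] p_gt_1 by simp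
  finally have "cap_integral \<alpha> f \<le> ennpowr ?Q q"
    unfolding cap_integral_eq using q_pos by (rule ennpowr_mono)
  also have "\<dots> = sobolev_cap \<alpha> (cball (0 :: real ^ 'n) r)"
    using ennpowr_inverse[of p] p_gt_1 by (simp add: inverse_p)
  finally show ?thesis .
qed

lemma sobolev_cap_cball_le:
  assumes "0 < r" "r < s"
  shows "sobolev_cap \<alpha> (cball (0 :: real ^ 'n) r) \<le> ennreal (s powr (N - \<alpha>)) * (2 * P)"
proof -
  have "sobolev_cap \<alpha> (cball (0 :: real ^ 'n) r) \<le> 2 * perimeter \<alpha> (ball (0 :: real ^ 'n) s)"
    using assms by (intro sobolev_cap_le_perimeter) auto
  also have "\<dots> = ennreal (s powr (N - \<alpha>)) * (2 * P)"
    using assms perimeter_ball_scale[of s \<alpha>, where 'n='n] by (simp add: N_def P_def mult.left_commute)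
  finally show ?thesis .
qed

lemma kappa_le_of:
  assumes "ennreal (\<omega> powr q) \<le> c * (2 * P)"
  shows "\<kappa> \<le> c"
proof -
  have "\<kappa> * (2 * P) \<le> c * (2 * P)"
    using assms kappa_eq by metis
  moreover have "2 * P \<noteq> 0" "2 * P \<noteq> top"
    using P_bounds by (auto simp: ennreal_mult_eq_top_iff)
  ultimately show ?thesis
    using ennreal_mult_le_mult_iff[of "2 * P" \<kappa> c] by (simp add: mult.commute)
qed

text \<open>For a cutoff of the unit ball the left side is at least \<open>\<omega> powr q\<close>,
  while the capacity integral is at most that of a slightly larger ball. The radius
  \<open>1 + 3 * d\<close> leaves room for the strict enlargement of \<open>1 + 2 * d\<close>
  required by the capacity bound.\<close>

lemma Lp_cap_integral_sharp:
  assumes c: "\<And>f. f \<in> (test_functions :: (real ^ 'n \<Rightarrow> real) set) \<Longrightarrow> Lp_norm p f \<le> c * cap_integral \<alpha> f"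
  shows "\<kappa> \<le> c"
proof (rule kappa_le_of, rule le_of_scaled_balls[where c=3])
  fix d :: real assume d: "0 < d"
  obtain f :: "real ^ 'n \<Rightarrow> real" where f: "f \<in> test_functions" "\<And>x. 0 \<le> f x" "\<And>x. f x \<le> 1"
    "\<And>x. norm x \<le> 1 \<Longrightarrow> f x = 1" "\<And>x. 1 + 2 * d < norm x \<Longrightarrow> f x = 0"
    using ball_cutoff_exists[OF d] by metis
  have "ennreal (\<omega> powr q) \<le> c * cap_integral \<alpha> f" using Lp_norm_ge[of f] f(4) c[OF f(1)] by (meson order_trans)
  also have "cap_integral \<alpha> f \<le> sobolev_cap \<alpha> (cball (0 :: real ^ 'n) (1 + 2 * d))" by (rule cap_integral_cutoff_le) (use f in auto)
  also have "\<dots> \<le> ennreal ((1 + 3 * d) powr (N - \<alpha>)) * (2 * P)"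
    using d by (intro sobolev_cap_cball_le) auto
  finally show "ennreal (\<omega> powr q) \<le> ennreal ((1 + 3 * d) powr (N - \<alpha>)) * (c * (2 * P))"
    by (simp add: mult_left_mono mult.left_commute)
qed simp

lemma isocapacitary_sharp:
  assumes "ennpowr (emeasure lborel (ball (0 :: real ^ 'n) 1)) q \<le> c * sobolev_cap \<alpha> (closure (ball (0 :: real ^ 'n) 1))"
  shows "\<kappa> \<le> c"
proof (rule kappa_le_of, rule le_of_scaled_balls[where c=1])
  fix d :: real assume d: "0 < d"
  have "ennreal (\<omega> powr q) \<le> c * sobolev_cap \<alpha> (cball (0 :: real ^ 'n) 1)"
    using assms unit_ball_measure by (simp add: ennpowr_ennreal)
  also have "sobolev_cap \<alpha> (cball (0 :: real ^ 'n) 1) \<le> ennreal ((1 + 1 * d) powr (N - \<alpha>)) * (2 * P)"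
    using d by (intro sobolev_cap_cball_le) auto
  finally show "ennreal (\<omega> powr q) \<le> ennreal ((1 + 1 * d) powr (N - \<alpha>)) * (c * (2 * P))"
    by (simp add: mult_left_mono mult.left_commute)
qed simp

lemma one_le_of:
  assumes "ennreal (\<omega> powr q) \<le> c * ennreal (\<omega> powr q)"
  shows "1 \<le> c"
  using assms ennreal_mult_le_mult_iff[of "ennreal (\<omega> powr q)" 1 c] unit_ball_measure(2)
  by (simp add: mult.commute)

text \<open>(A) supplies the lower bound for the capacity integral of a cutoff, whose norm is almost
  \<open>2 * P\<close>. As \<open>\<kappa> * (2 * P) = \<omega> powr q\<close>, nothing is lost in
  the chain from (A) to (C), and this forces \<open>1 \<le> c\<close>.\<close>

lemma cap_integral_sobolev_sharp:
  assumes c: "\<And>f. f \<in> (test_functions :: (real ^ 'n \<Rightarrow> real) set) \<Longrightarrow> cap_integral \<alpha> f \<le> c * sobolev_norm \<alpha> f"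
  shows "1 \<le> c"
proof (rule one_le_of, rule le_of_scaled_balls[where c=1])
  fix d :: real assume d: "0 < d"
  obtain f :: "real ^ 'n \<Rightarrow> real" where f: "f \<in> test_functions" "\<And>x. norm x \<le> 1 \<Longrightarrow> f x = 1"
    "sobolev_norm \<alpha> f \<le> ennreal ((1 + d) powr (N - \<alpha>)) * (2 * P)"
    using ball_cutoff_exists[OF d] by metis
  obtain k where k: "\<kappa> * (2 * P) = ennreal (\<omega> powr q)" using kappa_eq by metis
  have "ennreal (\<omega> powr q) \<le> \<kappa> * cap_integral \<alpha> f"
    using Lp_norm_ge[of f] f(2) Lp_norm_le_cap_integral[OF f(1)] by (meson order_trans)
  also have "\<dots> \<le> \<kappa> * (c * (ennreal ((1 + d) powr (N - \<alpha>)) * (2 * P)))"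
    by (intro mult_left_mono order_trans[OF c[OF f(1)]] f(3)) auto
  also have "\<dots> = ennreal ((1 + 1 * d) powr (N - \<alpha>)) * (c * (\<kappa> * (2 * P)))"
    by (simp add: mult_ac)
  finally show "ennreal (\<omega> powr q) \<le> ennreal ((1 + 1 * d) powr (N - \<alpha>)) * (c * ennreal (\<omega> powr q))"
    by (simp only: k)
qed simp

text \<open>By the isocapacitary inequality the closed unit ball has capacity at least
  \<open>2 * P\<close>.\<close>

lemma cap_perimeter_sharp:
  assumes "sobolev_cap \<alpha> (closure (ball (0 :: real ^ 'n) 1)) \<le> c * P"
  shows "2 \<le> c"
proof -
  obtain k where k: "\<kappa> * (2 * P) = ennreal (\<omega> powr q)" using kappa_eq by metis
  have "ennpowr (emeasure lborel (ball (0 :: real ^ 'n) 1)) q \<le> ennpowr (emeasure lborel (cball (0 :: real ^ 'n) 1)) q"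
    using q_pos by (intro ennpowr_mono emeasure_mono) auto
  then have "\<kappa> * (2 * P) \<le> \<kappa> * sobolev_cap \<alpha> (cball (0 :: real ^ 'n) 1)"
    unfolding k using isocapacitary_inequality[of "cball (0 :: real ^ 'n) 1"] unit_ball_measure
    by (simp add: ennpowr_ennreal)
  moreover have "\<kappa> \<noteq> 0" "\<kappa> \<noteq> top" using kappa_eq by (metis ennreal_eq_0_iff not_le, metis ennreal_neq_top)
  ultimately have "2 * P \<le> sobolev_cap \<alpha> (cball (0 :: real ^ 'n) 1)"
    by (simp add: ennreal_mult_le_mult_iff)
  also have "\<dots> \<le> c * P" using assms by simp
  finally show ?thesis
    using P_bounds ennreal_mult_le_mult_iff[of P 2 c] by (simp add: mult.commute)
qed

end

theorem theorem3:
  fixes \<alpha> :: real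
  assumes "0 < \<alpha>" and "\<alpha> < 1"
  shows "let n = real CARD('n::finite);
             \<kappa> = kappa TYPE('n) \<alpha>;
             A = (\<lambda>c. \<forall>f \<in> (test_functions :: (real ^ 'n \<Rightarrow> real) set).
                    Lp_norm (n / (n - \<alpha>)) f \<le> c * cap_integral \<alpha> f);
             B = (\<lambda>c. \<forall>S \<in> (smooth_domains :: (real ^ 'n) set set).
                    ennpowr (emeasure lborel S) ((n - \<alpha>) / n) \<le> c * sobolev_cap \<alpha> (closure S));
             C = (\<lambda>c. \<forall>f \<in> (test_functions :: (real ^ 'n \<Rightarrow> real) set).
                    cap_integral \<alpha> f \<le> c * sobolev_norm \<alpha> f);
             D = (\<lambda>c. \<forall>S \<in> (smooth_domains :: (real ^ 'n) set set).
                    sobolev_cap \<alpha> (closure S) \<le> c * perimeter \<alpha> S)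
         in ((A \<kappa> \<longleftrightarrow> B \<kappa>) \<and> (A \<kappa> \<and> B \<kappa>) \<and> (\<forall>c<\<kappa>. \<not> A c) \<and> (\<forall>c<\<kappa>. \<not> B c)) \<and>
            ((C 1 \<longleftrightarrow> D 2) \<and> (C 1 \<and> D 2) \<and> (\<forall>c<1. \<not> C c) \<and> (\<forall>c<2. \<not> D c))"
proof -
  let ?n = "real CARD('n)" and ?k = "kappa TYPE('n) \<alpha>"
  \<comment> \<open>A single domain, the unit ball, is enough to test (B) and (D).\<close>
  note B1 = ball_smooth_domain[where 'n='n]
  have A: "Lp_norm (?n / (?n - \<alpha>)) f \<le> ?k * cap_integral \<alpha> f"
    if "f \<in> test_functions" for f :: "real ^ 'n \<Rightarrow> real"
    using Lp_norm_le_cap_integral[OF assms that] .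
  have B: "ennpowr (emeasure lborel S) ((?n - \<alpha>) / ?n) \<le> ?k * sobolev_cap \<alpha> (closure S)"
    if "S \<in> smooth_domains" for S :: "(real ^ 'n) set"
  proof -
    have "0 < (?n - \<alpha>) / ?n" by (rule q_pos[OF assms])
    then have "ennpowr (emeasure lborel S) ((?n - \<alpha>) / ?n) \<le> ennpowr (emeasure lborel (closure S)) ((?n - \<alpha>) / ?n)"
      by (intro ennpowr_mono emeasure_mono closure_subset) auto
    also have "\<dots> \<le> ?k * sobolev_cap \<alpha> (closure S)"
      using that by (intro isocapacitary_inequality[OF assms]) (auto simp: smooth_domains_def bounded_closure)
    finally show ?thesis .
  qed
  have C: "cap_integral \<alpha> f \<le> 1 * sobolev_norm \<alpha> f"
    if "f \<in> test_functions" for f :: "real ^ 'n \<Rightarrow> real"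
    using cap_integral_le_sobolev_norm[OF assms that] by simp
  have D: "sobolev_cap \<alpha> (closure S) \<le> 2 * perimeter \<alpha> S"
    if "S \<in> smooth_domains" for S :: "(real ^ 'n) set"
    using that assms by (intro sobolev_cap_closure_le) (auto simp: smooth_domains_def)
  have A': "?k \<le> c" if "\<forall>f \<in> (test_functions :: (real ^ 'n \<Rightarrow> real) set). Lp_norm (?n / (?n - \<alpha>)) f \<le> c * cap_integral \<alpha> f" for c
    by (rule Lp_cap_integral_sharp[OF assms]) (use that in blast)
  have B': "?k \<le> c" if "\<forall>S \<in> (smooth_domains :: (real ^ 'n) set set). ennpowr (emeasure lborel S) ((?n - \<alpha>) / ?n) \<le> c * sobolev_cap \<alpha> (closure S)" for c
    by (rule isocapacitary_sharp[OF assms]) (use that B1 in blast)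
  have C': "1 \<le> c" if "\<forall>f \<in> (test_functions :: (real ^ 'n \<Rightarrow> real) set). cap_integral \<alpha> f \<le> c * sobolev_norm \<alpha> f" for c
    by (rule cap_integral_sobolev_sharp[OF assms]) (use that in blast)
  have D': "2 \<le> c" if "\<forall>S \<in> (smooth_domains :: (real ^ 'n) set set). sobolev_cap \<alpha> (closure S) \<le> c * perimeter \<alpha> S" for c
    by (rule cap_perimeter_sharp[OF assms, where 'n='n]) (use that B1 in blast)
  show ?thesis unfolding Let_def
    \<comment> \<open>Sharpness is proved in contrapositive form: any \<open>c\<close> for which an
      inequality holds is at least its constant.\<close>
    using A B C D A' B' C' D' by (meson not_le)
qed

end
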